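(* Let $L=\bigcup_{n\in\mathbb{N}}L_n$ be a countable alphabet with each $L_n$ finite and $L_n\subseteq L_{n+1}$, and let $v\notin L$. For every $\Lambda\subseteq2^{\infty}\times W_L^{[\infty]}$: 1. $\Lambda$ is perfectly $W_{Lv}^{[\infty]}$-Ramsey if and only if $\Lambda$ is perfectly $W_{Lv}^{[\infty]}$-Baire. 2. $\Lambda$ is perfectly $W_{Lv}^{[\infty]}$-Ramsey null if and only if $\Lambda$ is perfectly $W_{Lv}^{[\infty]}$-meager.
   Context: **The Hales–Jewett space.** $W_L$ is the semigroup (under concatenation) of words over $L$, and $W_{Lv}$ the semigroup of variable words over $L$, i.e. words over $L\cup\{v\}$ in which the variable $v$ occurs. For $x\in W_{Lv}$ and $\lambda\in L\cup\{v\}$, $x[\lambda]$ is the word obtained by replacing every occurrence of $v$ in $x$ by $\lambda$ (so $x[v]=x$). $|x|$ denotes the length of a word. A sequence $(x_n)_n$ of words is rapidly increasing if $|x_n|>\sum_{i=0}^{n-1}|x_i|$ for all $n$. $W_L^{[\infty]}$ (resp. $W_{Lv}^{[\infty]}$) is the set of infinite rapidly increasing sequences of elements of $W_L$ (resp. $W_{Lv}$). For $A=(w_n)_n\in W_L^{[\infty]}$ and $Y=(y_n)_n\in W_{Lv}^{[\infty]}$ put $r_n(A)=(w_0,\dots,w_{n-1})$ and $s_n(Y)=(y_0,\dots,y_{n-1})$; $\mathcal{AR}=\{r_n(A): A\in W_L^{[\infty]},n\in\mathbb N\}$. For $X=(x_n)_n\in W_{Lv}^{[\infty]}$ let $$[X]_L=\{x_{n_0}[\lambda_0]^\frown\cdots^\frown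 x_{n_k}[\lambda_k]\in W_L: n_0<\cdots<n_k,\ \lambda_i\in L_{n_i}\},$$ $$[X]_{Lv}=\{x_{n_0}[\lambda_0]^\frown\cdots^\frown x_{n_k}[\lambda_k]\in W_{Lv}: n_0<\cdots<n_k,\ \lambda_i\in L_{n_i}\cup\{v\}\}.$$ For $w\in[X]_L\cup[X]_{Lv}$, $supp_X(w)$ is the unique set $\{n_0<\cdots<n_k\}$ occurring in such a representation of $w$. For $Y=(y_n)_n\in W_{Lv}^{[\infty]}$, $Y\leq X$ means $y_n\in[X]_{Lv}$ for all $n$ and $\max supp_X(y_n)<\min supp_X(y_m)$ whenever $n<m$. For $A=(w_n)_n\in W_L^{[\infty]}$, $A\leq^0X$ means $w_n\in[X]_L$ for all $n$ and $\max supp_X(w_n)<\min supp_X(w_m)$ whenever $n<m$. For $a\in\mathcal{AR}$ and $Y\in W_{Lv}^{[\infty]}$: $[a,Y]=\{A\in W_L^{[\infty]}: A\leq^0Y,\ \exists n\,(r_n(A)=a)\}$; $[n,Y]=\{X\in W_{Lv}^{[\infty]}: X\leq Y,\ s_n(X)=s_n(Y)\}$. For $a=(w_0,\dots,w_{l-1})\in\mathcal{AR}$, $depth_Y(a)$ is the least $k$ such that $w_0,\dots,w_{l-1}\in[Y]_L$, $\max supp_Y(w_i)<\min supp_Y(w_j)$ for $i<j<l$, and all the supports $supp_Y(w_i)$ are contained in $\{0,\dots,k-1\}$; it is $-1$ if there is no such $k$. **Parametrized notions.** $2^\infty$ is the Cantor space. $\mathbb{P}$ is the family of perfect subsets of $2^{\infty}$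 (nonempty, closed, without isolated points); $M\in\mathbb{P}\upharpoonright Q$ means $M\in\mathbb{P}$ and $M\subseteq Q$. Let $\Lambda\subseteq2^\infty\times W_L^{[\infty]}$. - $\Lambda$ is perfectly $W_{Lv}^{[\infty]}$-Ramsey if for every $Q\in\mathbb{P}$ and every $[a,Y]\neq\emptyset$ ($a\in\mathcal{AR}$, $Y\in W_{Lv}^{[\infty]}$) there are $M\in\mathbb{P}\upharpoonright Q$ and $X\in[depth_Y(a),Y]$ with $[a,X]\neq\emptyset$ such that $M\times[a,X]\subseteq\Lambda$ or $M\times[a,X]\subseteq\Lambda^c$. It is perfectly $W_{Lv}^{[\infty]}$-Ramsey null if one can always achieve $M\times[a,X]\subseteq\Lambda^c$. - $\Lambda$ is perfectly $W_{Lv}^{[\infty]}$-Baire if for every $Q\in\mathbb{P}$ and every $[a,Y]\neq\emptyset$ there are $M\in\mathbb{P}\upharpoonright Q$ and a nonempty $[b,X]\subseteq[a,Y]$ ($b\in\mathcal{AR}$, $X\in W_{Lv}^{[\infty]}$) such that $M\times[b,X]\subseteq\Lambda$ or $M\times[b,X]\subseteq\Lambda^c$. It is perfectly $W_{Lv}^{[\infty]}$-meager if one can always achieve $M\times[b,X]\subseteq\Lambda^c$. *)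

theory Defs
  imports "HOL-Analysis.Analysis"
begin

(* The filtered alphabet is a sequence L of sets of letters, with union \<Union>n. L n; the variable v
   is a letter of the same type, assumed to lie outside of this union. *)

definition words :: "(nat \<Rightarrow> 'a set) \<Rightarrow> 'a list set" where
  "words L = lists (\<Union>n. L n)"

definition var_words :: "(nat \<Rightarrow> 'a set) \<Rightarrow> 'a \<Rightarrow> 'a list set" where
  "var_words L v = {x \<in> lists (insert v (\<Union>n. L n)). v \<in> set x}"

definition subst_var :: "'a \<Rightarrow> 'a list \<Rightarrow> 'a \<Rightarrow> 'a list" where
  "subst_var v x c = map (\<lambda>d. if d = v then c else d) x"

(* For n = 0 the sum is empty, so every term of such a sequence is a nonempty word. *)
definition rapidly_increasing :: "(nat \<Rightarrow> 'a list) \<Rightarrow> bool" where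
  "rapidly_increasing x \<longleftrightarrow> (\<forall>n. (\<Sum>i<n. length (x i)) < length (x n))"

definition word_seqs :: "(nat \<Rightarrow> 'a set) \<Rightarrow> (nat \<Rightarrow> 'a list) set" where
  "word_seqs L = {A. (\<forall>n. A n \<in> words L) \<and> rapidly_increasing A}"

definition var_word_seqs :: "(nat \<Rightarrow> 'a set) \<Rightarrow> 'a \<Rightarrow> (nat \<Rightarrow> 'a list) set" where
  "var_word_seqs L v = {X. (\<forall>n. X n \<in> var_words L v) \<and> rapidly_increasing X}"

(* Both r_n and s_n. *)
definition initial :: "nat \<Rightarrow> (nat \<Rightarrow> 'a list) \<Rightarrow> 'a list list" where
  "initial n A = map A [0..<n]"

definition approximations :: "(nat \<Rightarrow> 'a set) \<Rightarrow> 'a list list set" where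
  "approximations L = {initial n A | n A. A \<in> word_seqs L}"

(* w = x_{n_0}[f n_0] ^ ... ^ x_{n_k}[f n_k], where F = {n_0 < ... < n_k} is nonempty and
   f n is in K n for each n in F. *)
definition is_combination ::
  "'a \<Rightarrow> (nat \<Rightarrow> 'a set) \<Rightarrow> (nat \<Rightarrow> 'a list) \<Rightarrow> nat set \<Rightarrow> 'a list \<Rightarrow> bool" where
  "is_combination v K X F w \<longleftrightarrow> finite F \<and> F \<noteq> {} \<and>
     (\<exists>f. (\<forall>n\<in>F. f n \<in> K n) \<and>
          w = concat (map (\<lambda>n. subst_var v (X n) (f n)) (sorted_list_of_set F)))"

definition span_words :: "(nat \<Rightarrow> 'a set) \<Rightarrow> 'a \<Rightarrow> (nat \<Rightarrow> 'a list) \<Rightarrow> 'a list set" where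
  "span_words L v X = {w \<in> words L. \<exists>F. is_combination v L X F w}"

definition span_var_words :: "(nat \<Rightarrow> 'a set) \<Rightarrow> 'a \<Rightarrow> (nat \<Rightarrow> 'a list) \<Rightarrow> 'a list set" where
  "span_var_words L v X =
     {w \<in> var_words L v. \<exists>F. is_combination v (\<lambda>n. insert v (L n)) X F w}"

(* Allowing v as a value covers the representations of elements of both spans. The set F is unique
   because X is rapidly increasing: the length of w is the sum of the lengths of X n for n in F. *)
definition supp :: "(nat \<Rightarrow> 'a set) \<Rightarrow> 'a \<Rightarrow> (nat \<Rightarrow> 'a list) \<Rightarrow> 'a list \<Rightarrow> nat set" where
  "supp L v X w = (THE F. is_combination v (\<lambda>n. insert v (L n)) X F w)"

definition var_seq_le ::
  "(nat \<Rightarrow> 'a set) \<Rightarrow> 'a \<Rightarrow> (nat \<Rightarrow> 'a list) \<Rightarrow> (nat \<Rightarrow> 'a list) \<Rightarrow> bool" where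
  "var_seq_le L v Y X \<longleftrightarrow>
     (\<forall>n. Y n \<in> span_var_words L v X) \<and>
     (\<forall>n m. n < m \<longrightarrow> Max (supp L v X (Y n)) < Min (supp L v X (Y m)))"

definition word_seq_le ::
  "(nat \<Rightarrow> 'a set) \<Rightarrow> 'a \<Rightarrow> (nat \<Rightarrow> 'a list) \<Rightarrow> (nat \<Rightarrow> 'a list) \<Rightarrow> bool" where
  "word_seq_le L v A X \<longleftrightarrow>
     (\<forall>n. A n \<in> span_words L v X) \<and>
     (\<forall>n m. n < m \<longrightarrow> Max (supp L v X (A n)) < Min (supp L v X (A m)))"

(* [a,Y] *)
definition basic_set ::
  "(nat \<Rightarrow> 'a set) \<Rightarrow> 'a \<Rightarrow> 'a list list \<Rightarrow> (nat \<Rightarrow> 'a list) \<Rightarrow> (nat \<Rightarrow> 'a list) set" where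
  "basic_set L v a Y = {A \<in> word_seqs L. word_seq_le L v A Y \<and> (\<exists>n. initial n A = a)}"

(* [n,Y] *)
definition var_basic_set ::
  "(nat \<Rightarrow> 'a set) \<Rightarrow> 'a \<Rightarrow> nat \<Rightarrow> (nat \<Rightarrow> 'a list) \<Rightarrow> (nat \<Rightarrow> 'a list) set" where
  "var_basic_set L v n Y =
     {X \<in> var_word_seqs L v. var_seq_le L v X Y \<and> initial n X = initial n Y}"

definition within_depth ::
  "(nat \<Rightarrow> 'a set) \<Rightarrow> 'a \<Rightarrow> (nat \<Rightarrow> 'a list) \<Rightarrow> 'a list list \<Rightarrow> nat \<Rightarrow> bool" where
  "within_depth L v Y a k \<longleftrightarrow>
     (\<forall>i<length a. a ! i \<in> span_words L v Y) \<and>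
     (\<forall>i j. i < j \<and> j < length a \<longrightarrow> Max (supp L v Y (a ! i)) < Min (supp L v Y (a ! j))) \<and>
     (\<forall>i<length a. supp L v Y (a ! i) \<subseteq> {..<k})"

definition depth :: "(nat \<Rightarrow> 'a set) \<Rightarrow> 'a \<Rightarrow> (nat \<Rightarrow> 'a list) \<Rightarrow> 'a list list \<Rightarrow> int" where
  "depth L v Y a =
     (if \<exists>k. within_depth L v Y a k then int (LEAST k. within_depth L v Y a k) else - 1)"

(* The Cantor space is the type nat \<Rightarrow> bool with its product topology. *)
definition perfect_set :: "(nat \<Rightarrow> bool) set \<Rightarrow> bool" where
  "perfect_set P \<longleftrightarrow> P \<noteq> {} \<and> closed P \<and> (\<forall>x\<in>P. \<not> x isolated_in P)"

(* In the next two definitions [a,Y] is nonempty, hence the depth of a in Y is nonnegative and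
   nat does not truncate. *)
definition perfectly_Ramsey ::
  "(nat \<Rightarrow> 'a set) \<Rightarrow> 'a \<Rightarrow> ((nat \<Rightarrow> bool) \<times> (nat \<Rightarrow> 'a list)) set \<Rightarrow> bool" where
  "perfectly_Ramsey L v \<Lambda> \<longleftrightarrow>
     (\<forall>Q. \<forall>a\<in>approximations L. \<forall>Y\<in>var_word_seqs L v.
        perfect_set Q \<and> basic_set L v a Y \<noteq> {} \<longrightarrow>
        (\<exists>M. \<exists>X\<in>var_basic_set L v (nat (depth L v Y a)) Y.
           perfect_set M \<and> M \<subseteq> Q \<and> basic_set L v a X \<noteq> {} \<and>
           (M \<times> basic_set L v a X \<subseteq> \<Lambda> \<or>
            M \<times> basic_set L v a X \<subseteq> (UNIV \<times> word_seqs L) - \<Lambda>)))"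

definition perfectly_Ramsey_null ::
  "(nat \<Rightarrow> 'a set) \<Rightarrow> 'a \<Rightarrow> ((nat \<Rightarrow> bool) \<times> (nat \<Rightarrow> 'a list)) set \<Rightarrow> bool" where
  "perfectly_Ramsey_null L v \<Lambda> \<longleftrightarrow>
     (\<forall>Q. \<forall>a\<in>approximations L. \<forall>Y\<in>var_word_seqs L v.
        perfect_set Q \<and> basic_set L v a Y \<noteq> {} \<longrightarrow>
        (\<exists>M. \<exists>X\<in>var_basic_set L v (nat (depth L v Y a)) Y.
           perfect_set M \<and> M \<subseteq> Q \<and> basic_set L v a X \<noteq> {} \<and>
           M \<times> basic_set L v a X \<subseteq> (UNIV \<times> word_seqs L) - \<Lambda>))"

definition perfectly_Baire ::
  "(nat \<Rightarrow> 'a set) \<Rightarrow> 'a \<Rightarrow> ((nat \<Rightarrow> bool) \<times> (nat \<Rightarrow> 'a list)) set \<Rightarrow> bool" where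
  "perfectly_Baire L v \<Lambda> \<longleftrightarrow>
     (\<forall>Q. \<forall>a\<in>approximations L. \<forall>Y\<in>var_word_seqs L v.
        perfect_set Q \<and> basic_set L v a Y \<noteq> {} \<longrightarrow>
        (\<exists>M. \<exists>b\<in>approximations L. \<exists>X\<in>var_word_seqs L v.
           perfect_set M \<and> M \<subseteq> Q \<and>
           basic_set L v b X \<noteq> {} \<and> basic_set L v b X \<subseteq> basic_set L v a Y \<and>
           (M \<times> basic_set L v b X \<subseteq> \<Lambda> \<or>
            M \<times> basic_set L v b X \<subseteq> (UNIV \<times> word_seqs L) - \<Lambda>)))"

definition perfectly_meager ::
  "(nat \<Rightarrow> 'a set) \<Rightarrow> 'a \<Rightarrow> ((nat \<Rightarrow> bool) \<times> (nat \<Rightarrow> 'a list)) set \<Rightarrow> bool" where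
  "perfectly_meager L v \<Lambda> \<longleftrightarrow>
     (\<forall>Q. \<forall>a\<in>approximations L. \<forall>Y\<in>var_word_seqs L v.
        perfect_set Q \<and> basic_set L v a Y \<noteq> {} \<longrightarrow>
        (\<exists>M. \<exists>b\<in>approximations L. \<exists>X\<in>var_word_seqs L v.
           perfect_set M \<and> M \<subseteq> Q \<and>
           basic_set L v b X \<noteq> {} \<and> basic_set L v b X \<subseteq> basic_set L v a Y \<and>
           M \<times> basic_set L v b X \<subseteq> (UNIV \<times> word_seqs L) - \<Lambda>))"

end

theory Submission
  imports Defs
begin

text \<open>
  A homogeneous product \<open>M \<times> [a,X]\<close> with \<open>X\<close> below \<open>Y\<close> is in particular a product over a subset of
  \<open>[a,Y]\<close>, so Ramsey sets are Baire and Ramsey null sets are meager. Meager sets are Baire, and a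
  homogeneous product inside \<open>\<Lambda>\<close> is impossible when every product contains one that avoids \<open>\<Lambda>\<close>; hence
  meager sets are Ramsey null as soon as Baire sets are Ramsey. That last implication is the
  substance of the theorem.

  Let \<open>\<Lambda>\<close> be Baire, and call a finite sequence \<open>b\<close> undecidable over a perfect set \<open>M\<close> and a
  sequence \<open>X\<close> of variable words if no smaller perfect set and no reduction of \<open>X\<close> make the
  sequences that begin with \<open>b\<close> homogeneous. If the Ramsey property failed at \<open>(Q,a,Y)\<close>, then \<open>a\<close> would
  be undecidable over \<open>Q\<close> and \<open>Y\<close>. Undecidability spreads
  (\<open>undecidable_stems\<close>): some \<open>M\<close> and \<open>X\<close> make all finite sequences of \<open>X\<close> that extend \<open>a\<close>
  undecidable. The Baire property at \<open>(M,a,X)\<close> then yields a homogeneous \<open>[b,X']\<close> inside \<open>[a,X]\<close>, a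
  contradiction. Here \<open>X'\<close> need not be a reduction of \<open>X\<close>, but it can be replaced by one
  (\<open>basic_set_contains_tails_of_reduction\<close>).

  Undecidability passes from \<open>b\<close> to its one-word extensions \<open>b @ [w]\<close> by a pigeonhole principle. A
  \<open>fusion\<close> first gives every \<open>x\<close> in \<open>M\<close> and every \<open>w\<close> a neighbourhood of \<open>x\<close> on which \<open>b @ [w]\<close> is either
  homogeneous, in one of two ways, or undecidable. This colours the pairs \<open>(x,w)\<close> locally in \<open>x\<close>, and
  \<open>parametrized_pigeonhole\<close> makes the colour independent of both coordinates at once. If the common
  colour were one of the two homogeneous ones, \<open>b\<close> itself would be decided. A second fusion does this for all
  \<open>b\<close> together.

  The pigeonhole principle rests on an idempotent ultrafilter \<open>U\<close> on constant words and an
  ultrafilter \<open>V\<close> on variable words that every substitution of a letter maps to \<open>U\<close>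
  (\<open>hales_jewett_ultrafilters\<close>). Every point \<open>x\<close> has a colour that \<open>U\<close>-almost all words receive at \<open>x\<close>, and
  some colour belongs to uncountably many points. From these points one grows a tree, simultaneously
  with a reduction of \<open>X\<close>, and takes the closure. A new point has to be close to an old one and has
  to be as good as the old one for the finitely many words built so far; the latter is not
  an open condition. It becomes one in a finer topology with a countable base, and
  uncountable sets still have condensation points there (\<open>condensation_points\<close>).

  Supports are handled by intervals: a sequence of words is a block sequence over \<open>X\<close> iff there are
  numbers \<open>h 0 < h 1 < \<dots>\<close> such that its \<open>i\<close>th word is a combination of those \<open>X n\<close> with
  \<open>h i \<le> n < h (i + 1)\<close>. Composing two reductions amounts to composing the functions \<open>h\<close>.
\<close>

section \<open>Compactness of powers of the two-point space\<close>

lemma closed_coordinate: "closed {p :: 'i \<Rightarrow> bool. p i}" "closed {p :: 'i \<Rightarrow> bool. \<not> p i}"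
proof -
  have "open {p :: 'i \<Rightarrow> bool. \<forall>k\<in>{()}. p i \<in> U}" for U
    using product_topology_basis'[of "{()}" "\<lambda>_. U" "\<lambda>_. i"] by (simp add: open_discrete)
  from this[of "{False}"] this[of "{True}"]
  have *: "open {p :: 'i \<Rightarrow> bool. \<not> p i}" "open {p :: 'i \<Rightarrow> bool. p i}" by simp_all
  show "closed {p :: 'i \<Rightarrow> bool. p i}"
    using *(1) by (simp add: closed_def Collect_neg_eq [symmetric])
  show "closed {p :: 'i \<Rightarrow> bool. \<not> p i}"
    using *(2) by (simp add: closed_def Collect_neg_eq [symmetric])
qed

lemma compact_UNIV_bool: "compact (UNIV :: ('i \<Rightarrow> bool) set)"
proof -
  have "compact_space (euclidean :: bool topology)"
    by (simp add: compact_space_def finite_imp_compact)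
  then have "compact_space (product_topology (\<lambda>_::'i. euclidean :: bool topology) UNIV)"
    by (simp add: compact_space_product_topology)
  then show ?thesis
    by (simp add: euclidean_product_topology compact_space_def)
qed

lemma closed_imp_compact_bool: "closed (S :: ('i \<Rightarrow> bool) set) \<Longrightarrow> compact S"
  using compact_Int_closed[OF compact_UNIV_bool] by simp

lemma compact_imp_closed_bool:
  assumes "compact (S :: ('i \<Rightarrow> bool) set)"
  shows "closed S"
proof -
  have "Hausdorff_space (euclidean :: bool topology)"
    unfolding Hausdorff_space_def
  proof (intro allI impI)
    fix x y :: bool
    assume "x \<in> topspace euclidean \<and> y \<in> topspace euclidean \<and> x \<noteq> y"
    then show "\<exists>U V. openin euclidean U \<and> openin euclidean V \<and> x \<in> U \<and> y \<in> V \<and> disjnt U V"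
      by (intro exI[of _ "{x}"] exI[of _ "{y}"]) (simp add: open_discrete)
  qed
  then have "Hausdorff_space (product_topology (\<lambda>_::'i. euclidean :: bool topology) UNIV)"
    by (simp add: Hausdorff_space_product_topology)
  then have "Hausdorff_space (euclidean :: ('i \<Rightarrow> bool) topology)"
    by (simp add: euclidean_product_topology)
  then show ?thesis
    using compactin_imp_closedin[of euclidean S] assms by simp
qed

lemma nested_closed_nonempty:
  fixes C :: "nat \<Rightarrow> ('i \<Rightarrow> bool) set"
  assumes "\<And>n. closed (C n)" "\<And>n. C n \<noteq> {}" "\<And>n. C (Suc n) \<subseteq> C n"
  shows "(\<Inter>n. C n) \<noteq> {}"
proof -
  have dec: "C n \<subseteq> C m" if "m \<le> n" for m n
    using lift_Suc_antimono_le[of C] assms(3) that by blast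
  have "UNIV \<inter> (\<Inter>n\<in>UNIV. C n) \<noteq> {}"
  proof (rule compact_imp_fip_image[OF compact_UNIV_bool])
    fix I' :: "nat set" assume "finite I'"
    then obtain N where "\<forall>i\<in>I'. i \<le> N" by (meson finite_nat_set_iff_bounded_le)
    then have "C N \<subseteq> (\<Inter>i\<in>I'. C i)" using dec by blast
    then show "UNIV \<inter> (\<Inter>i\<in>I'. C i) \<noteq> {}" using assms(2)[of N] by blast
  qed (use assms(1) in auto)
  then show ?thesis by simp
qed

text \<open>Zorn's lemma for downward chains, in the form needed for minimal subsemigroups and minimal left
  ideals: compactness keeps the intersection of a chain nonempty.\<close>

lemma minimal_compact_subset:
  fixes K :: "'q::topological_space set"
  assumes compact_closed: "\<And>S :: 'q set. compact S \<Longrightarrow> closed S"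
    and "compact K" "K \<noteq> {}" "P K"
    and inter: "\<And>\<C>. \<C> \<noteq> {} \<Longrightarrow> (\<And>S. S \<in> \<C> \<Longrightarrow> P S) \<Longrightarrow> P (\<Inter>\<C>)"
  shows "\<exists>R\<subseteq>K. compact R \<and> R \<noteq> {} \<and> P R \<and>
    (\<forall>S\<subseteq>R. compact S \<and> S \<noteq> {} \<and> P S \<longrightarrow> S = R)"
proof -
  define good where "good = (\<lambda>S. S \<subseteq> K \<and> compact S \<and> S \<noteq> {} \<and> P S)"
  have "\<exists>M\<in>uminus ` Collect good. \<forall>X\<in>uminus ` Collect good. M \<subseteq> X \<longrightarrow> X = M"
  proof (rule subset_Zorn_nonempty)
    show "uminus ` Collect good \<noteq> {}" using assms by (auto simp: good_def)
  next
    fix \<C> assume ne: "\<C> \<noteq> {}" and ch: "subset.chain (uminus ` Collect good) \<C>"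
    define \<D> where "\<D> = uminus ` \<C>"
    have gd: "good S" if "S \<in> \<D>" for S
      using ch that by (auto simp: \<D>_def subset_chain_def)
    have lin: "S \<subseteq> T \<or> T \<subseteq> S" if "S \<in> \<D>" "T \<in> \<D>" for S T
      using ch that unfolding \<D>_def subset_chain_def by blast
    have neD: "\<D> \<noteq> {}" using ne by (simp add: \<D>_def)
    obtain S0 where S0: "S0 \<in> \<D>" using neD by auto
    have mn: "\<exists>S\<in>\<D>. \<forall>T\<in>F. S \<subseteq> T" if "finite F" "F \<subseteq> \<D>" for F
      using that
    proof (induction F)
      case empty
      then show ?case using S0 by auto
    next
      case (insert T F)
      then obtain S where S: "S \<in> \<D>" "\<forall>T\<in>F. S \<subseteq> T" by auto
      have T: "T \<in> \<D>" using insert.prems by simp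
      from lin[OF S(1) T] show ?case
      proof
        assume "S \<subseteq> T"
        then show ?thesis using S by (intro bexI[of _ S]) simp_all
      next
        assume "T \<subseteq> S"
        then show ?thesis using S T by (intro bexI[of _ T]) (simp_all, blast)
      qed
    qed
    have cl: "closed S" if "S \<in> \<D>" for S
      using gd[OF that] unfolding good_def by (intro compact_closed) simp
    have "K \<inter> \<Inter>\<D> \<noteq> {}"
    proof (rule compact_imp_fip[OF \<open>compact K\<close> cl])
      fix F assume "finite F" "F \<subseteq> \<D>"
      then obtain S where S: "S \<in> \<D>" "\<forall>T\<in>F. S \<subseteq> T" using mn by blast
      then have "S \<subseteq> K \<inter> \<Inter>F" "S \<noteq> {}" using gd[of S] by (auto simp: good_def)
      then show "K \<inter> \<Inter>F \<noteq> {}" by blast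
    qed
    moreover have "compact (\<Inter>\<D>)"
      using S0 gd[OF S0] cl closed_Inter[of \<D>] compact_Int_closed[of S0 "\<Inter>\<D>"]
      by (auto simp: good_def Inter_lower Int_absorb1)
    moreover have "P (\<Inter>\<D>)"
      by (rule inter[OF neD]) (use gd in \<open>auto simp: good_def\<close>)
    ultimately have "good (\<Inter>\<D>)" using S0 gd[OF S0] by (auto simp: good_def)
    moreover have "\<Union>\<C> = - \<Inter>\<D>" by (auto simp: \<D>_def)
    ultimately show "\<Union>\<C> \<in> uminus ` Collect good" by blast
  qed
  then obtain R where R: "good R" "\<forall>X\<in>uminus ` Collect good. - R \<subseteq> X \<longrightarrow> X = - R"
    by (elim bexE imageE) simp
  have "S = R" if "S \<subseteq> R" "compact S" "S \<noteq> {}" "P S" for S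
  proof -
    have "good S" using that R(1) by (auto simp: good_def)
    then    have "- S \<in> uminus ` Collect good" "- R \<subseteq> - S" using that(1) by simp_all
    with R(2) have "- S = - R" by metis
    then show ?thesis by simp
  qed
  then show ?thesis using R(1) unfolding good_def by (intro exI[of _ R]) simp
qed

section \<open>Idempotents in compact right topological semigroups\<close>

locale right_topological_semigroup =
  fixes op :: "'q::topological_space \<Rightarrow> 'q \<Rightarrow> 'q" (infixl "\<odot>" 70)
  assumes assoc: "(p \<odot> q) \<odot> r = p \<odot> (q \<odot> r)"
    and compact_closed: "compact (S :: 'q set) \<Longrightarrow> closed S"
    and cont: "continuous_on UNIV (\<lambda>p. p \<odot> q)"
begin

lemma compact_translate: "compact S \<Longrightarrow> compact ((\<lambda>p. p \<odot> q) ` S)"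
  using compact_continuous_image continuous_on_subset[OF cont] by blast

text \<open>The Ellis--Numakura lemma. In a minimal compact subsemigroup \<open>R\<close> with an element \<open>x\<close>, both \<open>R \<odot> x\<close> and the
  set of \<open>y\<close> with \<open>y \<odot> x = x\<close> are compact subsemigroups, hence equal to \<open>R\<close>.\<close>

lemma idempotent_exists:
  assumes "compact K" "K \<noteq> {}" "\<And>p q. p \<in> K \<Longrightarrow> q \<in> K \<Longrightarrow> p \<odot> q \<in> K"
  obtains e where "e \<in> K" "e \<odot> e = e"
proof -
  have inter: "\<forall>p\<in>\<Inter>\<C>. \<forall>q\<in>\<Inter>\<C>. p \<odot> q \<in> \<Inter>\<C>"
    if "\<And>S. S \<in> \<C> \<Longrightarrow> \<forall>p\<in>S. \<forall>q\<in>S. p \<odot> q \<in> S" for \<C>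
    using that by blast
  have "\<exists>R\<subseteq>K. compact R \<and> R \<noteq> {} \<and> (\<forall>p\<in>R. \<forall>q\<in>R. p \<odot> q \<in> R) \<and>
    (\<forall>S\<subseteq>R. compact S \<and> S \<noteq> {} \<and> (\<forall>p\<in>S. \<forall>q\<in>S. p \<odot> q \<in> S) \<longrightarrow> S = R)"
    by (rule minimal_compact_subset[OF compact_closed, of K "\<lambda>S. \<forall>p\<in>S. \<forall>q\<in>S. p \<odot> q \<in> S"])
      (use assms inter in simp_all)
  then obtain R where R: "R \<subseteq> K" "compact R" "R \<noteq> {}" and sg: "\<forall>p\<in>R. \<forall>q\<in>R. p \<odot> q \<in> R"
    and mn: "\<And>S. S \<subseteq> R \<Longrightarrow> compact S \<Longrightarrow> S \<noteq> {} \<Longrightarrow> \<forall>p\<in>S. \<forall>q\<in>S. p \<odot> q \<in> S \<Longrightarrow> S = R"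
    by (elim exE conjE) simp
  obtain x where x: "x \<in> R" using R by auto
  have "(\<lambda>p. p \<odot> x) ` R = R"
  proof (rule mn)
    show "\<forall>p\<in>(\<lambda>p. p \<odot> x) ` R. \<forall>q\<in>(\<lambda>p. p \<odot> x) ` R. p \<odot> q \<in> (\<lambda>p. p \<odot> x) ` R"
    proof (clarify)
      fix p q assume "p \<in> R" "q \<in> R"
      then have "p \<odot> x \<odot> q \<in> R" using sg x by blast
      then show "p \<odot> x \<odot> (q \<odot> x) \<in> (\<lambda>p. p \<odot> x) ` R" by (simp add: assoc[symmetric])
    qed
  qed (use sg x R compact_translate in auto)
  then obtain y where y: "y \<in> R" "y \<odot> x = x" using x by (metis imageE)
  have "R \<inter> {y. y \<odot> x = x} = R"
  proof (rule mn)
    have "closed {y. y \<odot> x = x}"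
      using closed_vimage[OF compact_closed[of "{x}"] cont[of x]] by (simp add: vimage_def)
    then show "compact (R \<inter> {y. y \<odot> x = x})" using R compact_Int_closed by blast
  qed (use y sg in \<open>auto simp: assoc\<close>)
  then have "x \<odot> x = x" using x by auto
  then show ?thesis using that x R by blast
qed

text \<open>Algebraic core of the Hales--Jewett theorem. An idempotent \<open>u\<close> of a minimal left ideal of \<open>K\<close> is minimal
  among idempotents: the only idempotent \<open>f\<close> of \<open>K\<close> with \<open>f \<odot> u = f = u \<odot> f\<close> is \<open>u\<close>. Below \<open>u\<close> there is
  an idempotent \<open>e\<close> of \<open>J\<close>, and a homomorphism into \<open>K\<close> that fixes \<open>u\<close> maps \<open>e\<close> to an idempotent below
  \<open>u\<close>, that is, to \<open>u\<close>. In the application \<open>K\<close> consists of ultrafilters on constant words, \<open>J\<close> of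
  ultrafilters on variable words, and the homomorphisms substitute a letter for the variable.\<close>

lemma minimal_idempotent_below:
  assumes K: "compact K" "K \<noteq> {}" "\<And>p q. p \<in> K \<Longrightarrow> q \<in> K \<Longrightarrow> p \<odot> q \<in> K"
    and J: "compact J" "J \<noteq> {}" "\<And>p q. p \<in> J \<Longrightarrow> q \<in> J \<Longrightarrow> p \<odot> q \<in> J"
    and KJ: "\<And>p q. p \<in> K \<Longrightarrow> q \<in> J \<Longrightarrow> p \<odot> q \<in> J" "\<And>p q. p \<in> K \<Longrightarrow> q \<in> J \<Longrightarrow> q \<odot> p \<in> J"
  obtains u e where "u \<in> K" "u \<odot> u = u" "e \<in> J"
    "\<And>\<phi>. (\<And>p q. \<phi> (p \<odot> q) = \<phi> p \<odot> \<phi> q) \<Longrightarrow> \<phi> ` J \<subseteq> K \<Longrightarrow> \<phi> u = u \<Longrightarrow> \<phi> e = u"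
proof -
  have inter: "\<forall>p\<in>K. \<forall>q\<in>\<Inter>\<C>. p \<odot> q \<in> \<Inter>\<C>"
    if "\<And>S. S \<in> \<C> \<Longrightarrow> \<forall>p\<in>K. \<forall>q\<in>S. p \<odot> q \<in> S" for \<C>
    using that by blast
  have "\<exists>R\<subseteq>K. compact R \<and> R \<noteq> {} \<and> (\<forall>p\<in>K. \<forall>q\<in>R. p \<odot> q \<in> R) \<and>
    (\<forall>S\<subseteq>R. compact S \<and> S \<noteq> {} \<and> (\<forall>p\<in>K. \<forall>q\<in>S. p \<odot> q \<in> S) \<longrightarrow> S = R)"
    by (rule minimal_compact_subset[OF compact_closed, of K "\<lambda>S. \<forall>p\<in>K. \<forall>q\<in>S. p \<odot> q \<in> S"])
      (use K inter in simp_all)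
  then obtain I where I: "I \<subseteq> K" "compact I" "I \<noteq> {}" and li: "\<forall>p\<in>K. \<forall>q\<in>I. p \<odot> q \<in> I"
    and mn: "\<And>S. S \<subseteq> I \<Longrightarrow> compact S \<Longrightarrow> S \<noteq> {} \<Longrightarrow> \<forall>p\<in>K. \<forall>q\<in>S. p \<odot> q \<in> S \<Longrightarrow> S = I"
    by (elim exE conjE) simp
  obtain u where u: "u \<in> I" "u \<odot> u = u"
    using idempotent_exists[of I] I li by blast
  have uK: "u \<in> K" using u I by blast
  have uniq: "f = u" if f: "f \<in> K" "f \<odot> f = f" "f \<odot> u = f" "u \<odot> f = f" for f
  proof -
    have fI: "f \<in> I" using li f u by metis
    have "(\<lambda>p. p \<odot> f) ` K = I"
    proof (rule mn)
      show "\<forall>p\<in>K. \<forall>q\<in>(\<lambda>p. p \<odot> f) ` K. p \<odot> q \<in> (\<lambda>p. p \<odot> f) ` K"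
        using K(3) by (auto simp: assoc[symmetric])
    qed (use K li fI compact_translate in auto)
    then obtain t where "t \<odot> f = u" using u by (metis imageE)
    then show ?thesis using f by (metis assoc)
  qed
  obtain e0 where e0: "e0 \<in> (\<lambda>p. p \<odot> u) ` J" "e0 \<odot> e0 = e0"
  proof (rule idempotent_exists[of "(\<lambda>p. p \<odot> u) ` J"])
    fix p q assume "p \<in> (\<lambda>p. p \<odot> u) ` J" "q \<in> (\<lambda>p. p \<odot> u) ` J"
    then obtain p' q' where pq: "p' \<in> J" "q' \<in> J" "p = p' \<odot> u" "q = q' \<odot> u" by auto
    then have "p \<odot> q = (p' \<odot> u \<odot> q') \<odot> u" "p' \<odot> u \<odot> q' \<in> J"
      using J KJ uK by (simp_all add: assoc)
    then show "p \<odot> q \<in> (\<lambda>p. p \<odot> u) ` J" by blast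
  qed (use J compact_translate in auto)
  then have e0u: "e0 \<odot> u = e0" using u by (auto simp: assoc)
  have e0J: "e0 \<in> J" using e0 KJ uK by auto
  define e where "e = u \<odot> e0"
  have e: "e \<in> J" "e \<odot> e = e" "u \<odot> e = e" "e \<odot> u = e"
    using e0J KJ uK e0u e0(2) u(2) unfolding e_def by (metis assoc)+
  show ?thesis
  proof (rule that[OF uK u(2) e(1)])
    fix \<phi> assume "\<And>p q. \<phi> (p \<odot> q) = \<phi> p \<odot> \<phi> q" "\<phi> ` J \<subseteq> K" "\<phi> u = u"
    then show "\<phi> e = u" using uniq[of "\<phi> e"] e by (metis image_subset_iff)
  qed
qed

end

section \<open>Ultrafilters on the semigroup of words\<close>

text \<open>An ultrafilter is represented by its membership predicate, a point of a power of the two-point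
  space, so that the space of ultrafilters is compact as a closed set.\<close>

definition ultra :: "('b set \<Rightarrow> bool) \<Rightarrow> bool" where
  "ultra p \<longleftrightarrow> (\<forall>A B. p (A \<inter> B) \<longleftrightarrow> p A \<and> p B) \<and> (\<forall>A. p (- A) \<longleftrightarrow> \<not> p A)"

lemma ultra_Int: "ultra p \<Longrightarrow> p (A \<inter> B) \<longleftrightarrow> p A \<and> p B"
  and ultra_Compl: "ultra p \<Longrightarrow> p (- A) \<longleftrightarrow> \<not> p A"
  by (auto simp: ultra_def)

lemma ultra_mono: "ultra p \<Longrightarrow> p A \<Longrightarrow> A \<subseteq> B \<Longrightarrow> p B"
  using ultra_Int[of p A B] by (simp add: Int_absorb2)

lemma ultra_UNIV: "ultra p \<Longrightarrow> p UNIV"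
  using ultra_Compl[of p UNIV] ultra_Int[of p UNIV "- UNIV"] by simp

lemma ultra_empty: "ultra p \<Longrightarrow> \<not> p {}"
  using ultra_Compl[of p UNIV] ultra_UNIV[of p] by simp

lemma ultra_Un: "ultra p \<Longrightarrow> p (A \<union> B) \<longleftrightarrow> p A \<or> p B"
  using ultra_Int[of p "-A" "-B"] ultra_Compl[of p A] ultra_Compl[of p B] ultra_Compl[of p "A \<union> B"]
  by (simp only: Compl_Un) blast

lemma ultra_INT: "ultra p \<Longrightarrow> finite I \<Longrightarrow> p (\<Inter>i\<in>I. A i) \<longleftrightarrow> (\<forall>i\<in>I. p (A i))"
  by (rotate_tac 1, induction I rule: finite_induct) (simp_all add: ultra_UNIV ultra_Int)

lemma ultra_UN: "ultra p \<Longrightarrow> finite I \<Longrightarrow> p (\<Union>i\<in>I. A i) \<longleftrightarrow> (\<exists>i\<in>I. p (A i))"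
  by (rotate_tac 1, induction I rule: finite_induct) (simp_all add: ultra_empty ultra_Un)

lemma closed_ultra: "closed {p :: 'b set \<Rightarrow> bool. ultra p}"
proof -
  have 1: "closed {p :: 'b set \<Rightarrow> bool. p (A \<inter> B) \<longleftrightarrow> p A \<and> p B}" for A B
  proof -
    have "{p :: 'b set \<Rightarrow> bool. p (A \<inter> B) \<longleftrightarrow> p A \<and> p B} =
      ({p. p (A \<inter> B)} \<inter> {p. p A} \<inter> {p. p B}) \<union>
      ({p. \<not> p (A \<inter> B)} \<inter> ({p. \<not> p A} \<union> {p. \<not> p B}))" by auto
    then show ?thesis
      by (simp only:) (intro closed_Un closed_Int closed_coordinate)
  qed
  have 2: "closed {p :: 'b set \<Rightarrow> bool. p (- A) \<longleftrightarrow> \<not> p A}" for A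
  proof -
    have "{p :: 'b set \<Rightarrow> bool. p (- A) \<longleftrightarrow> \<not> p A} =
      ({p. p (- A)} \<inter> {p. \<not> p A}) \<union> ({p. \<not> p (- A)} \<inter> {p. p A})" by auto
    then show ?thesis
      by (simp only:) (intro closed_Un closed_Int closed_coordinate)
  qed
  have "{p :: 'b set \<Rightarrow> bool. ultra p} =
    (\<Inter>A. \<Inter>B. {p. p (A \<inter> B) \<longleftrightarrow> p A \<and> p B}) \<inter> (\<Inter>A. {p. p (- A) \<longleftrightarrow> \<not> p A})"
    by (auto simp: ultra_def)
  then show ?thesis
    by (simp only:) (intro closed_INT closed_Int 1 2 ballI)
qed

lemma ultra_with_nested_sets:
  assumes "\<And>n. S n \<noteq> {}" "\<And>n. S (Suc n) \<subseteq> S n"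
  obtains p where "ultra p" "\<And>n. p (S n)"
proof -
  have pr: "ultra (\<lambda>A. x \<in> A)" for x :: 'a by (auto simp: ultra_def)
  have "(\<Inter>n. {p. ultra p} \<inter> {p. p (S n)}) \<noteq> {}"
  proof (rule nested_closed_nonempty)
    fix n
    show "closed ({p. ultra p} \<inter> {p. p (S n)})"
      by (rule closed_Int[OF closed_ultra closed_coordinate(1)])
    obtain x where "x \<in> S n" using assms(1) by blast
    then show "{p. ultra p} \<inter> {p. p (S n)} \<noteq> {}" using pr[of x] by blast
    show "{p. ultra p} \<inter> {p. p (S (Suc n))} \<subseteq> {p. ultra p} \<inter> {p. p (S n)}"
      using ultra_mono assms(2) by blast
  qed
  then show ?thesis using that by auto
qed

text \<open>The product of ultrafilters that extends concatenation: \<open>A\<close> is large iff for \<open>p\<close>-almost all \<open>w\<close> and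
  then \<open>q\<close>-almost all \<open>u\<close> the word \<open>w @ u\<close> lies in \<open>A\<close>. It is continuous in the left factor.\<close>

definition tensor :: "('a list set \<Rightarrow> bool) \<Rightarrow> ('a list set \<Rightarrow> bool) \<Rightarrow> 'a list set \<Rightarrow> bool" where
  "tensor p q = (\<lambda>A. p {w. q {u. w @ u \<in> A}})"

lemma ultra_tensor:
  assumes "ultra p" "ultra q"
  shows "ultra (tensor p q)"
proof -
  have i: "q {u. w @ u \<in> A \<inter> B} \<longleftrightarrow> q {u. w @ u \<in> A} \<and> q {u. w @ u \<in> B}" for A B and w :: "'a list"
  proof -
    have "{u. w @ u \<in> A \<inter> B} = {u. w @ u \<in> A} \<inter> {u. w @ u \<in> B}" by auto
    then show ?thesis by (simp only: ultra_Int[OF assms(2)])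
  qed
  have c: "q {u. w @ u \<in> - A} \<longleftrightarrow> \<not> q {u. w @ u \<in> A}" for A and w :: "'a list"
  proof -
    have "{u. w @ u \<in> - A} = - {u. w @ u \<in> A}" by auto
    then show ?thesis by (simp only: ultra_Compl[OF assms(2)])
  qed
  have "tensor p q (A \<inter> B) \<longleftrightarrow> tensor p q A \<and> tensor p q B" for A B
    unfolding tensor_def i Collect_conj_eq by (rule ultra_Int[OF assms(1)])
  moreover have "tensor p q (- A) \<longleftrightarrow> \<not> tensor p q A" for A
    unfolding tensor_def c Collect_neg_eq by (rule ultra_Compl[OF assms(1)])
  ultimately show ?thesis by (simp add: ultra_def)
qed

interpretation tensor: right_topological_semigroup
  "tensor :: ('a list set \<Rightarrow> bool) \<Rightarrow> ('a list set \<Rightarrow> bool) \<Rightarrow> 'a list set \<Rightarrow> bool"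
proof
  show "tensor (tensor p q) r = tensor p (tensor q r)" for p q r :: "'a list set \<Rightarrow> bool"
    by (simp only: tensor_def append_assoc mem_Collect_eq)
  show "compact S \<Longrightarrow> closed S" for S :: "('a list set \<Rightarrow> bool) set"
    by (rule compact_imp_closed_bool)
  show "continuous_on UNIV (\<lambda>p. tensor p q)" for q :: "'a list set \<Rightarrow> bool"
  proof (rule continuous_on_coordinatewise_then_product)
    show "continuous_on UNIV (\<lambda>p. tensor p q A)" for A
      using continuous_on_product_coordinates[of "{w. q {u. w @ u \<in> A}}"]
      by (simp only: tensor_def)
  qed
qed

section \<open>Combinations with support in an interval\<close>

text \<open>The combinations of the \<open>X n\<close> with \<open>i \<le> n < j\<close>, including the empty word. The recursion
  decides whether the last index of the interval belongs to the support.\<close>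

primrec combos :: "'a \<Rightarrow> (nat \<Rightarrow> 'a set) \<Rightarrow> (nat \<Rightarrow> 'a list) \<Rightarrow> nat \<Rightarrow> nat \<Rightarrow> 'a list set" where
  "combos v K X i 0 = {[]}"
| "combos v K X i (Suc j) = combos v K X i j \<union>
     (if i \<le> j then {w @ subst_var v (X j) c | w c. w \<in> combos v K X i j \<and> c \<in> K j} else {})"

lemma Nil_in_combos [simp]: "[] \<in> combos v K X i j"
  by (induction j) auto

lemma combos_trivial: "j \<le> i \<Longrightarrow> combos v K X i j = {[]}"
  by (induction j) auto

lemma combos_nonempty_less: "w \<in> combos v K X i j \<Longrightarrow> w \<noteq> [] \<Longrightarrow> i < j"
  using combos_trivial[of j i v K X] by (cases "i < j") auto

lemma combos_Suc_mono: "combos v K X i j \<subseteq> combos v K X i (Suc j)"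
  by auto

lemma combos_mono_right: "j \<le> j' \<Longrightarrow> combos v K X i j \<subseteq> combos v K X i j'"
  by (rule lift_Suc_mono_le[of "combos v K X i"]) (auto intro: combos_Suc_mono)

lemma combos_mono:
  assumes "i' \<le> i" "j \<le> j'" "\<And>n. K n \<subseteq> K' n"
  shows "combos v K X i j \<subseteq> combos v K' X i' j'"
proof -
  have "combos v K X i j \<subseteq> combos v K' X i' j"
    using assms(1,3) by (induction j) (auto split: if_splits, blast+)
  then show ?thesis using combos_mono_right[OF assms(2)] by (rule order_trans)
qed

lemma combos_append:
  assumes "w \<in> combos v K X i j" "u \<in> combos v K X j k" "i \<le> j" "j \<le> k"
  shows "w @ u \<in> combos v K X i k"
  using assms(4,2)
proof (induction k arbitrary: u rule: dec_induct)
  case base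
  then show ?case using combos_trivial[of j j v K X] assms(1) by simp
next
  case (step n)
  from step.prems consider "u \<in> combos v K X j n"
    | u' c where "u = u' @ subst_var v (X n) c" "u' \<in> combos v K X j n" "c \<in> K n"
    by (auto split: if_splits)
  then show ?case
  proof cases
    case 1
    then show ?thesis using step.IH by auto
  next
    case 2
    then have "w @ u' \<in> combos v K X i n" using step.IH by blast
    then have "(w @ u') @ subst_var v (X n) c \<in> combos v K X i (Suc n)"
      using 2(3) assms(3) step.hyps by auto
    then show ?thesis using 2(1) by simp
  qed
qed

lemma combos_single: "c \<in> K n \<Longrightarrow> subst_var v (X n) c \<in> combos v K X n (Suc n)"
  by (auto intro!: exI[of _ "[]"])

lemma combos_cong:
  assumes "\<And>n. n < j \<Longrightarrow> X n = X' n"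
  shows "combos v K X i j = combos v K X' i j"
  using assms by (induction j) (auto split: if_splits)

text \<open>Moving every index up by \<open>k\<close> changes no word as long as the substituted words agree. As the sets of
  letters grow, terms of a sequence may therefore be placed at earlier positions.\<close>

lemma combos_transfer:
  assumes "\<And>n c. i \<le> n \<Longrightarrow> n < j \<Longrightarrow> c \<in> K n \<Longrightarrow>
    c \<in> K (n + k) \<and> subst_var v (X n) c = subst_var v (X' (n + k)) c"
  shows "combos v K X i j \<subseteq> combos v K X' (i + k) (j + k)"
  using assms
proof (induction j)
  case (Suc j)
  have IH: "combos v K X i j \<subseteq> combos v K X' (i + k) (j + k)"
    using Suc by auto
  have "w @ subst_var v (X j) c \<in> combos v K X' (i + k) (Suc j + k)"
    if "w \<in> combos v K X i j" "c \<in> K j" "i \<le> j" for w c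
    using that IH Suc.prems[of j c] by auto
  then show ?case using IH by (auto split: if_splits)
qed simp

lemma finite_combos:
  assumes "\<And>n. finite (K n)"
  shows "finite (combos v K X i j)"
proof (induction j)
  case (Suc j)
  have "{w @ subst_var v (X j) c | w c. w \<in> combos v K X i j \<and> c \<in> K j} =
    (\<lambda>(w, c). w @ subst_var v (X j) c) ` (combos v K X i j \<times> K j)" by auto
  then show ?case using Suc assms by auto
qed simp

lemma length_subst_var [simp]: "length (subst_var v x c) = length x"
  by (simp add: subst_var_def)

lemma subst_var_append [simp]: "subst_var v (x @ y) c = subst_var v x c @ subst_var v y c"
  by (simp add: subst_var_def)

lemma subst_var_self [simp]: "subst_var v x v = x"
  by (simp add: subst_var_def map_idI)

lemma subst_var_no_var: "v \<notin> set x \<Longrightarrow> subst_var v x c = x"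
  by (auto simp: subst_var_def intro!: map_idI)

lemma subst_var_subst_var: "subst_var v (subst_var v x c) d = subst_var v x (if c = v then d else c)"
  by (auto simp: subst_var_def)

lemma set_subst_var: "set (subst_var v x c) \<subseteq> insert c (set x - {v})"
  by (auto simp: subst_var_def)

lemma Nil_subst_var [simp]: "subst_var v x c = [] \<longleftrightarrow> x = []"
  by (simp add: subst_var_def)

lemma length_combos_le:
  "w \<in> combos v K X i j \<Longrightarrow> length w \<le> (\<Sum>n\<in>{i..<j}. length (X n))"
proof (induction j arbitrary: w)
  case (Suc j)
  then show ?case
    by (cases "i \<le> j") (auto, (fastforce simp: trans_le_add1)+)
qed simp

lemma length_combos_ge:
  assumes "w \<in> combos v K X i j" "w \<noteq> []"
  shows "\<exists>k. i \<le> k \<and> k < j \<and> length (X k) \<le> length w"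
  using assms
proof (induction j arbitrary: w)
  case (Suc j)
  show ?case
  proof (cases "w \<in> combos v K X i j")
    case True
    then show ?thesis using Suc by (meson less_SucI)
  next
    case False
    then have "i \<le> j" "length (X j) \<le> length w" using Suc.prems by (auto split: if_splits)
    then show ?thesis by auto
  qed
qed simp

lemma rapidly_increasing_less:
  assumes "rapidly_increasing X" "m < n"
  shows "length (X m) < length (X n)"
proof -
  have "length (X m) \<le> (\<Sum>i<n. length (X i))" using assms(2)
    by (intro member_le_sum[of m "{..<n}" "\<lambda>i. length (X i)"]) simp_all
  also have "\<dots> < length (X n)" using assms(1) by (simp add: rapidly_increasing_def)
  finally show ?thesis .
qed

lemma rapidly_increasing_le:
  "rapidly_increasing X \<Longrightarrow> m \<le> n \<Longrightarrow> length (X m) \<le> length (X n)"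
  using rapidly_increasing_less[of X m n] by (cases "m = n") auto

lemma rapidly_increasing_nonempty: "rapidly_increasing X \<Longrightarrow> X n \<noteq> []"
  by (auto simp: rapidly_increasing_def dest: spec[of _ n])

text \<open>Every term of a block sequence is at least as long as some \<open>X k\<close> whose index exceeds all indices used
  before, and that \<open>X k\<close> outweighs everything used before.\<close>

lemma rapidly_increasing_combos:
  assumes X: "rapidly_increasing X"
    and A: "\<And>i. A i \<in> combos v K X (h i) (h (Suc i))" "\<And>i. A i \<noteq> []"
  shows "rapidly_increasing A"
proof -
  have h: "h i < h (Suc i)" for i using combos_nonempty_less[OF A(1) A(2)] .
  have le: "(\<Sum>i<n. length (A i)) \<le> (\<Sum>i<h n. length (X i))" for n
  proof (induction n)
    case (Suc n)
    have "(\<Sum>i<Suc n. length (A i)) \<le> (\<Sum>i<h n. length (X i)) + (\<Sum>i\<in>{h n..<h (Suc n)}. length (X i))"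
      using Suc length_combos_le[OF A(1), of n] by simp
    also have "\<dots> = (\<Sum>i<h (Suc n). length (X i))"
      using h[of n] by (simp add: lessThan_atLeast0 sum.atLeastLessThan_concat)
    finally show ?case .
  qed simp
  have "(\<Sum>i<n. length (A i)) < length (A n)" for n
  proof -
    obtain k where k: "h n \<le> k" "length (X k) \<le> length (A n)"
      using length_combos_ge[OF A(1) A(2), of n] by blast
    have "(\<Sum>i<n. length (A i)) \<le> (\<Sum>i<h n. length (X i))" by (rule le)
    also have "\<dots> < length (X (h n))" using X by (simp add: rapidly_increasing_def)
    also have "\<dots> \<le> length (X k)" by (rule rapidly_increasing_le[OF X k(1)])
    finally show ?thesis using k by linarith
  qed
  then show ?thesis by (simp add: rapidly_increasing_def)
qed

section \<open>Reductions of sequences of variable words\<close>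

locale alphabet =
  fixes L :: "nat \<Rightarrow> 'a set" and v :: 'a
  assumes fin: "\<And>n. finite (L n)"
    and L_Suc: "\<And>n. L n \<subseteq> L (Suc n)"
    and v_notin: "v \<notin> (\<Union>n. L n)"
    and letters: "(\<Union>n. L n) \<noteq> {}"
begin

lemma L_mono: "m \<le> n \<Longrightarrow> L m \<subseteq> L n"
  using lift_Suc_mono_le[of L] L_Suc by blast

lemma v_notin_L [simp]: "v \<notin> L n"
  using v_notin by blast

lemma eventually_letters: "\<exists>N0. \<forall>N\<ge>N0. L N \<noteq> {}"
proof -
  obtain c N0 where "c \<in> L N0" using letters by auto
  then have "c \<in> L N" if "N0 \<le> N" for N using L_mono[OF that] by blast
  then show ?thesis by blast
qed

lemma letter_sequence: "\<exists>N c. n \<le> N \<and> (\<forall>i. c i \<in> L (N + i))"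
proof -
  obtain N0 where N0: "\<And>N. N0 \<le> N \<Longrightarrow> L N \<noteq> {}" using eventually_letters by blast
  have "\<exists>c. c \<in> L (max n N0 + i)" for i
  proof -
    have "N0 \<le> max n N0 + i" by linarith
    then show ?thesis using N0 by (simp add: ex_in_conv)
  qed
  then have "\<exists>c. \<forall>i. c i \<in> L (max n N0 + i)" by (intro choice allI)
  then show ?thesis by (intro exI[of _ "max n N0"]) simp
qed

abbreviation lwords :: "(nat \<Rightarrow> 'a list) \<Rightarrow> nat \<Rightarrow> nat \<Rightarrow> 'a list set" where
  "lwords \<equiv> combos v L"

abbreviation vwords :: "(nat \<Rightarrow> 'a list) \<Rightarrow> nat \<Rightarrow> nat \<Rightarrow> 'a list set" where
  "vwords \<equiv> combos v (\<lambda>n. insert v (L n))"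

lemma lwords_subset_vwords: "lwords X i j \<subseteq> vwords X i j"
  by (rule combos_mono) auto

lemma v_notin_lwords: "w \<in> lwords X i j \<Longrightarrow> v \<notin> set w"
proof (induction j arbitrary: w)
  case (Suc j)
  have "v \<notin> set (subst_var v x c)" if "c \<in> L j" for x c
    using set_subst_var[of v x c] that v_notin_L[of j] by blast
  then show ?case using Suc by (auto split: if_splits)
qed simp

lemma vwords_letters:
  assumes "X \<in> var_word_seqs L v"
  shows "w \<in> vwords X i j \<Longrightarrow> set w \<subseteq> insert v (\<Union>n. L n)"
proof (induction j arbitrary: w)
  case (Suc j)
  have "set (subst_var v (X j) c) \<subseteq> insert v (\<Union>n. L n)" if "c \<in> insert v (L j)" for c
  proof -
    have "set (X j) \<subseteq> insert v (\<Union>n. L n)"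
      using assms by (simp add: var_word_seqs_def var_words_def lists_eq_set)
    then show ?thesis using set_subst_var[of v "X j" c] that by blast
  qed
  moreover have "w \<in> vwords X i j \<or> (\<exists>w' c. w = w' @ subst_var v (X j) c \<and> w' \<in> vwords X i j \<and> c \<in> insert v (L j))"
    using Suc.prems by (auto split: if_splits)
  ultimately show ?case using Suc.IH by (elim disjE exE conjE) simp_all
qed simp

lemma lwords_in_words:
  assumes "X \<in> var_word_seqs L v" "w \<in> lwords X i j"
  shows "w \<in> words L"
  using vwords_letters[OF assms(1)] v_notin_lwords[OF assms(2)] assms(2) lwords_subset_vwords[of X i j]
  by (fastforce simp: words_def)

lemma vwords_in_var_words:
  assumes "X \<in> var_word_seqs L v" "w \<in> vwords X i j" "v \<in> set w"
  shows "w \<in> var_words L v"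
  using vwords_letters[OF assms(1,2)] assms(3) by (auto simp: var_words_def)

lemma subst_vwords:
  assumes "c \<in> L i"
  shows "x \<in> vwords X i j \<Longrightarrow> subst_var v x c \<in> lwords X i j"
proof (induction j arbitrary: x)
  case (Suc j)
  consider "x \<in> vwords X i j"
    | x' d where "x = x' @ subst_var v (X j) d" "x' \<in> vwords X i j" "d \<in> insert v (L j)" "i \<le> j"
    using Suc.prems by (auto split: if_splits)
  then show ?case
  proof cases
    case 1
    then show ?thesis using Suc.IH by auto
  next
    case 2
    have "(if d = v then c else d) \<in> L j" using 2(3,4) L_mono[of i j] assms by auto
    moreover have "subst_var v x c = subst_var v x' c @ subst_var v (X j) (if d = v then c else d)"
      unfolding 2(1) subst_var_append subst_var_subst_var ..
    ultimately show ?thesis using Suc.IH[OF 2(2)] 2(4) by auto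
  qed
qed (simp add: subst_var_def)

text \<open>Combinations of combinations. The premise on substitutions covers constant words as well as
  variable words, which allow the variable as a letter.\<close>

lemma combos_compose:
  assumes Y: "\<And>k. Y k \<in> vwords X (h k) (h (Suc k))" "\<And>k. h k \<le> h (Suc k)"
    and sub: "\<And>k c x. c \<in> K k \<Longrightarrow> x \<in> vwords X (h k) (h (Suc k)) \<Longrightarrow>
      subst_var v x c \<in> combos v K X (h k) (h (Suc k))"
  shows "w \<in> combos v K Y i j \<Longrightarrow> w \<in> combos v K X (h i) (h j)"
proof (induction j arbitrary: w)
  case (Suc j)
  have mono: "h m \<le> h n" if "m \<le> n" for m n
    using lift_Suc_mono_le[of h] Y(2) that by blast
  consider "w \<in> combos v K Y i j"
    | w' c where "w = w' @ subst_var v (Y j) c" "w' \<in> combos v K Y i j" "c \<in> K j" "i \<le> j"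
    using Suc.prems by (auto split: if_splits)
  then show ?case
  proof cases
    case 1
    then show ?thesis
      using Suc.IH subsetD[OF combos_mono_right[OF Y(2)[of j], of v K X "h i"]] by simp
  next
    case 2
    show ?thesis
      unfolding 2(1) by (rule combos_append[OF Suc.IH[OF 2(2)] sub[OF 2(3) Y(1)] mono[OF 2(4)] Y(2)])
  qed
qed simp

text \<open>The numbers \<open>h i\<close> are the endpoints of the intervals that carry the supports of the \<open>X' i\<close>.\<close>

definition reduces :: "(nat \<Rightarrow> nat) \<Rightarrow> (nat \<Rightarrow> 'a list) \<Rightarrow> (nat \<Rightarrow> 'a list) \<Rightarrow> bool" where
  "reduces h X' X \<longleftrightarrow> (\<forall>i. v \<in> set (X' i) \<and> X' i \<in> vwords X (h i) (h (Suc i)))"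

text \<open>The analogue of \<open>[n,X]\<close>. The first \<open>n\<close> intervals are the singletons \<open>{i}\<close>, which makes the
  composition of two reductions fix the initial segment that both of them fix.\<close>

definition ext :: "nat \<Rightarrow> (nat \<Rightarrow> 'a list) \<Rightarrow> (nat \<Rightarrow> 'a list) set" where
  "ext n X = {X'. \<exists>h. reduces h X' X \<and> (\<forall>i\<le>n. h i = i) \<and> (\<forall>i<n. X' i = X i)}"

lemma ext_iff: "X' \<in> ext n X \<longleftrightarrow>
    (\<exists>h. reduces h X' X \<and> (\<forall>i\<le>n. h i = i) \<and> (\<forall>i<n. X' i = X i))"
  by (simp add: ext_def)

lemma reduces_less: "reduces h X' X \<Longrightarrow> h i < h (Suc i)"
  by (rule combos_nonempty_less[of "X' i" v "\<lambda>n. insert v (L n)" X])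
    (auto simp: reduces_def dest!: spec[of _ i])

lemma reduces_ge: "reduces h X' X \<Longrightarrow> i \<le> h i"
  using reduces_less by (intro strict_mono_imp_increasing strict_monoI_Suc) blast

lemma reduces_lwords:
  assumes "reduces h X' X" "w \<in> lwords X' i j"
  shows "w \<in> lwords X (h i) (h j)"
proof (rule combos_compose[of X' X h])
  fix k c x assume "c \<in> L k" "x \<in> vwords X (h k) (h (Suc k))"
  then show "subst_var v x c \<in> lwords X (h k) (h (Suc k))"
    using subst_vwords L_mono[OF reduces_ge[OF assms(1)], of k] by blast
qed (use assms reduces_less[OF assms(1)] in \<open>auto simp: reduces_def less_imp_le\<close>)

lemma reduces_vwords:
  assumes "reduces h X' X" "w \<in> vwords X' i j"
  shows "w \<in> vwords X (h i) (h j)"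
proof (rule combos_compose[of X' X h])
  fix k c x assume "c \<in> insert v (L k)" "x \<in> vwords X (h k) (h (Suc k))"
  then show "subst_var v x c \<in> vwords X (h k) (h (Suc k))"
    using subst_vwords[of c "h k" x X] L_mono[OF reduces_ge[OF assms(1)], of k]
      lwords_subset_vwords[of X "h k"] by auto
qed (use assms reduces_less[OF assms(1)] in \<open>auto simp: reduces_def less_imp_le\<close>)

lemma reduces_var_word_seqs:
  assumes "X \<in> var_word_seqs L v" "reduces h X' X"
  shows "X' \<in> var_word_seqs L v"
proof -
  have "rapidly_increasing X'"
  proof (rule rapidly_increasing_combos)
    show "rapidly_increasing X" using assms by (simp add: var_word_seqs_def)
    show "X' i \<in> vwords X (h i) (h (Suc i))" for i using assms by (simp add: reduces_def)
    show "X' i \<noteq> []" for i using assms by (auto simp: reduces_def dest!: spec[of _ i])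
  qed
  then show ?thesis
    using vwords_in_var_words[OF assms(1)] assms(2)
    by (auto simp: var_word_seqs_def reduces_def)
qed

lemma ext_var_word_seqs: "X \<in> var_word_seqs L v \<Longrightarrow> X' \<in> ext n X \<Longrightarrow> X' \<in> var_word_seqs L v"
  using reduces_var_word_seqs by (auto simp: ext_iff)

lemma vwords_self: "X n \<in> vwords X n (Suc n)"
  using combos_single[of v "\<lambda>n. insert v (L n)" n v X] by simp

lemma ext_refl: "X \<in> var_word_seqs L v \<Longrightarrow> X \<in> ext n X"
  using vwords_self unfolding ext_iff
  by (intro exI[of _ "\<lambda>i. i"]) (auto simp: reduces_def var_word_seqs_def var_words_def)

lemma ext_trans:
  assumes "X' \<in> ext n X" "X'' \<in> ext m X'" "n \<le> m"
  shows "X'' \<in> ext n X"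
proof -
  obtain h where h: "reduces h X' X" "\<forall>i\<le>n. h i = i" "\<forall>i<n. X' i = X i"
    using assms(1) by (auto simp: ext_iff)
  obtain g where g: "reduces g X'' X'" "\<forall>i\<le>m. g i = i" "\<forall>i<m. X'' i = X' i"
    using assms(2) by (auto simp: ext_iff)
  have "reduces (\<lambda>i. h (g i)) X'' X"
    using g(1) reduces_vwords[OF h(1)] by (auto simp: reduces_def)
  then show ?thesis using h g assms(3) unfolding ext_iff
    by (intro exI[of _ "\<lambda>i. h (g i)"]) auto
qed

lemma ext_antimono: "n \<le> m \<Longrightarrow> ext m X \<subseteq> ext n X"
  by (force simp: ext_iff)

lemma ext_initial: "X' \<in> ext n X \<Longrightarrow> i < n \<Longrightarrow> X' i = X i"
  by (auto simp: ext_iff)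

text \<open>Stage \<open>k\<close> changes no entry before position \<open>n + k\<close>, so the diagonal is the limit of the stages. The
  intervals of the limit are consistent because the composed endpoint functions stabilise
  in the same way.\<close>

lemma ext_limit:
  assumes step: "\<And>k. Xs (Suc k) \<in> ext (n + k) (Xs k)"
  shows "(\<lambda>i. Xs (Suc i) i) \<in> ext (n + k) (Xs k)"
proof -
  have "\<exists>g. \<forall>k. reduces (g k) (Xs (Suc k)) (Xs k) \<and> (\<forall>i\<le>n + k. g k i = i) \<and>
      (\<forall>i<n + k. Xs (Suc k) i = Xs k i)"
    using step unfolding ext_iff by (intro choice) blast
  then obtain g where g: "\<And>k. reduces (g k) (Xs (Suc k)) (Xs k)"
    "\<And>k i. i \<le> n + k \<Longrightarrow> g k i = i" "\<And>k i. i < n + k \<Longrightarrow> Xs (Suc k) i = Xs k i" by blast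
  \<comment> \<open>H j composes the endpoint functions of the stages k, ..., k + j - 1.\<close>
  define H where "H = rec_nat (\<lambda>i. i) (\<lambda>j G i. G (g (k + j) i))"
  have H0: "H 0 i = i" and HS: "H (Suc j) i = H j (g (k + j) i)" for i j
    by (simp_all add: H_def)
  have red: "w \<in> vwords (Xs k) (H j a) (H j b)" if "w \<in> vwords (Xs (k + j)) a b" for w j a b
    using that
  proof (induction j arbitrary: a b)
    case (Suc j)
    then have "w \<in> vwords (Xs (Suc (k + j))) a b" by simp
    then have "w \<in> vwords (Xs (k + j)) (g (k + j) a) (g (k + j) b)"
      by (rule reduces_vwords[OF g(1)])
    then show ?case unfolding HS by (rule Suc.IH)
  qed (simp add: H0)
  have fixed: "H j i = i" if "i \<le> n + k" for i j
    using that by (induction j) (auto simp: H0 HS g(2))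
  have froz: "Xs (Suc i + j) i = Xs (Suc i) i" for i j
    by (induction j) (auto simp: g(3))
  have frozk: "Xs (Suc i) i = Xs k i" if i: "i < n + k" for i
  proof (cases "Suc i \<le> k")
    case True
    then show ?thesis using froz[of i "k - Suc i"] by simp
  next
    case False
    have "Xs (k + j) i = Xs k i" for j
      by (induction j) (use i in \<open>auto simp: g(3)\<close>)
    from this[of "Suc i - k"] False show ?thesis by simp
  qed
  show ?thesis unfolding ext_iff
  proof (intro exI[of _ "\<lambda>i. H i i"] conjI allI impI)
    show "reduces (\<lambda>i. H i i) (\<lambda>i. Xs (Suc i) i) (Xs k)"
      unfolding reduces_def
    proof (intro allI conjI)
      fix i
      show "v \<in> set (Xs (Suc i) i)" using g(1)[of i] by (simp add: reduces_def)
      have "Xs (Suc i) i = Xs (k + Suc i) i" using froz[of i k] by (simp add: ac_simps)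
      then have "Xs (Suc i) i \<in> vwords (Xs (k + Suc i)) i (Suc i)" by (metis vwords_self)
      then have "Xs (Suc i) i \<in> vwords (Xs k) (H (Suc i) i) (H (Suc i) (Suc i))" by (rule red)
      then show "Xs (Suc i) i \<in> vwords (Xs k) (H i i) (H (Suc i) (Suc i))"
        by (simp only: HS g(2)[of i "k + i"])
    qed
  qed (use fixed frozk in auto)
qed

section \<open>Sequences of words with a prescribed beginning\<close>

text \<open>The elements of \<open>[b,X]\<close> whose words after \<open>b\<close> have supports in \<open>{n..}\<close>, without any condition on
  \<open>b\<close>. For the depth \<open>n\<close> of \<open>b\<close> this is \<open>[b,X]\<close> itself, and it depends only on the part of \<open>X\<close> from \<open>n\<close> on.\<close>

definition tails :: "'a list list \<Rightarrow> nat \<Rightarrow> (nat \<Rightarrow> 'a list) \<Rightarrow> (nat \<Rightarrow> 'a list) set" where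
  "tails b n X = {A \<in> word_seqs L. initial (length b) A = b \<and>
     (\<exists>h. h 0 = n \<and> (\<forall>i. A (length b + i) \<in> lwords X (h i) (h (Suc i))))}"

lemma tailsI:
  assumes "A \<in> word_seqs L" "initial (length b) A = b" "n \<le> h 0"
    "\<And>i. A (length b + i) \<in> lwords X (h i) (h (Suc i))"
  shows "A \<in> tails b n X"
proof -
  define g where "g = (\<lambda>i. if i = 0 then n else h i)"
  have "A (length b + i) \<in> lwords X (g i) (g (Suc i))" for i
  proof -
    have "lwords X (h i) (h (Suc i)) \<subseteq> lwords X (g i) (g (Suc i))"
      by (rule combos_mono) (use assms(3) in \<open>auto simp: g_def\<close>)
    then show ?thesis using assms(4)[of i] by blast
  qed
  then show ?thesis unfolding tails_def using assms(1,2)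
    by (auto intro!: exI[of _ g] simp: g_def)
qed

lemma tailsD:
  assumes "A \<in> tails b n X"
  shows "A \<in> word_seqs L" "initial (length b) A = b"
    "\<exists>h. h 0 = n \<and> (\<forall>i. A (length b + i) \<in> lwords X (h i) (h (Suc i)))"
  using assms by (auto simp: tails_def)

lemma tails_antimono: "n \<le> m \<Longrightarrow> tails b m X \<subseteq> tails b n X"
  by (metis subsetI tailsD tailsI)

lemma tails_reduces: "reduces h X' X \<Longrightarrow> tails b n X' \<subseteq> tails b (h n) X"
proof
  fix A assume h: "reduces h X' X" and "A \<in> tails b n X'"
  note A = tailsD[OF this(2)]
  then obtain g where "g 0 = n" "\<And>i. A (length b + i) \<in> lwords X' (g i) (g (Suc i))" by blast
  then show "A \<in> tails b (h n) X"
    using reduces_lwords[OF h] A by (intro tailsI[of _ _ _ "\<lambda>i. h (g i)"]) auto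
qed

lemma tails_ext: "X' \<in> ext m X \<Longrightarrow> tails b n X' \<subseteq> tails b n X"
  using tails_reduces tails_antimono reduces_ge unfolding ext_iff by (metis order_trans)

lemma word_seqs_nonempty: "A \<in> word_seqs L \<Longrightarrow> A i \<noteq> []"
  using rapidly_increasing_nonempty by (auto simp: word_seqs_def)

lemma initial_Suc: "initial (Suc n) A = initial n A @ [A n]"
  by (simp add: initial_def)

lemma length_initial [simp]: "length (initial n A) = n"
  by (simp add: initial_def)

lemma initial_nth: "initial (length b) A = b \<Longrightarrow> i < length b \<Longrightarrow> b ! i = A i"
  by (metis initial_def add_0 diff_zero length_map length_upt nth_map_upt)

text \<open>The least interval that contains the next word \<open>w\<close> depends on \<open>w\<close> alone, not on the rest of
  the sequence.\<close>

lemma tails_step: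
  assumes A: "A \<in> tails b n X" and w: "w = A (length b)"
  shows "w \<noteq> []" "\<exists>m. w \<in> lwords X n m" "A \<in> tails (b @ [w]) (LEAST m. w \<in> lwords X n m) X"
proof -
  obtain h where h: "A \<in> word_seqs L" "initial (length b) A = b" "h 0 = n"
    "\<And>i. A (length b + i) \<in> lwords X (h i) (h (Suc i))" using tailsD[OF A] by blast
  show "w \<noteq> []" using word_seqs_nonempty[OF h(1)] w by simp
  have m: "w \<in> lwords X n (h 1)" using h(3) h(4)[of 0] w by simp
  then show "\<exists>m. w \<in> lwords X n m" by blast
  show "A \<in> tails (b @ [w]) (LEAST m. w \<in> lwords X n m) X"
  proof (rule tailsI[of _ _ _ "\<lambda>i. h (Suc i)"])
    show "initial (length (b @ [w])) A = b @ [w]" using h(2) w by (simp add: initial_Suc)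
    show "(LEAST m. w \<in> lwords X n m) \<le> h (Suc 0)" using m by (simp add: Least_le)
    show "A (length (b @ [w]) + i) \<in> lwords X (h (Suc i)) (h (Suc (Suc i)))" for i
      using h(4)[of "Suc i"] by simp
  qed (rule h(1))
qed

end

section \<open>Intervals instead of supports\<close>

lemma sorted_list_of_set_snoc:
  fixes j :: nat
  assumes "finite F" "\<And>n. n \<in> F \<Longrightarrow> n < j"
  shows "sorted_list_of_set (insert j F) = sorted_list_of_set F @ [j]"
proof -
  have "sorted (sorted_list_of_set F @ [j])" "distinct (sorted_list_of_set F @ [j])"
    "set (sorted_list_of_set F @ [j]) = insert j F"
    using assms by (auto simp: sorted_append less_imp_le)
  then show ?thesis using sorted_list_of_set.idem_if_sorted_distinct by metis
qed

lemma combos_iff: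
  "w \<in> combos v K X i j \<longleftrightarrow> (\<exists>F f. F \<subseteq> {i..<j} \<and> (\<forall>n\<in>F. f n \<in> K n) \<and>
     w = concat (map (\<lambda>n. subst_var v (X n) (f n)) (sorted_list_of_set F)))"
proof (induction j arbitrary: w)
  case (Suc j)
  define R where "R = (\<lambda>j w. \<exists>F f. F \<subseteq> {i..<j} \<and> (\<forall>n\<in>F. f n \<in> K n) \<and>
     w = concat (map (\<lambda>n. subst_var v (X n) (f n)) (sorted_list_of_set F)))"
  have IH: "w \<in> combos v K X i j \<longleftrightarrow> R j w" for w using Suc.IH by (simp add: R_def)
  have "R (Suc j) w \<longleftrightarrow> R j w \<or> (i \<le> j \<and> (\<exists>w' c. w = w' @ subst_var v (X j) c \<and> R j w' \<and> c \<in> K j))"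
  proof (intro iffI; (elim disjE conjE exE)?)
    assume "R (Suc j) w"
    then obtain F f where F: "F \<subseteq> {i..<Suc j}" "\<forall>n\<in>F. f n \<in> K n"
      "w = concat (map (\<lambda>n. subst_var v (X n) (f n)) (sorted_list_of_set F))"
      by (auto simp: R_def)
    show "R j w \<or> (i \<le> j \<and> (\<exists>w' c. w = w' @ subst_var v (X j) c \<and> R j w' \<and> c \<in> K j))"
    proof (cases "j \<in> F")
      case True
      define G where "G = F - {j}"
      have G: "F = insert j G" "G \<subseteq> {i..<j}" "finite G"
        using True F(1) finite_subset[OF F(1)] by (auto simp: G_def)
      have "sorted_list_of_set F = sorted_list_of_set G @ [j]"
        unfolding G(1) by (rule sorted_list_of_set_snoc) (use G in auto)
      then have "w = concat (map (\<lambda>n. subst_var v (X n) (f n)) (sorted_list_of_set G)) @ subst_var v (X j) (f j)"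
        using F(3) by simp
      moreover have "R j (concat (map (\<lambda>n. subst_var v (X n) (f n)) (sorted_list_of_set G)))"
        unfolding R_def using G F(2) by blast
      moreover have "i \<le> j" "f j \<in> K j" using F True by auto
      ultimately show ?thesis by blast
    next
      case False
      then have "F \<subseteq> {i..<j}" using F(1) less_antisym by fastforce
      then have "R j w" using F unfolding R_def by blast
      then show ?thesis ..
    qed
  next
    assume "R j w"
    then obtain F f where F: "F \<subseteq> {i..<j}" "\<forall>n\<in>F. f n \<in> K n"
      "w = concat (map (\<lambda>n. subst_var v (X n) (f n)) (sorted_list_of_set F))"
      by (auto simp: R_def)
    have "F \<subseteq> {i..<Suc j}" using F(1) by auto
    then show "R (Suc j) w" unfolding R_def using F(2,3) by blast
  next
    fix w' c assume *: "i \<le> j" "w = w' @ subst_var v (X j) c" "R j w'" "c \<in> K j"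
    then obtain F f where F: "F \<subseteq> {i..<j}" "\<forall>n\<in>F. f n \<in> K n"
      "w' = concat (map (\<lambda>n. subst_var v (X n) (f n)) (sorted_list_of_set F))"
      by (auto simp: R_def)
    have fin: "finite F" using F(1) finite_subset by blast
    have s: "sorted_list_of_set (insert j F) = sorted_list_of_set F @ [j]"
      by (rule sorted_list_of_set_snoc) (use F fin in auto)
    have jF: "j \<notin> F" using F(1) by auto
    have "w = concat (map (\<lambda>n. subst_var v (X n) ((f(j := c)) n)) (sorted_list_of_set (insert j F)))"
      unfolding s *(2) F(3) using jF fin by (auto intro!: arg_cong[of _ _ concat])
    moreover have "insert j F \<subseteq> {i..<Suc j}" "\<forall>n\<in>insert j F. (f(j := c)) n \<in> K n"
      using F * jF by auto
    ultimately show "R (Suc j) w" unfolding R_def by blast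
  qed
  then show ?case using IH by (auto simp: R_def)
qed simp

lemma combos_chain_mono:
  assumes A: "\<And>i. i < n \<Longrightarrow> A i \<in> combos v K X (h i) (h (Suc i))" "\<And>i. i < n \<Longrightarrow> A i \<noteq> []"
    and "i \<le> j" "j \<le> n"
  shows "h i \<le> h j"
  using assms(3,4)
proof (induction j rule: dec_induct)
  case (step j)
  then have "h j < h (Suc j)" by (intro combos_nonempty_less[OF A]) auto
  then show ?case using step by simp
qed simp

lemma length_concat_blocks:
  assumes "finite F"
  shows "length (concat (map (\<lambda>n. subst_var v (X n) (f n)) (sorted_list_of_set F))) =
    (\<Sum>n\<in>F. length (X n))"
  using assms by (simp add: length_concat comp_def sum_list_distinct_conv_sum_set)

text \<open>Binary expansion for a superincreasing sequence: the largest index in which \<open>F\<close> and \<open>G\<close> differ would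
  contribute more than all smaller indices together. This is why the length of a word determines its support.\<close>

lemma rapid_sums_inj:
  fixes a :: "nat \<Rightarrow> nat"
  assumes a: "\<And>n. (\<Sum>i<n. a i) < a n"
    and "F \<subseteq> {..<N}" "G \<subseteq> {..<N}" "sum a F = sum a G"
  shows "F = G"
  using assms(2-)
proof (induction N arbitrary: F G)
  case (Suc N)
  have small: "sum a H < a N" if "H \<subseteq> {..<N}" for H
    using sum_mono2[of "{..<N}" H a] that a[of N] by auto
  have big: "a N \<le> sum a H" if "N \<in> H" "H \<subseteq> {..<Suc N}" for H
    using member_le_sum[of N H a] that finite_subset by auto
  have sub: "H - {N} \<subseteq> {..<N}" if "H \<subseteq> {..<Suc N}" for H
    using that by (auto simp: less_Suc_eq)
  have fin: "finite F" "finite G" using Suc.prems finite_subset by auto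
  have iff: "N \<in> F \<longleftrightarrow> N \<in> G"
    using small big sub Suc.prems by (metis Diff_empty Diff_insert0 leD)
  have "sum a (F - {N}) = sum a (G - {N})"
    using Suc.prems(3) iff fin by (simp add: sum_diff1_nat)
  then have "F - {N} = G - {N}" using Suc.IH sub Suc.prems by blast
  then show ?case using iff by blast
qed auto

context alphabet
begin

lemma supp_unique:
  assumes X: "X \<in> var_word_seqs L v"
    and F: "is_combination v (\<lambda>n. insert v (L n)) X F w"
  shows "supp L v X w = F"
  unfolding supp_def
proof (rule the_equality)
  show "is_combination v (\<lambda>n. insert v (L n)) X F w" by (rule F)
next
  fix G assume G: "is_combination v (\<lambda>n. insert v (L n)) X G w"
  have fin: "finite F" "finite G" using F G by (auto simp: is_combination_def)
  obtain N where N: "F \<subseteq> {..<N}" "G \<subseteq> {..<N}"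
    using finite_nat_iff_bounded[of "F \<union> G"] fin by auto
  show "G = F"
  proof (rule rapid_sums_inj[of "\<lambda>n. length (X n)"])
    show "(\<Sum>i<n. length (X i)) < length (X n)" for n
      using X by (auto simp: var_word_seqs_def rapidly_increasing_def)
    show "(\<Sum>n\<in>G. length (X n)) = (\<Sum>n\<in>F. length (X n))"
      using F G unfolding is_combination_def by (metis length_concat_blocks)
  qed (use N in auto)
qed

lemma combos_supp:
  assumes X: "X \<in> var_word_seqs L v" and K: "\<And>n. K n \<subseteq> insert v (L n)"
    and w: "w \<in> combos v K X i j" "w \<noteq> []"
  shows "is_combination v K X (supp L v X w) w \<and> finite (supp L v X w) \<and> supp L v X w \<noteq> {} \<and>
    supp L v X w \<subseteq> {i..<j}"
proof -
  obtain F f where F: "F \<subseteq> {i..<j}" "\<forall>n\<in>F. f n \<in> K n"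
    "w = concat (map (\<lambda>n. subst_var v (X n) (f n)) (sorted_list_of_set F))"
    using w(1) unfolding combos_iff by blast
  have fin: "finite F" "F \<noteq> {}" using finite_subset[OF F(1)] w(2) F(3) by auto
  have c: "is_combination v K X F w" using F fin unfolding is_combination_def by blast
  then have "is_combination v (\<lambda>n. insert v (L n)) X F w"
    using K unfolding is_combination_def by blast
  then have "supp L v X w = F" by (rule supp_unique[OF X])
  then show ?thesis using c F fin by simp
qed

lemma is_combination_supp:
  assumes X: "X \<in> var_word_seqs L v" and K: "\<And>n. K n \<subseteq> insert v (L n)"
    and w: "is_combination v K X F w" and ij: "supp L v X w \<subseteq> {i..<j}"
  shows "w \<in> combos v K X i j"
proof -
  have "is_combination v (\<lambda>n. insert v (L n)) X F w"
    using K w unfolding is_combination_def by blast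
  then have "supp L v X w = F" by (rule supp_unique[OF X])
  then show ?thesis using w ij unfolding is_combination_def combos_iff by blast
qed

lemma is_combination_supp_ne:
  assumes X: "X \<in> var_word_seqs L v" and K: "\<And>n. K n \<subseteq> insert v (L n)"
    and w: "is_combination v K X F w"
  shows "finite (supp L v X w)" "supp L v X w \<noteq> {}" "w \<noteq> []"
proof -
  have *: "is_combination v (\<lambda>n. insert v (L n)) X F w"
    using K w unfolding is_combination_def by blast
  then have s: "supp L v X w = F" by (rule supp_unique[OF X])
  then show fin: "finite (supp L v X w)" "supp L v X w \<noteq> {}" using w by (auto simp: is_combination_def)
  obtain n where n: "n \<in> F" using fin s by blast
  have "length (X n) \<le> length w"
    using w n length_concat_blocks[of F v X] unfolding is_combination_def
    by (auto intro!: member_le_sum)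
  moreover have "X n \<noteq> []" using X by (auto simp: var_word_seqs_def rapidly_increasing_nonempty)
  ultimately show "w \<noteq> []" by auto
qed

text \<open>The translation between successive supports and intervals: take the interval endpoints just
  above the maxima of the supports. The index set \<open>I\<close> is all of the natural numbers for
  infinite sequences and an initial segment for approximations.\<close>

lemma block_sequence_iff:
  assumes X: "X \<in> var_word_seqs L v" and K: "\<And>n. K n \<subseteq> insert v (L n)"
    and I: "\<And>i j. j \<in> I \<Longrightarrow> i < j \<Longrightarrow> i \<in> I"
  shows "(\<forall>i\<in>I. \<exists>F. is_combination v K X F (A i)) \<and>
      (\<forall>i j. i < j \<and> j \<in> I \<longrightarrow> Max (supp L v X (A i)) < Min (supp L v X (A j))) \<longleftrightarrow>
    (\<exists>h. \<forall>i\<in>I. A i \<in> combos v K X (h i) (h (Suc i)) \<and> A i \<noteq> [])" (is "?l \<longleftrightarrow> ?r")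
proof
  assume l: ?l
  let ?S = "\<lambda>i. supp L v X (A i)"
  define h where "h = rec_nat 0 (\<lambda>i _. Suc (Max (?S i)))"
  have hS: "h 0 = 0" "h (Suc i) = Suc (Max (?S i))" for i by (simp_all add: h_def)
  have ne: "finite (?S i)" "?S i \<noteq> {}" "A i \<noteq> []" if "i \<in> I" for i
    using l that is_combination_supp_ne[OF X K] by blast+
  have "A i \<in> combos v K X (h i) (h (Suc i)) \<and> A i \<noteq> []" if i: "i \<in> I" for i
  proof -
    have "h i \<le> n" if n: "n \<in> ?S i" for n
    proof (cases i)
      case (Suc m)
      then have "Max (?S m) < Min (?S i)" using l i by blast
      then show ?thesis using n ne[OF i] Suc hS(2)[of m] by (metis Min_le Suc_leI less_le_trans)
    qed (simp add: hS)
    moreover have "n < h (Suc i)" if "n \<in> ?S i" for n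
      using that ne[OF i] by (simp add: hS less_Suc_eq_le)
    ultimately have "?S i \<subseteq> {h i..<h (Suc i)}" by auto
    then show ?thesis using l i ne[OF i] is_combination_supp[OF X K] by blast
  qed
  then show ?r by blast
next
  assume ?r
  then obtain h where h: "\<And>i. i \<in> I \<Longrightarrow> A i \<in> combos v K X (h i) (h (Suc i))"
    "\<And>i. i \<in> I \<Longrightarrow> A i \<noteq> []" by blast
  note s = combos_supp[OF X K h(1) h(2)]
  have mono: "i < j \<Longrightarrow> j \<in> I \<Longrightarrow> h (Suc i) \<le> h j" for i j
  proof (induction j)
    case (Suc j)
    then have j: "j \<in> I" using I by blast
    have "h j < h (Suc j)" using combos_nonempty_less[OF h(1)[OF j] h(2)[OF j]] .
    then show ?case using Suc j by (cases "i = j") auto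
  qed simp
  have "Max (supp L v X (A i)) < Min (supp L v X (A j))" if ij: "i < j" "j \<in> I" for i j
  proof -
    have i: "i \<in> I" using ij I by blast
    have "Max (supp L v X (A i)) < h (Suc i)" using s[OF i i] by (meson Max_in atLeastLessThan_iff subsetD)
    moreover have "h j \<le> Min (supp L v X (A j))"
      using s[OF ij(2) ij(2)] by (meson Min_in atLeastLessThan_iff subsetD)
    ultimately show ?thesis using mono[OF ij] by linarith
  qed
  then show ?l using s by blast
qed

lemma word_seq_le_iff:
  assumes X: "X \<in> var_word_seqs L v" and A: "A \<in> word_seqs L"
  shows "word_seq_le L v A X \<longleftrightarrow> (\<exists>h. \<forall>i. A i \<in> lwords X (h i) (h (Suc i)))"
proof -
  have "word_seq_le L v A X \<longleftrightarrow> (\<forall>i\<in>UNIV. \<exists>F. is_combination v L X F (A i)) \<and>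
      (\<forall>i j. i < j \<and> j \<in> UNIV \<longrightarrow> Max (supp L v X (A i)) < Min (supp L v X (A j)))"
    using A by (simp add: word_seq_le_def span_words_def word_seqs_def)
  also have "\<dots> \<longleftrightarrow> (\<exists>h. \<forall>i\<in>UNIV. A i \<in> lwords X (h i) (h (Suc i)) \<and> A i \<noteq> [])"
    by (rule block_sequence_iff[OF X]) auto
  finally show ?thesis using word_seqs_nonempty[OF A] by simp
qed

lemma var_seq_le_iff:
  assumes X: "X \<in> var_word_seqs L v" and Y: "Y \<in> var_word_seqs L v"
  shows "var_seq_le L v Y X \<longleftrightarrow> (\<exists>h. reduces h Y X)"
proof -
  have v: "Y i \<in> var_words L v" "v \<in> set (Y i)" "Y i \<noteq> []" for i
    using Y by (auto simp: var_word_seqs_def var_words_def rapidly_increasing_nonempty)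
  have "var_seq_le L v Y X \<longleftrightarrow> (\<forall>i\<in>UNIV. \<exists>F. is_combination v (\<lambda>n. insert v (L n)) X F (Y i)) \<and>
      (\<forall>i j. i < j \<and> j \<in> UNIV \<longrightarrow> Max (supp L v X (Y i)) < Min (supp L v X (Y j)))"
    using v(1) by (simp add: var_seq_le_def span_var_words_def)
  also have "\<dots> \<longleftrightarrow> (\<exists>h. \<forall>i\<in>UNIV. Y i \<in> vwords X (h i) (h (Suc i)) \<and> Y i \<noteq> [])"
    by (rule block_sequence_iff[OF X]) auto
  finally show ?thesis using v(2,3) by (simp add: reduces_def)
qed

lemma ext_var_basic_set:
  assumes "Y \<in> var_word_seqs L v" "X \<in> ext n Y"
  shows "X \<in> var_basic_set L v n Y"
proof -
  have X: "X \<in> var_word_seqs L v" using ext_var_word_seqs[OF assms] .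
  moreover have "var_seq_le L v X Y" using var_seq_le_iff[OF assms(1) X] assms(2) by (auto simp: ext_iff)
  moreover have "initial n X = initial n Y" using ext_initial[OF assms(2)] by (simp add: initial_def)
  ultimately show ?thesis by (simp add: var_basic_set_def)
qed

lemma within_depth_iff:
  assumes X: "X \<in> var_word_seqs L v"
  shows "within_depth L v X a k \<longleftrightarrow>
    (\<exists>h. h (length a) \<le> k \<and> (\<forall>i<length a. a ! i \<in> lwords X (h i) (h (Suc i)) \<and> a ! i \<noteq> []))"
    (is "_ \<longleftrightarrow> ?r")
proof -
  let ?I = "{..<length a}"
  have b: "(\<forall>i\<in>?I. \<exists>F. is_combination v L X F (a ! i)) \<and>
      (\<forall>i j. i < j \<and> j \<in> ?I \<longrightarrow> Max (supp L v X (a ! i)) < Min (supp L v X (a ! j))) \<longleftrightarrow>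
    (\<exists>h. \<forall>i\<in>?I. a ! i \<in> lwords X (h i) (h (Suc i)) \<and> a ! i \<noteq> [])"
    by (rule block_sequence_iff[OF X]) auto
  show ?thesis
  proof
    assume w: "within_depth L v X a k"
    then obtain h where h: "\<And>i. i < length a \<Longrightarrow> a ! i \<in> lwords X (h i) (h (Suc i)) \<and> a ! i \<noteq> []"
      using b by (auto simp: within_depth_def span_words_def)
    \<comment> \<open>The supports lie below k, so the intervals may be truncated there.\<close>
    define g where "g = (\<lambda>i. min (h i) k)"
    have "a ! i \<in> lwords X (g i) (g (Suc i))" if i: "i < length a" for i
    proof -
      have *: "supp L v X (a ! i) \<subseteq> {h i..<h (Suc i)}" "is_combination v L X (supp L v X (a ! i)) (a ! i)"
        "finite (supp L v X (a ! i))" "supp L v X (a ! i) \<noteq> {}"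
        using combos_supp[OF X _ conjunct1[OF h[OF i]] conjunct2[OF h[OF i]]] by auto
      have "supp L v X (a ! i) \<subseteq> {..<k}" using w i by (simp add: within_depth_def)
      then have "supp L v X (a ! i) \<subseteq> {g i..<g (Suc i)}" using *(1) by (force simp: g_def)
      then show ?thesis using is_combination_supp[OF X _ *(2)] by blast
    qed
    then show ?r using h by (intro exI[of _ g]) (simp add: g_def)
  next
    assume ?r
    then obtain h where h: "h (length a) \<le> k"
      "\<And>i. i < length a \<Longrightarrow> a ! i \<in> lwords X (h i) (h (Suc i)) \<and> a ! i \<noteq> []" by blast
    have mono: "h (Suc i) \<le> h (length a)" if "i < length a" for i
      by (rule combos_chain_mono[of "length a" "\<lambda>i. a ! i"]) (use h(2) that in auto)
    have "supp L v X (a ! i) \<subseteq> {h i..<h (Suc i)}" if "i < length a" for i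
      using combos_supp[OF X, of L] h(2)[OF that] by blast
    then have "supp L v X (a ! i) \<subseteq> {..<k}" if "i < length a" for i
      using mono[OF that] h(1) that by fastforce
    moreover have "a ! i \<in> words L" if "i < length a" for i
      using lwords_in_words[OF X] h(2)[OF that] by blast
    moreover have "\<exists>h. \<forall>i\<in>?I. a ! i \<in> lwords X (h i) (h (Suc i)) \<and> a ! i \<noteq> []"
      using h(2) by blast
    ultimately show "within_depth L v X a k"
      using b by (simp add: within_depth_def span_words_def)
  qed
qed

lemma basic_set_iff:
  assumes X: "X \<in> var_word_seqs L v"
  shows "A \<in> basic_set L v b X \<longleftrightarrow> A \<in> word_seqs L \<and> initial (length b) A = b \<and>
     (\<exists>h. \<forall>i. A i \<in> lwords X (h i) (h (Suc i)))"
  using word_seq_le_iff[OF X] by (auto simp: basic_set_def)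

text \<open>Every finite block sequence extends to an infinite one: append the later words of \<open>X\<close>, one by one,
  with letters substituted for the variable.\<close>

lemma extend_stem:
  assumes X: "X \<in> var_word_seqs L v"
    and b: "\<And>i. i < length b \<Longrightarrow> b ! i \<in> lwords X (h i) (h (Suc i)) \<and> b ! i \<noteq> []"
    and N: "h (length b) \<le> N" and c: "\<And>i. c i \<in> L (N + i)"
  defines "A \<equiv> (\<lambda>i. if i < length b then b ! i else subst_var v (X (N + (i - length b))) (c (i - length b)))"
  shows "A \<in> basic_set L v b X"
proof -
  define g where "g = (\<lambda>i. if i < length b then h i else if i = length b then h i else N + (i - length b))"
  have A: "A i \<in> lwords X (g i) (g (Suc i))" for i
  proof (cases "i < length b")
    case True
    then show ?thesis using b[OF True] by (auto simp: A_def g_def dest: Suc_lessI)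
  next
    case False
    then have "A i \<in> lwords X (N + (i - length b)) (Suc (N + (i - length b)))"
      using combos_single[where K = L, OF c[of "i - length b"], of v X] by (simp only: A_def if_False)
    moreover have "lwords X (N + (i - length b)) (Suc (N + (i - length b))) \<subseteq> lwords X (g i) (g (Suc i))"
      by (rule combos_mono) (use False N in \<open>auto simp: g_def\<close>)
    ultimately show ?thesis by blast
  qed
  have ne: "A i \<noteq> []" for i
    using b[of i] X by (auto simp: A_def var_word_seqs_def rapidly_increasing_nonempty)
  have "rapidly_increasing A"
  proof (rule rapidly_increasing_combos[where K = L and h = g and X = X])
    show "rapidly_increasing X" using X by (simp add: var_word_seqs_def)
  qed (fact A, fact ne)
  then have "A \<in> word_seqs L"
    using lwords_in_words[OF X A] by (simp add: word_seqs_def)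
  moreover have "initial (length b) A = b"
    by (auto simp: initial_def A_def intro: nth_equalityI)
  ultimately show ?thesis using A basic_set_iff[OF X] by blast
qed

lemma tails_subset_basic_set:
  assumes X: "X \<in> var_word_seqs L v"
    and b: "\<And>i. i < length b \<Longrightarrow> b ! i \<in> lwords X (h i) (h (Suc i))" and n: "h (length b) \<le> n"
  shows "tails b n X \<subseteq> basic_set L v b X"
proof
  fix A assume A: "A \<in> tails b n X"
  then obtain g where g: "g 0 = n" "\<And>i. A (length b + i) \<in> lwords X (g i) (g (Suc i))"
    using tailsD(3) by blast
  define q where "q = (\<lambda>i. if i \<le> length b then h i else g (i - length b))"
  have nth: "b ! i = A i" if "i < length b" for i
    using initial_nth[OF tailsD(2)[OF A] that] .
  have "A i \<in> lwords X (q i) (q (Suc i))" for i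
  proof (cases "i < length b")
    case True
    then show ?thesis using b[OF True] nth[OF True] by (simp add: q_def)
  next
    case False
    then have "A i \<in> lwords X (g (i - length b)) (g (Suc (i - length b)))"
      using g(2)[of "i - length b"] by simp
    moreover have "lwords X (g (i - length b)) (g (Suc (i - length b))) \<subseteq> lwords X (q i) (q (Suc i))"
      by (rule combos_mono) (use False n g(1) in \<open>auto simp: q_def Suc_diff_le\<close>)
    ultimately show ?thesis by blast
  qed
  then show "A \<in> basic_set L v b X"
    using basic_set_iff[OF X] tailsD(1,2)[OF A] by blast
qed

text \<open>At the depth \<open>d\<close> of \<open>a\<close> the set \<open>[a,X]\<close> has no other elements: if some representation of \<open>a\<close> ended before
  \<open>d\<close>, then \<open>Y\<close>, which agrees with \<open>X\<close> there, would give \<open>a\<close> a smaller depth.\<close>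

lemma basic_set_ext_depth:
  assumes Y: "Y \<in> var_word_seqs L v" and ne: "basic_set L v a Y \<noteq> {}"
    and d: "d = nat (depth L v Y a)" and X: "X \<in> ext d Y"
  shows "basic_set L v a X = tails a d X" "tails a d X \<noteq> {}"
proof -
  have Xv: "X \<in> var_word_seqs L v" using ext_var_word_seqs[OF Y X] .
  obtain A h where "A \<in> word_seqs L" "initial (length a) A = a" "\<And>i. A i \<in> lwords Y (h i) (h (Suc i))"
    using ne basic_set_iff[OF Y] by blast
  moreover from this have "a ! i = A i" if "i < length a" for i
    using initial_nth[OF _ that] by blast
  ultimately have ex: "within_depth L v Y a (h (length a))"
    unfolding within_depth_iff[OF Y] using word_seqs_nonempty by (intro exI[of _ h]) auto
  have d': "d = (LEAST k. within_depth L v Y a k)"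
    using ex d by (auto simp: depth_def)
  have wd: "within_depth L v Y a d" unfolding d' using ex by (rule LeastI)
  have least: "d \<le> k" if "within_depth L v Y a k" for k
    unfolding d' using that by (rule Least_le)
  obtain p where p: "p (length a) \<le> d" "\<And>i. i < length a \<Longrightarrow> a ! i \<in> lwords Y (p i) (p (Suc i)) \<and> a ! i \<noteq> []"
    using wd within_depth_iff[OF Y] by blast
  have agree: "lwords X i j = lwords Y i j" if "j \<le> d" for i j
    by (rule combos_cong) (use ext_initial[OF X] that in auto)
  have pmono: "p (Suc i) \<le> d" if "i < length a" for i
  proof -
    have "p (Suc i) \<le> p (length a)"
      by (rule combos_chain_mono[of "length a" "\<lambda>i. a ! i"]) (use p(2) that in auto)
    then show ?thesis using p(1) by simp
  qed
  have pX: "a ! i \<in> lwords X (p i) (p (Suc i)) \<and> a ! i \<noteq> []" if "i < length a" for i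
    using p(2)[OF that] agree[OF pmono[OF that]] by simp
  have sub1: "tails a d X \<subseteq> basic_set L v a X"
    by (rule tails_subset_basic_set[where h = p, OF Xv _ p(1)]) (use pX in blast)
  have sub2: "basic_set L v a X \<subseteq> tails a d X"
  proof
    fix A assume "A \<in> basic_set L v a X"
    then obtain h where A: "A \<in> word_seqs L" "initial (length a) A = a"
      and h: "\<And>i. A i \<in> lwords X (h i) (h (Suc i))" using basic_set_iff[OF Xv] by blast
    have nth: "a ! i = A i" if "i < length a" for i
      using initial_nth[OF A(2) that] .
    have hm: "h i \<le> h j" if "i \<le> j" for i j
      using that by (rule combos_chain_mono[of j A, OF h word_seqs_nonempty[OF A(1)]]) simp
    have "d \<le> h (length a)"
    proof (rule ccontr)
      assume c: "\<not> d \<le> h (length a)"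
      have "within_depth L v Y a (h (length a))"
        unfolding within_depth_iff[OF Y]
      proof (intro exI[of _ h] conjI allI impI)
        fix i assume i: "i < length a"
        have "h (Suc i) \<le> d" using hm[of "Suc i" "length a"] i c by simp
        then show "a ! i \<in> lwords Y (h i) (h (Suc i))" using h[of i] agree nth[OF i] by simp
        show "a ! i \<noteq> []" using nth[OF i] word_seqs_nonempty[OF A(1)] by simp
      qed simp
      then show False using least c by blast
    qed
    then show "A \<in> tails a d X"
      by (intro tailsI[of _ _ _ "\<lambda>i. h (length a + i)"]) (use A h in auto)
  qed
  show "basic_set L v a X = tails a d X" using sub1 sub2 by blast
  obtain N c where N: "d \<le> N" and c: "\<And>i. c i \<in> L (N + i)" using letter_sequence by blast
  have "p (length a) \<le> N" using p(1) N by simp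
  from extend_stem[OF Xv pX this c] sub2 show "tails a d X \<noteq> {}" by blast
qed

end

section \<open>Perfect subsets of the Cantor space\<close>

definition cyl :: "(nat \<Rightarrow> bool) \<Rightarrow> nat \<Rightarrow> (nat \<Rightarrow> bool) set" where
  "cyl x m = {y. \<forall>i<m. y i = x i}"

lemma cyl_self [simp]: "x \<in> cyl x m"
  by (simp add: cyl_def)

lemma cyl_antimono: "m \<le> n \<Longrightarrow> cyl x n \<subseteq> cyl x m"
  by (auto simp: cyl_def)

lemma cyl_eq: "y \<in> cyl x m \<Longrightarrow> cyl y m = cyl x m"
  by (auto simp: cyl_def)

lemma closed_cyl: "closed (cyl x m)"
proof -
  have "closed {y :: nat \<Rightarrow> bool. y i = x i}" for i
    using closed_coordinate[of i] by (cases "x i") simp_all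
  moreover have "cyl x m = (\<Inter>i\<in>{..<m}. {y. y i = x i})" by (auto simp: cyl_def)
  ultimately show ?thesis by (simp add: closed_INT)
qed

lemma finite_cyl_cover: "\<exists>R. finite R \<and> (\<forall>x. \<exists>r\<in>R. cyl x m = cyl r m)"
proof (intro exI conjI allI)
  let ?R = "(\<lambda>S i. i \<in> S) ` Pow {..<m}"
  show "finite ?R" by simp
  fix x :: "nat \<Rightarrow> bool"
  show "\<exists>r\<in>?R. cyl x m = cyl r m"
  proof
    show "(\<lambda>i. i \<in> {i. i < m \<and> x i}) \<in> ?R" by (rule imageI) auto
  qed (auto simp: cyl_def)
qed

lemma open_cyl: "open (cyl x m)"
proof -
  have "open {f :: nat \<Rightarrow> bool. \<forall>i\<in>{..<m}. f i \<in> {x i}}"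
    by (rule product_topology_basis'[of "{..<m}" "\<lambda>i. {x i}" "\<lambda>i. i"]) (simp_all add: open_discrete)
  then show ?thesis by (simp add: cyl_def Ball_def)
qed

lemma open_contains_cyl:
  assumes "open U" "x \<in> U"
  shows "\<exists>m. cyl x m \<subseteq> U"
proof -
  have "openin (product_topology (\<lambda>i::nat. euclidean :: bool topology) UNIV) U"
    using assms(1) by (simp add: open_fun_def)
  from product_topology_open_contains_basis[OF this assms(2)]
  obtain V where V: "x \<in> Pi\<^sub>E UNIV V" "finite {i. V i \<noteq> UNIV}" "Pi\<^sub>E UNIV V \<subseteq> U"
    by auto
  obtain m where m: "{i. V i \<noteq> UNIV} \<subseteq> {..<m}" using V(2) finite_nat_iff_bounded by blast
  have "y \<in> Pi\<^sub>E UNIV V" if y: "y \<in> cyl x m" for y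
  proof (rule PiE_I)
    fix i
    show "y i \<in> V i"
    proof (cases "i < m")
      case True
      then show ?thesis using y V(1) by (auto simp: cyl_def PiE_iff)
    next
      case False
      then have "V i = UNIV" using m by auto
      then show ?thesis by simp
    qed
  qed simp
  then show ?thesis using V(3) by blast
qed

lemma perfect_set_iff:
  "perfect_set M \<longleftrightarrow> M \<noteq> {} \<and> closed M \<and> (\<forall>x\<in>M. \<forall>m. \<exists>y\<in>M \<inter> cyl x m. y \<noteq> x)"
proof -
  have "x isolated_in M \<longleftrightarrow> (\<exists>m. \<forall>y\<in>M \<inter> cyl x m. y = x)" if x: "x \<in> M" for x
  proof
    assume "x isolated_in M"
    then obtain T where T: "open T" "T \<inter> M = {x}" by (auto simp: isolated_in_def)
    then obtain m where "cyl x m \<subseteq> T" using open_contains_cyl by blast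
    then show "\<exists>m. \<forall>y\<in>M \<inter> cyl x m. y = x" using T by blast
  next
    assume "\<exists>m. \<forall>y\<in>M \<inter> cyl x m. y = x"
    then obtain m where "\<forall>y\<in>M \<inter> cyl x m. y = x" by blast
    then have "cyl x m \<inter> M = {x}" using x by auto
    then show "x isolated_in M" using open_cyl x by (auto simp: isolated_in_def)
  qed
  then show ?thesis by (auto simp: perfect_set_def)
qed

lemma perfect_setD:
  assumes "perfect_set M"
  shows "M \<noteq> {}" "closed M" "x \<in> M \<Longrightarrow> \<exists>y\<in>M \<inter> cyl x m. y \<noteq> x"
  using assms by (auto simp: perfect_set_iff)

lemma perfect_Int_cyl:
  assumes M: "perfect_set M" and ne: "M \<inter> cyl x m \<noteq> {}"
  shows "perfect_set (M \<inter> cyl x m)"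
  unfolding perfect_set_iff
proof (intro conjI ballI allI)
  show "closed (M \<inter> cyl x m)" using perfect_setD(2)[OF M] closed_cyl by blast
  fix z k assume z: "z \<in> M \<inter> cyl x m"
  then obtain y where y: "y \<in> M" "y \<in> cyl z (max m k)" "y \<noteq> z"
    using perfect_setD(3)[OF M, of z "max m k"] by blast
  have "y \<in> cyl z m" "y \<in> cyl z k" using y(2) by (auto simp: cyl_def)
  then show "\<exists>y\<in>M \<inter> cyl x m \<inter> cyl z k. y \<noteq> z" using y z cyl_eq by blast
qed (rule ne)

lemma perfect_subset_avoiding:
  assumes M: "perfect_set M"
  shows "\<exists>M'\<subseteq>M. perfect_set M' \<and> z \<notin> M'"
proof -
  obtain x where x: "x \<in> M" "x \<noteq> z"
    using perfect_setD(1)[OF M] perfect_setD(3)[OF M, of z 0] by blast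
  then obtain i where "x i \<noteq> z i" by auto
  then have "z \<notin> cyl x (Suc i)" by (auto simp: cyl_def)
  moreover have "perfect_set (M \<inter> cyl x (Suc i))" using x(1) by (intro perfect_Int_cyl[OF M]) auto
  ultimately show ?thesis by blast
qed

text \<open>A perfect set can be shrunk to avoid the points of an enumeration one after the other, and by
  compactness something remains.\<close>

lemma perfect_uncountable:
  assumes M: "perfect_set M"
  shows "uncountable M"
proof
  assume "countable M"
  then obtain z where z: "M \<subseteq> range (z :: nat \<Rightarrow> _)"
    using perfect_setD(1)[OF M] by (metis order_refl uncountable_def)
  have "\<exists>N. \<forall>k. (perfect_set (N k) \<and> N k \<subseteq> M) \<and> (N (Suc k) \<subseteq> N k \<and> z k \<notin> N (Suc k))"
  proof (rule dependent_nat_choice)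
    fix N k assume "perfect_set N \<and> N \<subseteq> M"
    moreover from this obtain N' where "N' \<subseteq> N" "perfect_set N'" "z k \<notin> N'"
      using perfect_subset_avoiding[of N "z k"] by blast
    ultimately show "\<exists>N'. (perfect_set N' \<and> N' \<subseteq> M) \<and> (N' \<subseteq> N \<and> z k \<notin> N')" by blast
  qed (use M in blast)
  then obtain N where N: "\<And>k. perfect_set (N k)" "\<And>k. N k \<subseteq> M" "\<And>k. N (Suc k) \<subseteq> N k"
    "\<And>k. z k \<notin> N (Suc k)" by blast
  have "(\<Inter>k. N k) \<noteq> {}"
    using nested_closed_nonempty[of N] N perfect_setD by metis
  then obtain x where x: "\<And>k. x \<in> N k" by blast
  then obtain k where "x = z k" using N(2)[of 0] z by blast
  then show False using x N(4) by blast
qed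

text \<open>A perfect set grown from points. The sets \<open>P k\<close> increase, every point of level \<open>k\<close> gets a companion
  in its cylinder at the next level, and new points stay in the cylinders of level \<open>k\<close>; as these cylinders are
  closed and finite in number, so does the closure.\<close>

lemma perfect_closure_of_tree:
  assumes P: "\<And>k. finite (P k)" "P 0 \<noteq> {}" "\<And>k. P k \<subseteq> P (Suc k)"
    and m: "\<And>k. m k < m (Suc k)"
    and split: "\<And>k p. p \<in> P k \<Longrightarrow> \<exists>q\<in>P (Suc k). q \<noteq> p \<and> q \<in> cyl p (m k)"
    and cover: "\<And>k q. q \<in> P (Suc k) \<Longrightarrow> \<exists>p\<in>P k. q \<in> cyl p (m k)"
  shows "perfect_set (closure (\<Union>k. P k))" "closure (\<Union>k. P k) \<subseteq> (\<Union>p\<in>P k. cyl p (m k))"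
proof -
  have mono: "P j \<subseteq> P k" if "j \<le> k" for j k
    using lift_Suc_mono_le[of P] P(3) that by blast
  have mm: "m j \<le> m k" if "j \<le> k" for j k
    using lift_Suc_mono_le[of m] m that by (metis less_imp_le)
  have mk: "k \<le> m k" for k
    by (rule strict_mono_imp_increasing) (simp add: strict_monoI_Suc m)
  have cov: "\<exists>p\<in>P k. q \<in> cyl p (m k)" if "q \<in> P (k + j)" for q j k
    using that
  proof (induction j arbitrary: q)
    case (Suc j)
    then obtain p where p: "p \<in> P (k + j)" "q \<in> cyl p (m (k + j))" using cover by fastforce
    then obtain r where r: "r \<in> P k" "p \<in> cyl r (m k)" using Suc.IH by blast
    have "q \<in> cyl p (m k)" using p(2) cyl_antimono[OF mm[of k "k + j"], of p] by auto
    then show ?case using r cyl_eq by blast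
  next
    case 0
    then show ?case by (intro bexI[of _ q]) simp_all
  qed
  have "(\<Union>k. P k) \<subseteq> (\<Union>p\<in>P k. cyl p (m k))"
  proof
    fix q assume "q \<in> (\<Union>k. P k)"
    then obtain j where "q \<in> P j" by blast
    then have "q \<in> P (k + j)" using mono[of j "k + j"] by auto
    then show "q \<in> (\<Union>p\<in>P k. cyl p (m k))" using cov by blast
  qed
  moreover have "closed (\<Union>p\<in>P k. cyl p (m k))" using P(1) closed_cyl by (intro closed_UN) auto
  ultimately show "closure (\<Union>k. P k) \<subseteq> (\<Union>p\<in>P k. cyl p (m k))" by (rule closure_minimal)
  show "perfect_set (closure (\<Union>k. P k))"
    unfolding perfect_set_iff
  proof (intro conjI ballI allI)
    show "closure (\<Union>k. P k) \<noteq> {}" using P(2) closure_subset by blast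
    fix x l assume "x \<in> closure (\<Union>k. P k)"
    then have "cyl x l \<inter> (\<Union>k. P k) \<noteq> {}"
      using open_cyl[of x l] cyl_self[of x l] open_Int_closure_eq_empty[of "cyl x l" "\<Union>k. P k"] by blast
    then obtain p j where p: "p \<in> cyl x l" "p \<in> P j" by blast
    define k where "k = max j l"
    have "p \<in> P k" using p(2) mono[of j k] by (auto simp: k_def)
    then obtain q where q: "q \<in> P (Suc k)" "q \<noteq> p" "q \<in> cyl p (m k)" using split by blast
    have "l \<le> m k" using mk[of k] by (simp add: k_def)
    then have "q \<in> cyl p l" using q(3) cyl_antimono by blast
    then have "q \<in> cyl x l" using p(1) cyl_eq by blast
    moreover have "p \<in> (\<Union>k. P k)" "q \<in> (\<Union>k. P k)" using p(2) q(1) by auto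
    then have "p \<in> closure (\<Union>k. P k)" "q \<in> closure (\<Union>k. P k)"
      by (simp_all add: closure_def)
    ultimately show "\<exists>y\<in>closure (\<Union>k. P k) \<inter> cyl x l. y \<noteq> x"
      using p(1) q(2) by (cases "p = x") blast+
  qed simp
qed

text \<open>A perfect set obtained by shrinking. The splitting condition keeps two separated pieces alive in
  every cylinder that meets \<open>M k\<close>, and compactness finds a point of the intersection in each of them.\<close>

lemma perfect_fusion:
  assumes M: "\<And>k. perfect_set (M k)" "\<And>k. M (Suc k) \<subseteq> M k"
    and m: "\<And>k. m k < m (Suc k)"
    and split: "\<And>k x. x \<in> M k \<Longrightarrow>
      \<exists>y z. y \<in> M (Suc k) \<inter> cyl x (m k) \<and> z \<in> M (Suc k) \<inter> cyl x (m k) \<and> z \<notin> cyl y (m (Suc k))"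
  shows "perfect_set (\<Inter>k. M k)"
proof -
  have cl: "closed (M k)" for k using perfect_setD(2)[OF M(1)] .
  have dec: "M k \<subseteq> M j" if "j \<le> k" for j k
    using lift_Suc_antimono_le[of M] M(2) that by blast
  have mm: "m j \<le> m k" if "j \<le> k" for j k
    using lift_Suc_mono_le[of m] m that by (metis less_imp_le)
  have mk: "k \<le> m k" for k
    by (rule strict_mono_imp_increasing) (simp add: strict_monoI_Suc m)
  have ne: "\<exists>x. (\<forall>k. x \<in> M k) \<and> x \<in> cyl y (m j)" if y: "y \<in> M j" for y j
  proof -
    have meet: "M (j + i) \<inter> cyl y (m j) \<noteq> {}" for i
    proof (induction i)
      case (Suc i)
      then obtain x where x: "x \<in> M (j + i)" "x \<in> cyl y (m j)" by blast
      then obtain x' where x': "x' \<in> M (Suc (j + i))" "x' \<in> cyl x (m (j + i))" using split by blast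
      have "x' \<in> cyl x (m j)" using x'(2) cyl_antimono[OF mm[of j "j + i"]] by auto
      then have "x' \<in> cyl y (m j)" using x(2) cyl_eq by blast
      then show ?case using x'(1) by auto
    qed (use y in auto)
    have "(\<Inter>i. M (j + i) \<inter> cyl y (m j)) \<noteq> {}"
    proof (rule nested_closed_nonempty)
      show "closed (M (j + i) \<inter> cyl y (m j))" for i using cl closed_cyl by blast
      show "M (j + Suc i) \<inter> cyl y (m j) \<subseteq> M (j + i) \<inter> cyl y (m j)" for i using M(2) by auto
    qed (rule meet)
    then obtain x where x: "\<And>i. x \<in> M (j + i)" "x \<in> cyl y (m j)" by blast
    have "x \<in> M k" for k using x(1)[of k] dec[of k "j + k"] by auto
    then show ?thesis using x(2) by blast
  qed
  show ?thesis
    unfolding perfect_set_iff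
  proof (intro conjI ballI allI)
    obtain y where "y \<in> M 0" using perfect_setD(1)[OF M(1)] by blast
    then show "(\<Inter>k. M k) \<noteq> {}" using ne by blast
    show "closed (\<Inter>k. M k)" using cl by blast
    fix x l assume x: "x \<in> (\<Inter>k. M k)"
    then obtain y z where yz: "y \<in> M (Suc l)" "y \<in> cyl x (m l)" "z \<in> M (Suc l)" "z \<in> cyl x (m l)"
      "z \<notin> cyl y (m (Suc l))" using split[of x l] by blast
    obtain y' z' where y': "\<forall>k. y' \<in> M k" "y' \<in> cyl y (m (Suc l))"
      and z': "\<forall>k. z' \<in> M k" "z' \<in> cyl z (m (Suc l))" using ne yz by meson
    have "y' \<noteq> z'" using yz(5) y'(2) z'(2) by (auto simp: cyl_def)
    moreover have "y' \<in> cyl x l" "z' \<in> cyl x l"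
      using y'(2) z'(2) yz(2,4) m[of l] mk[of l] by (auto simp: cyl_def)
    moreover have "y' \<in> (\<Inter>k. M k)" "z' \<in> (\<Inter>k. M k)" using y'(1) z'(1) by simp_all
    ultimately show "\<exists>y\<in>(\<Inter>k. M k) \<inter> cyl x l. y \<noteq> x" by (cases "y' = x") blast+
  qed
qed

lemma perfect_splitting_level:
  assumes M: "perfect_set M"
  shows "\<exists>n>m. \<forall>x\<in>M. \<exists>y z. y \<in> M \<inter> cyl x m \<and> z \<in> M \<inter> cyl x m \<and> z \<notin> cyl y n"
proof -
  obtain R where R: "finite R" "\<And>x. \<exists>r\<in>R. cyl x m = cyl r m" using finite_cyl_cover by metis
  have "\<exists>n y z. M \<inter> cyl r m \<noteq> {} \<longrightarrow> y \<in> M \<inter> cyl r m \<and> z \<in> M \<inter> cyl r m \<and> z \<notin> cyl y n" for r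
  proof (cases "M \<inter> cyl r m = {}")
    case False
    then obtain y where y: "y \<in> M \<inter> cyl r m" by blast
    then obtain z where z: "z \<in> M" "z \<in> cyl y m" "z \<noteq> y" using perfect_setD(3)[OF M, of y m] by blast
    then obtain i where "z i \<noteq> y i" by auto
    then have "z \<notin> cyl y (Suc i)" by (auto simp: cyl_def)
    moreover have "z \<in> cyl r m" using z(2) y cyl_eq by blast
    ultimately show ?thesis using y z by blast
  qed simp
  then obtain n where n: "\<And>r. M \<inter> cyl r m \<noteq> {} \<Longrightarrow> \<exists>y z. y \<in> M \<inter> cyl r m \<and> z \<in> M \<inter> cyl r m \<and> z \<notin> cyl y (n r)"
    by metis
  \<comment> \<open>The sum is a convenient common upper bound of the finitely many levels.\<close>
  define N where "N = Suc (m + (\<Sum>r\<in>R. n r))"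
  have "\<exists>y z. y \<in> M \<inter> cyl x m \<and> z \<in> M \<inter> cyl x m \<and> z \<notin> cyl y N" if x: "x \<in> M" for x
  proof -
    obtain r where r: "r \<in> R" "cyl x m = cyl r m" using R(2) by blast
    have "M \<inter> cyl r m \<noteq> {}" using x cyl_self[of x m] unfolding r(2) by blast
    then obtain y z where yz: "y \<in> M \<inter> cyl r m" "z \<in> M \<inter> cyl r m" "z \<notin> cyl y (n r)" using n by blast
    have "n r \<le> N" using member_le_sum[OF r(1), of n] R(1) by (simp add: N_def)
    then have "z \<notin> cyl y N" using yz(3) cyl_antimono by blast
    then show ?thesis using yz r(2) by auto
  qed
  then show ?thesis by (intro exI[of _ N]) (auto simp: N_def)
qed

text \<open>Think of the topology generated by the cylinders and the sets of all \<open>q\<close> with \<open>w \<in> star q\<close>, for \<open>w\<close> in the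
  countable set \<open>W\<close>. It has a countable base, so all but countably many points of \<open>D0\<close> are
  condensation points of \<open>D0\<close>, and these form a set that is dense in itself.\<close>

lemma condensation_points:
  fixes D0 :: "(nat \<Rightarrow> bool) set" and star :: "(nat \<Rightarrow> bool) \<Rightarrow> 'b set"
  assumes D0: "uncountable D0" and W: "countable W" "\<And>p. star p \<subseteq> W"
  shows "\<exists>D\<subseteq>D0. D \<noteq> {} \<and> (\<forall>p\<in>D. \<forall>m E. finite E \<longrightarrow> E \<subseteq> star p \<longrightarrow>
    (\<exists>q\<in>D. q \<noteq> p \<and> q \<in> cyl p m \<and> E \<subseteq> star q))"
proof -
  define S where "S = (\<lambda>Z E. {q\<in>D0. q \<in> Z \<and> E \<subseteq> star q})"
  define D where "D = {p\<in>D0. \<forall>m E. finite E \<longrightarrow> E \<subseteq> star p \<longrightarrow> uncountable (S (cyl p m) E)}"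
  define Z where "Z = (\<Union>m. range (\<lambda>r. cyl r m))"
  have "countable Z"
  proof -
    have "finite (range (\<lambda>r. cyl r m))" for m
    proof -
      obtain R where R: "finite R" "\<forall>x. \<exists>r\<in>R. cyl x m = cyl r m" using finite_cyl_cover by blast
      have "range (\<lambda>r. cyl r m) \<subseteq> (\<lambda>r. cyl r m) ` R"
      proof
        fix B assume "B \<in> range (\<lambda>r. cyl r m)"
        then obtain x where "B = cyl x m" by blast
        then show "B \<in> (\<lambda>r. cyl r m) ` R" using R(2) by (metis imageI)
      qed
      then show ?thesis using R(1) finite_surj by blast
    qed
    then show ?thesis unfolding Z_def by (intro countable_UN) (simp_all add: countable_finite)
  qed
  define B where "B = {(Q, E). Q \<in> Z \<and> E \<in> {E. finite E \<and> E \<subseteq> W} \<and> countable (S Q E)}"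
  have "countable {E. finite E \<and> E \<subseteq> W}" using countable_Collect_finite_subset[OF W(1)] .
  then have "countable (Z \<times> {E. finite E \<and> E \<subseteq> W})" using \<open>countable Z\<close> by simp
  moreover have "B \<subseteq> Z \<times> {E. finite E \<and> E \<subseteq> W}" by (auto simp: B_def)
  ultimately have "countable B" by (rule countable_subset[rotated])
  then have cb: "countable (\<Union>(Q, E)\<in>B. S Q E)" by (rule countable_UN) (auto simp: B_def)
  have "D0 - D \<subseteq> (\<Union>(Q, E)\<in>B. S Q E)"
  proof
    fix p assume p: "p \<in> D0 - D"
    then obtain m E where mE: "finite E" "E \<subseteq> star p" "countable (S (cyl p m) E)"
      by (auto simp: D_def)
    have "cyl p m \<in> Z" by (auto simp: Z_def)
    moreover have "E \<subseteq> W" using mE(2) W(2)[of p] by (rule order_trans)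
    ultimately have "(cyl p m, E) \<in> B" using mE by (simp add: B_def)
    moreover have "p \<in> S (cyl p m) E" using p mE(2) by (simp add: S_def)
    ultimately show "p \<in> (\<Union>(Q, E)\<in>B. S Q E)" by blast
  qed
  then have cD: "countable (D0 - D)" using cb countable_subset by blast
  have meet: "\<exists>q\<in>D. q \<noteq> p \<and> q \<in> Y" if Y: "uncountable Y" "Y \<subseteq> D0" for Y p
  proof (rule ccontr)
    assume "\<not> ?thesis"
    then have "Y \<subseteq> insert p (D0 - D)" using Y(2) by blast
    then show False using Y(1) cD countable_subset by (metis countable_insert)
  qed
  have "D \<subseteq> D0" by (auto simp: D_def)
  moreover have "D \<noteq> {}" using meet[OF D0] by blast
  moreover have "\<exists>q\<in>D. q \<noteq> p \<and> q \<in> cyl p m \<and> E \<subseteq> star q"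
    if "p \<in> D" "finite E" "E \<subseteq> star p" for p m E
  proof -
    have "uncountable (S (cyl p m) E)" using that by (simp add: D_def)
    moreover have "S (cyl p m) E \<subseteq> D0" by (auto simp: S_def)
    ultimately obtain q where "q \<in> D" "q \<noteq> p" "q \<in> S (cyl p m) E" using meet by blast
    then show ?thesis by (auto simp: S_def)
  qed
  ultimately show ?thesis by (intro exI[of _ D]) simp
qed

section \<open>Hales--Jewett ultrafilters\<close>

lemma tensor_conc:
  assumes "ultra p" "ultra q" "p S"
    and "\<And>w. w \<in> S \<Longrightarrow> \<exists>T. q T \<and> (\<forall>u\<in>T. w @ u \<in> R)"
  shows "tensor p q R"
  unfolding tensor_def
proof (rule ultra_mono[OF assms(1,3)])
  show "S \<subseteq> {w. q {u. w @ u \<in> R}}"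
  proof
    fix w assume "w \<in> S"
    then obtain T where T: "q T" "\<forall>u\<in>T. w @ u \<in> R" using assms(4) by blast
    have "T \<subseteq> {u. w @ u \<in> R}" using T(2) by blast
    then show "w \<in> {w. q {u. w @ u \<in> R}}" using ultra_mono[OF assms(2) T(1)] by simp
  qed
qed

text \<open>The Galvin--Glazer observation. Applied to \<open>{u. w @ u \<in> B}\<close> it shows that the set in the conclusion is closed
  under a large set of continuations, so that concatenations of words can be built inside \<open>B\<close> one
  factor at a time.\<close>

lemma idempotent_star:
  assumes U: "ultra U" "tensor U U = U" "U B"
  shows "U {w \<in> B. U {u. w @ u \<in> B}}"
proof -
  have "tensor U U B" using U(2,3) by simp
  then have "U {w. U {u. w @ u \<in> B}}" by (simp only: tensor_def)
  then have "U (B \<inter> {w. U {u. w @ u \<in> B}})" using U ultra_Int[OF U(1)] by simp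
  then show ?thesis by (simp add: Int_def)
qed

context alphabet
begin

definition lspan :: "(nat \<Rightarrow> 'a list) \<Rightarrow> nat \<Rightarrow> 'a list set" where
  "lspan X n = {w. w \<noteq> [] \<and> (\<exists>m. w \<in> lwords X n m)}"

definition vspan :: "(nat \<Rightarrow> 'a list) \<Rightarrow> nat \<Rightarrow> 'a list set" where
  "vspan X n = {x. v \<in> set x \<and> (\<exists>m. x \<in> vwords X n m)}"

lemma lspan_append:
  assumes "w \<in> lwords X n m" "w \<noteq> []" "u \<in> lspan X m"
  shows "w @ u \<in> lspan X n"
proof -
  obtain k where k: "u \<in> lwords X m k" "u \<noteq> []" using assms(3) by (auto simp: lspan_def)
  have "n \<le> m" "m \<le> k"
    using combos_nonempty_less[OF assms(1,2)] combos_nonempty_less[OF k] by simp_all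
  then have "w @ u \<in> lwords X n k" using combos_append[OF assms(1) k(1)] by blast
  then show ?thesis using assms(2) by (auto simp: lspan_def)
qed

lemma vspan_append:
  assumes "w \<in> vwords X n m" "w \<noteq> []" "u \<in> vwords X m k" "u \<noteq> []" "v \<in> set (w @ u)"
  shows "w @ u \<in> vspan X n"
proof -
  have "n \<le> m" "m \<le> k"
    using combos_nonempty_less[OF assms(1,2)] combos_nonempty_less[OF assms(3,4)] by simp_all
  then have "w @ u \<in> vwords X n k" using combos_append[OF assms(1,3)] by blast
  then show ?thesis using assms(5) by (auto simp: vspan_def)
qed

text \<open>Let \<open>K\<close> and \<open>J\<close> be the ultrafilters that contain all spans of tails of \<open>X\<close>, with constant and with
  variable words. Restricting to tails has two effects. Concatenations respect the order
  of supports, since almost every second factor lies beyond the first; and substituting any fixed letter \<open>c\<close>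
  is eventually legitimate, although \<open>c\<close> may be missing from the first sets of letters.\<close>

lemma hales_jewett_ultrafilters:
  assumes X: "X \<in> var_word_seqs L v"
  shows "\<exists>U V. ultra U \<and> ultra V \<and> tensor U U = U \<and> (\<forall>n. U (lspan X n)) \<and> (\<forall>n. V (vspan X n)) \<and>
    (\<forall>n. \<forall>c\<in>L n. \<forall>A. U A \<longrightarrow> V {x. subst_var v x c \<in> A})"
proof -
  define K where "K = {p. ultra p} \<inter> (\<Inter>n. {p. p (lspan X n)})"
  define J where "J = {p. ultra p} \<inter> (\<Inter>n. {p. p (vspan X n)})"
  have Kd: "p \<in> K \<longleftrightarrow> ultra p \<and> (\<forall>n. p (lspan X n))" for p by (simp add: K_def)
  have Jd: "p \<in> J \<longleftrightarrow> ultra p \<and> (\<forall>n. p (vspan X n))" for p by (simp add: J_def)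
  have Xne: "X n \<noteq> []" "v \<in> set (X n)" for n
    using X by (auto simp: var_word_seqs_def var_words_def rapidly_increasing_nonempty)
  have K1: "compact K"
    unfolding K_def
    by (intro closed_imp_compact_bool closed_Int closed_ultra closed_INT ballI closed_coordinate)
  have J1: "compact J"
    unfolding J_def
    by (intro closed_imp_compact_bool closed_Int closed_ultra closed_INT ballI closed_coordinate)
  have K2: "K \<noteq> {}"
  proof (rule ultra_with_nested_sets[of "lspan X"])
    fix n
    obtain N c where N: "n \<le> N" and c: "\<And>i. c i \<in> L (N + i)" using letter_sequence[of n] by blast
    have "lwords X N (Suc N) \<subseteq> lwords X n (Suc N)" by (rule combos_mono) (use N in auto)
    moreover have "subst_var v (X N) (c 0) \<in> lwords X N (Suc N)"
      using c[of 0] by (intro combos_single) simp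
    ultimately have "subst_var v (X N) (c 0) \<in> lwords X n (Suc N)" by (rule subsetD)
    moreover have "subst_var v (X N) (c 0) \<noteq> []" using Xne(1) by simp
    ultimately show "lspan X n \<noteq> {}" unfolding lspan_def by blast
  next
    fix n
    have "lwords X (Suc n) m \<subseteq> lwords X n m" for m by (rule combos_mono) auto
    then show "lspan X (Suc n) \<subseteq> lspan X n" by (auto simp: lspan_def)
  next
    fix p assume "ultra p" "\<And>n. p (lspan X n)"
    then show "K \<noteq> {}" using Kd by blast
  qed
  have J2: "J \<noteq> {}"
  proof (rule ultra_with_nested_sets[of "vspan X"])
    show "vspan X n \<noteq> {}" for n
      using vwords_self[of X n] Xne(2)[of n] by (auto simp: vspan_def simp del: combos.simps)
  next
    fix n
    have "vwords X (Suc n) m \<subseteq> vwords X n m" for m by (rule combos_mono) auto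
    then show "vspan X (Suc n) \<subseteq> vspan X n" by (auto simp: vspan_def)
  next
    fix p assume "ultra p" "\<And>n. p (vspan X n)"
    then show "J \<noteq> {}" using Jd by blast
  qed
  have K3: "tensor p q \<in> K" if p: "p \<in> K" and q: "q \<in> K" for p q
  proof -
    have "tensor p q (lspan X n)" for n
    proof (rule tensor_conc[of p q "lspan X n"])
      fix w assume "w \<in> lspan X n"
      then obtain m where m: "w \<in> lwords X n m" "w \<noteq> []" by (auto simp: lspan_def)
      show "\<exists>T. q T \<and> (\<forall>u\<in>T. w @ u \<in> lspan X n)"
        using q lspan_append[OF m] by (intro exI[of _ "lspan X m"]) (simp add: Kd)
    qed (use p q in \<open>auto simp: Kd\<close>)
    then show ?thesis using p q ultra_tensor[of p q] by (simp add: Kd)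
  qed
  have mixed: "tensor p q \<in> J" if p: "p \<in> K \<union> J" and q: "q \<in> K \<union> J" and pq: "p \<in> J \<or> q \<in> J" for p q
  proof -
    define S where "S = (\<lambda>p n. if p \<in> J then vspan X n else lspan X n)"
    have S: "ultra p \<and> p (S p n)" if "p \<in> K \<union> J" for p n using that by (auto simp: S_def Kd Jd)
    have Sv: "w \<noteq> [] \<and> (\<exists>m. w \<in> vwords X n m) \<and> (p \<in> J \<longrightarrow> v \<in> set w)" if "w \<in> S p n" for p n w
      using that lwords_subset_vwords by (force simp: S_def lspan_def vspan_def split: if_splits)
    have "tensor p q (vspan X n)" for n
    proof (rule tensor_conc[of p q "S p n"])
      fix w assume "w \<in> S p n"
      then obtain m where m: "w \<noteq> []" "w \<in> vwords X n m" "p \<in> J \<longrightarrow> v \<in> set w" using Sv by blast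
      have "w @ u \<in> vspan X n" if "u \<in> S q m" for u
      proof -
        obtain k where k: "u \<noteq> []" "u \<in> vwords X m k" "q \<in> J \<longrightarrow> v \<in> set u" using Sv \<open>u \<in> S q m\<close> by blast
        show ?thesis by (rule vspan_append[OF m(2,1) k(2,1)]) (use m k pq in auto)
      qed
      then show "\<exists>T. q T \<and> (\<forall>u\<in>T. w @ u \<in> vspan X n)" using S[OF q] by blast
    qed (use S p q in auto)
    then show ?thesis using S[OF p] S[OF q] ultra_tensor[of p q] by (simp add: Jd)
  qed
  show ?thesis
  proof (rule tensor.minimal_idempotent_below[OF K1 K2 K3 J1 J2])
    fix U V
    assume U: "U \<in> K" "tensor U U = U" and V: "V \<in> J"
      and hom: "\<And>\<phi>. (\<And>p q. \<phi> (tensor p q) = tensor (\<phi> p) (\<phi> q)) \<Longrightarrow> \<phi> ` J \<subseteq> K \<Longrightarrow> \<phi> U = U \<Longrightarrow> \<phi> V = U"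
    have "V {x. subst_var v x c \<in> A}" if c: "c \<in> L k" and A: "U A" for c k A
    proof -
      define \<phi> :: "('a list set \<Rightarrow> bool) \<Rightarrow> 'a list set \<Rightarrow> bool" where "\<phi> = (\<lambda>p A. p {x. subst_var v x c \<in> A})"
      have "\<phi> V = U"
      proof (rule hom)
        show "\<phi> (tensor p q) = tensor (\<phi> p) (\<phi> q)" for p q
          by (rule ext) (simp add: \<phi>_def tensor_def)
        show "\<phi> ` J \<subseteq> K"
        proof
          fix r assume "r \<in> \<phi> ` J"
          then obtain p where p: "p \<in> J" "r = \<phi> p" by blast
          have up: "ultra p" using p by (simp add: Jd)
          have "{x. subst_var v x c \<in> A \<inter> B} = {x. subst_var v x c \<in> A} \<inter> {x. subst_var v x c \<in> B}"
            "{x. subst_var v x c \<in> - A} = - {x. subst_var v x c \<in> A}" for A B by auto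
          then have "ultra r"
            unfolding ultra_def p(2) \<phi>_def by (simp only: ultra_Int[OF up] ultra_Compl[OF up]) simp
          moreover have "r (lspan X n)" for n
          proof -
            have "vspan X (max n k) \<subseteq> {x. subst_var v x c \<in> lspan X n}"
            proof
              fix x assume "x \<in> vspan X (max n k)"
              then obtain m where "x \<in> vwords X (max n k) m" "v \<in> set x" by (auto simp: vspan_def)
              then have m: "x \<in> vwords X (max n k) m" "x \<noteq> []" by auto
              have "c \<in> L (max n k)" using c L_mono[of k "max n k"] by auto
              then have "subst_var v x c \<in> lwords X (max n k) m" using subst_vwords m(1) by blast
              moreover have "lwords X (max n k) m \<subseteq> lwords X n m" by (rule combos_mono) auto
              ultimately show "x \<in> {x. subst_var v x c \<in> lspan X n}" using m(2) by (auto simp: lspan_def)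
            qed
            then show ?thesis using p ultra_mono[OF up] by (auto simp: Jd \<phi>_def)
          qed
          ultimately show "r \<in> K" by (simp add: Kd)
        qed
        show "\<phi> U = U"
        proof (rule ext)
          fix B
          have uU: "ultra U" "U (lspan X 0)" using U by (simp_all add: Kd)
          have "subst_var v w c = w" if "w \<in> lspan X 0" for w
            using that v_notin_lwords by (auto simp: lspan_def intro!: subst_var_no_var)
          then have "{x. subst_var v x c \<in> B} \<inter> lspan X 0 = B \<inter> lspan X 0" by auto
          then have "U {x. subst_var v x c \<in> B} \<longleftrightarrow> U B"
            using ultra_Int[OF uU(1), of _ "lspan X 0"] uU(2) by metis
          then show "\<phi> U B = U B" by (simp add: \<phi>_def)
        qed
      qed
      then have "\<phi> V A" using A by simp
      then show ?thesis by (simp add: \<phi>_def)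
    qed
    then show ?thesis using U V unfolding Kd Jd by blast
  qed (use mixed in auto)
qed

lemma countable_lspan: "countable (lspan X n)"
proof -
  have "lspan X n \<subseteq> (\<Union>m. lwords X n m)" by (auto simp: lspan_def)
  moreover have "countable (\<Union>m. lwords X n m)"
    by (intro countable_UN) (simp_all add: countable_finite finite_combos fin)
  ultimately show ?thesis by (rule countable_subset)
qed


section \<open>The parametrized pigeonhole principle\<close>

text \<open>Colours are given as hereditary properties of sets of points, so a pair may have several of them; for
  each word, every point has a neighbourhood on which the word has a colour. The reduction and the tree of points are built
  together: at step \<open>k\<close> every point of the tree gets a companion, and then a variable
  word is chosen all of whose relevant substitutions and concatenations lie in the \<open>star\<close> sets of
  all points present. The cylinders are shrunk last.\<close>

lemma parametrized_pigeonhole: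
  fixes \<Psi> :: "'c \<Rightarrow> (nat \<Rightarrow> bool) set \<Rightarrow> 'a list \<Rightarrow> bool"
  assumes X: "X \<in> var_word_seqs L v" and M: "perfect_set M" and C: "finite C"
    and hered: "\<And>c N N' w. \<Psi> c N w \<Longrightarrow> N' \<subseteq> N \<Longrightarrow> \<Psi> c N' w"
    and colour: "\<And>w x. w \<in> lspan X n \<Longrightarrow> x \<in> M \<Longrightarrow> \<exists>c\<in>C. \<exists>m. \<Psi> c (M \<inter> cyl x m) w"
  shows "\<exists>c\<in>C. \<exists>M' X'. M' \<subseteq> M \<and> perfect_set M' \<and> X' \<in> ext n X \<and>
    (\<forall>w\<in>lspan X' n. \<forall>x\<in>M'. \<exists>m. \<Psi> c (M' \<inter> cyl x m) w)"
proof -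
  obtain U V where U: "ultra U" "tensor U U = U" "\<And>n. U (lspan X n)"
    and V: "ultra V" "\<And>n. V (vspan X n)"
    and UV: "\<And>n c A. c \<in> L n \<Longrightarrow> U A \<Longrightarrow> V {x. subst_var v x c \<in> A}"
    using hales_jewett_ultrafilters[OF X] by blast
  define G where "G = (\<lambda>c p. {w \<in> lspan X n. \<exists>m. \<Psi> c (M \<inter> cyl p m) w})"
  have "\<exists>c\<in>C. uncountable {p\<in>M. U (G c p)}"
  proof (rule ccontr)
    assume "\<not> ?thesis"
    then have "countable (\<Union>c\<in>C. {p\<in>M. U (G c p)})"
      using C by (intro countable_UN) (auto simp: countable_finite)
    moreover have "M \<subseteq> (\<Union>c\<in>C. {p\<in>M. U (G c p)})"
    proof
      fix p assume p: "p \<in> M"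
      have "lspan X n \<subseteq> (\<Union>c\<in>C. G c p)" using colour[OF _ p] by (auto simp: G_def)
      then have "U (\<Union>c\<in>C. G c p)" by (rule ultra_mono[OF U(1) U(3)])
      then show "p \<in> (\<Union>c\<in>C. {p\<in>M. U (G c p)})" using p ultra_UN[OF U(1) C] by auto
    qed
    ultimately show False using perfect_uncountable[OF M] countable_subset by blast
  qed
  then obtain c where c: "c \<in> C" "uncountable {p\<in>M. U (G c p)}" by blast
  define star where "star = (\<lambda>p. {w \<in> G c p. U {u. w @ u \<in> G c p}})"
  have Ustar: "U (star p)" if "U (G c p)" for p
    unfolding star_def by (rule idempotent_star[OF U(1,2) that])
  have star_step: "U {u. w @ u \<in> star p}" if "w \<in> star p" for w p
  proof -
    have "U {u. w @ u \<in> G c p}" using that by (simp add: star_def)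
    from idempotent_star[OF U(1,2) this] show ?thesis by (simp add: star_def)
  qed
  have star_sub: "star p \<subseteq> lspan X n" for p by (auto simp: star_def G_def)
  from condensation_points[where star = star, OF c(2) countable_lspan star_sub]
  obtain D where D: "D \<subseteq> {p\<in>M. U (G c p)}" "D \<noteq> {}" and
    D': "\<forall>p\<in>D. \<forall>m E. finite E \<longrightarrow> E \<subseteq> star p \<longrightarrow> (\<exists>q\<in>D. q \<noteq> p \<and> q \<in> cyl p m \<and> E \<subseteq> star q)"
    by (elim exE conjE)
  have Dsplit: "\<exists>q\<in>D. q \<noteq> p \<and> q \<in> cyl p m \<and> E \<subseteq> star q"
    if "p \<in> D" "finite E" "E \<subseteq> star p" for p m E
    using D'[rule_format, OF that] .
  have finl: "finite (lwords Z i j)" for Z i j by (rule finite_combos[OF fin])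
  let ?inv = "\<lambda>k (P, m :: nat, Z, e). finite P \<and> P \<noteq> {} \<and> P \<subseteq> D \<and> (k = 0 \<longrightarrow> Z = X \<and> e = n) \<and>
    (\<forall>w\<in>lwords Z n (n + k) - {[]}. \<forall>p\<in>P. w \<in> star p \<and> \<Psi> c (M \<inter> cyl p m) w)"
  let ?rel = "\<lambda>k (P, m, Z, e) (P', m', Z', e'). P \<subseteq> P' \<and> m < m' \<and>
    (\<forall>p\<in>P. \<exists>q\<in>P'. q \<noteq> p \<and> q \<in> cyl p m) \<and> (\<forall>q\<in>P'. \<exists>p\<in>P. q \<in> cyl p m) \<and>
    (\<exists>x. Z' = Z(n + k := x) \<and> v \<in> set x \<and> x \<in> vwords X e e')"
  have "\<exists>s. \<forall>k. ?inv k (s k) \<and> ?rel k (s k) (s (Suc k))"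
  proof (rule dependent_nat_choice)
    obtain p where "p \<in> D" using D(2) by blast
    then have "?inv 0 ({p}, 0, X, n)" by (simp add: combos_trivial)
    then show "\<exists>s. ?inv 0 s" by (rule exI)
  next
    fix s k assume "?inv k s"
    moreover obtain P m Z e where s: "s = (P, m, Z, e)" by (cases s) auto
    ultimately have P: "finite P" "P \<noteq> {}" "P \<subseteq> D"
      and E: "\<And>w p. w \<in> lwords Z n (n + k) - {[]} \<Longrightarrow> p \<in> P \<Longrightarrow> w \<in> star p \<and> \<Psi> c (M \<inter> cyl p m) w"
      by auto
    \<comment> \<open>The words built so far.\<close>
    define E where "E = lwords Z n (n + k) - {[]}"
    have finE: "finite E" using finl by (simp add: E_def)
    have "\<exists>q. \<forall>p\<in>P. q p \<in> D \<and> q p \<noteq> p \<and> q p \<in> cyl p m \<and> E \<subseteq> star (q p)"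
    proof (rule bchoice, rule ballI)
      fix p assume p: "p \<in> P"
      have "E \<subseteq> star p" using E p by (auto simp: E_def)
      from Dsplit[OF _ finE this, of m] p P(3)
      show "\<exists>q. q \<in> D \<and> q \<noteq> p \<and> q \<in> cyl p m \<and> E \<subseteq> star q" by blast
    qed
    then obtain q where q: "\<And>p. p \<in> P \<Longrightarrow> q p \<in> D \<and> q p \<noteq> p \<and> q p \<in> cyl p m \<and> E \<subseteq> star (q p)" by blast
    define P' where "P' = P \<union> q ` P"
    have P': "finite P'" "P' \<subseteq> D" using P q by (auto simp: P'_def)
    have EP': "E \<subseteq> star r" if "r \<in> P'" for r
      using that E q by (auto simp: P'_def E_def)
    \<comment> \<open>T consists of the words that may follow the empty word or any word of E, for every point present.\<close>
    define T where "T = (\<Inter>r\<in>P'. star r \<inter> (\<Inter>w\<in>E. {u. w @ u \<in> star r}))"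
    have "U T"
    proof -
      have "U (star r \<inter> (\<Inter>w\<in>E. {u. w @ u \<in> star r}))" if r: "r \<in> P'" for r
      proof -
        have "U (star r)" using r P'(2) D(1) Ustar by blast
        moreover have "\<forall>w\<in>E. U {u. w @ u \<in> star r}" using EP'[OF r] star_step by blast
        ultimately show ?thesis by (simp add: ultra_Int[OF U(1)] ultra_INT[OF U(1) finE])
      qed
      then show ?thesis unfolding T_def by (simp add: ultra_INT[OF U(1) P'(1)])
    qed
    have "V ((\<Inter>d\<in>L (n + k). {x. subst_var v x d \<in> T}) \<inter> vspan X e)"
      using UV[OF _ \<open>U T\<close>] V(2) by (simp add: ultra_Int[OF V(1)] ultra_INT[OF V(1) fin])
    then have "(\<Inter>d\<in>L (n + k). {x. subst_var v x d \<in> T}) \<inter> vspan X e \<noteq> {}"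
      using ultra_empty[OF V(1)] by (intro notI) simp
    then obtain x where x: "x \<in> (\<Inter>d\<in>L (n + k). {x. subst_var v x d \<in> T}) \<inter> vspan X e"
      by (simp only: ex_in_conv [symmetric]) (elim exE)
    then have xT: "\<And>d. d \<in> L (n + k) \<Longrightarrow> subst_var v x d \<in> T" and xv: "x \<in> vspan X e"
      by simp_all
    obtain e' where e': "v \<in> set x" "x \<in> vwords X e e'" using xv by (auto simp: vspan_def)
    define Z' where "Z' = Z(n + k := x)"
    have new: "w \<in> star r" if w: "w \<in> lwords Z' n (n + Suc k) - {[]}" and r: "r \<in> P'" for w r
    proof -
      have same: "lwords Z' n (n + k) = lwords Z n (n + k)"
        by (rule combos_cong) (simp add: Z'_def)
      have "w \<in> E \<or> (\<exists>w' d. w = w' @ subst_var v x d \<and> w' \<in> insert [] E \<and> d \<in> L (n + k))"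
        using w same by (auto simp: Z'_def E_def)
      then show ?thesis
      proof (elim disjE exE conjE)
        assume "w \<in> E"
        then show ?thesis using EP'[OF r] by blast
      next
        fix w' d assume w': "w = w' @ subst_var v x d" "w' \<in> insert [] E" "d \<in> L (n + k)"
        have "subst_var v x d \<in> star r \<inter> (\<Inter>w\<in>E. {u. w @ u \<in> star r})"
          using xT[OF w'(3)] r unfolding T_def by blast
        then show ?thesis using w' by auto
      qed
    qed
    have "\<exists>l. \<Psi> c (M \<inter> cyl r l) w" if "w \<in> lwords Z' n (n + Suc k) - {[]}" "r \<in> P'" for w r
      using new[OF that] by (simp add: star_def G_def)
    then obtain l where l: "\<And>w r. w \<in> lwords Z' n (n + Suc k) - {[]} \<Longrightarrow> r \<in> P' \<Longrightarrow> \<Psi> c (M \<inter> cyl r (l w r)) w"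
      by metis
    \<comment> \<open>A level beyond m and beyond all the levels that the finitely many words and points require.\<close>
    define m' where "m' = Suc (m + (\<Sum>r\<in>P'. \<Sum>w\<in>lwords Z' n (n + Suc k). l w r))"
    have Psi: "\<Psi> c (M \<inter> cyl r m') w" if w: "w \<in> lwords Z' n (n + Suc k) - {[]}" and r: "r \<in> P'" for w r
    proof (rule hered[OF l[OF w r]])
      have "l w r \<le> (\<Sum>w\<in>lwords Z' n (n + Suc k). l w r)"
        using w finl by (intro member_le_sum[of w _ "\<lambda>w. l w r"])
          (simp_all del: combos.simps add_Suc_right)
      also have "\<dots> \<le> (\<Sum>r\<in>P'. \<Sum>w\<in>lwords Z' n (n + Suc k). l w r)"
        using r P'(1) by (intro member_le_sum[of r P' "\<lambda>r. \<Sum>w\<in>lwords Z' n (n + Suc k). l w r"])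
          (simp_all del: combos.simps add_Suc_right)
      finally have "l w r \<le> m'" by (simp add: m'_def)
      then show "M \<inter> cyl r m' \<subseteq> M \<inter> cyl r (l w r)" using cyl_antimono by blast
    qed
    have "?inv (Suc k) (P', m', Z', e')"
      using P' P(2) new Psi by (simp add: P'_def del: combos.simps add_Suc_right)
    moreover have "?rel k (P, m, Z, e) (P', m', Z', e')"
    proof (simp only: prod.case, intro conjI ballI)
      show "P \<subseteq> P'" by (simp add: P'_def)
      show "m < m'" by (simp add: m'_def)
      show "\<exists>q\<in>P'. q \<noteq> p \<and> q \<in> cyl p m" if "p \<in> P" for p using q[OF that] that by (auto simp: P'_def)
      show "\<exists>p\<in>P. r \<in> cyl p m" if "r \<in> P'" for r
      proof (cases "r \<in> P")
        case True
        then show ?thesis using cyl_self by blast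
      next
        case False
        then show ?thesis using that q by (auto simp: P'_def)
      qed
      show "\<exists>x. Z' = Z(n + k := x) \<and> v \<in> set x \<and> x \<in> vwords X e e'" using e' Z'_def by blast
    qed
    ultimately show "\<exists>s'. ?inv (Suc k) s' \<and> ?rel k s s'"
      unfolding s by (rule exI[of _ "(P', m', Z', e')", OF conjI])
  qed
  then obtain s where s': "\<forall>k. ?inv k (s k) \<and> ?rel k (s k) (s (Suc k))" by (elim exE)
  have s: "?inv k (s k)" "?rel k (s k) (s (Suc k))" for k
    using conjunct1[OF s'[THEN spec, of k]] conjunct2[OF s'[THEN spec, of k]] .
  define P where "P = (\<lambda>k. fst (s k))"
  define m where "m = (\<lambda>k. fst (snd (s k)))"
  define Z where "Z = (\<lambda>k. fst (snd (snd (s k))))"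
  define e where "e = (\<lambda>k. snd (snd (snd (s k))))"
  have sk: "s k = (P k, m k, Z k, e k)" for k by (simp add: P_def m_def Z_def e_def)
  have P: "finite (P k)" "P k \<noteq> {}" "P k \<subseteq> D" for k using s(1)[of k] unfolding sk by simp_all
  have ZX: "Z 0 = X" "e 0 = n" using s(1)[of 0] unfolding sk by simp_all
  have words: "w \<in> star p \<and> \<Psi> c (M \<inter> cyl p (m k)) w"
    if "w \<in> lwords (Z k) n (n + k)" "w \<noteq> []" "p \<in> P k" for w p k
    using s(1)[of k] that unfolding sk by simp
  have rel: "P k \<subseteq> P (Suc k)" "m k < m (Suc k)"
    "\<And>p. p \<in> P k \<Longrightarrow> \<exists>q\<in>P (Suc k). q \<noteq> p \<and> q \<in> cyl p (m k)"
    "\<And>q. q \<in> P (Suc k) \<Longrightarrow> \<exists>p\<in>P k. q \<in> cyl p (m k)"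
    "\<exists>x. Z (Suc k) = (Z k)(n + k := x) \<and> v \<in> set x \<and> x \<in> vwords X (e k) (e (Suc k))" for k
    using s(2)[of k] unfolding sk by simp_all
  define M' where "M' = closure (\<Union>k. P k)"
  have M': "perfect_set M'" "\<And>k. M' \<subseteq> (\<Union>p\<in>P k. cyl p (m k))"
    unfolding M'_def
    using perfect_closure_of_tree[where P = P and m = m, OF P(1) P(2) rel(1-4)] by simp_all
  have "M' \<subseteq> M"
    unfolding M'_def using P(3) D(1) perfect_setD(2)[OF M] by (intro closure_minimal) blast+
  define X' where "X' = (\<lambda>i. if i < n then X i else Z (Suc (i - n)) i)"
  have ZX': "Z k i = X' i" if "i < n + k" for k i
    using that
  proof (induction k arbitrary: i)
    case 0
    then show ?case using ZX(1) by (simp add: X'_def)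
  next
    case (Suc k)
    obtain x where x: "Z (Suc k) = (Z k)(n + k := x)" using rel(5)[of k] by blast
    show ?case
    proof (cases "i = n + k")
      case True
      then show ?thesis by (simp add: X'_def)
    next
      case False
      then show ?thesis using Suc x by simp
    qed
  qed
  have "X' \<in> ext n X"
    unfolding ext_iff
  proof (intro exI[of _ "\<lambda>i. if i < n then i else e (i - n)"] conjI allI impI)
    show "reduces (\<lambda>i. if i < n then i else e (i - n)) X' X"
      unfolding reduces_def
    proof (intro allI)
      fix i
      show "v \<in> set (X' i) \<and> X' i \<in> vwords X (if i < n then i else e (i - n)) (if Suc i < n then Suc i else e (Suc i - n))"
      proof (cases "i < n")
        case True
        then have "(if Suc i < n then Suc i else e (Suc i - n)) = Suc i"
          using ZX(2) by (cases "Suc i = n") auto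
        moreover have "v \<in> set (X i)" using X by (auto simp: var_word_seqs_def var_words_def)
        ultimately show ?thesis using True vwords_self[of X i] by (simp add: X'_def del: combos.simps)
      next
        case False
        obtain x where "Z (Suc (i - n)) = (Z (i - n))(n + (i - n) := x)" "v \<in> set x"
          "x \<in> vwords X (e (i - n)) (e (Suc (i - n)))" using rel(5)[of "i - n"] by blast
        then show ?thesis using False by (simp add: X'_def Suc_diff_le)
      qed
    qed
  qed (use ZX(2) in \<open>auto simp: X'_def\<close>)
  moreover have "\<exists>l. \<Psi> c (M' \<inter> cyl x l) w" if w: "w \<in> lspan X' n" and x: "x \<in> M'" for w x
  proof -
    obtain k where k: "w \<in> lwords X' n k" "w \<noteq> []" using w by (auto simp: lspan_def)
    have "w \<in> lwords X' n (n + k)" using k(1) combos_mono_right[of k "n + k" v L X' n] by auto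
    also have "lwords X' n (n + k) = lwords (Z k) n (n + k)" by (rule combos_cong) (simp add: ZX')
    finally have wk: "w \<in> lwords (Z k) n (n + k)" .
    obtain p where p: "p \<in> P k" "x \<in> cyl p (m k)" using M'(2)[of k] x by blast
    have "\<Psi> c (M \<inter> cyl x (m k)) w" using words[OF wk k(2) p(1)] cyl_eq[OF p(2)] by simp
    then have "\<Psi> c (M' \<inter> cyl x (m k)) w" by (rule hered) (use \<open>M' \<subseteq> M\<close> in blast)
    then show ?thesis by blast
  qed
  ultimately show ?thesis using c(1) M'(1) \<open>M' \<subseteq> M\<close> by blast
qed

end

section \<open>Fusion of perfect sets and reductions\<close>

lemma perfect_replace_cyl:
  assumes M: "perfect_set M" and N: "perfect_set N"
  shows "perfect_set ((M - cyl r l) \<union> N)"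
  unfolding perfect_set_iff
proof (intro conjI ballI allI)
  show "(M - cyl r l) \<union> N \<noteq> {}" using perfect_setD(1)[OF N] by simp
  show "closed ((M - cyl r l) \<union> N)"
    using perfect_setD(2)[OF M] perfect_setD(2)[OF N] open_cyl by (intro closed_Un closed_Diff)
  fix x k assume "x \<in> (M - cyl r l) \<union> N"
  then consider "x \<in> M" "x \<notin> cyl r l" | "x \<in> N" by blast
  then show "\<exists>y\<in>((M - cyl r l) \<union> N) \<inter> cyl x k. y \<noteq> x"
  proof cases
    case 1
    obtain y where y: "y \<in> M" "y \<in> cyl x (max k l)" "y \<noteq> x"
      using perfect_setD(3)[OF M 1(1), of "max k l"] by blast
    have "y \<in> cyl x k" "y \<in> cyl x l" using y(2) by (auto simp: cyl_def)
    then have "y \<notin> cyl r l" using 1(2) by (auto simp: cyl_def)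
    then show ?thesis using y \<open>y \<in> cyl x k\<close> by (intro bexI[of _ y]) simp_all
  next
    case 2
    then show ?thesis using perfect_setD(3)[OF N 2, of k] by blast
  qed
qed

context alphabet
begin

text \<open>The pieces of \<open>M\<close> in the cylinders of length \<open>l\<close> are shrunk one at a time, and each of them survives. Earlier
  achievements persist because \<open>\<Phi>\<close> is hereditary.\<close>

lemma shrink_pieces:
  fixes \<Phi> :: "(nat \<Rightarrow> bool) set \<Rightarrow> 'c \<Rightarrow> nat \<Rightarrow> (nat \<Rightarrow> 'a list) \<Rightarrow> bool"
  assumes hered: "\<And>M M' b m X X'. \<Phi> M b m X \<Longrightarrow> M' \<subseteq> M \<Longrightarrow> X' \<in> ext m X \<Longrightarrow> \<Phi> M' b m X'"
    and dense: "\<And>M b m X. perfect_set M \<Longrightarrow> X \<in> var_word_seqs L v \<Longrightarrow>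
      \<exists>M' X'. M' \<subseteq> M \<and> perfect_set M' \<and> X' \<in> ext m X \<and> \<Phi> M' b m X'"
    and M: "perfect_set M" and X: "X \<in> var_word_seqs L v" and J: "finite J"
  shows "\<exists>M' X'. M' \<subseteq> M \<and> perfect_set M' \<and> X' \<in> ext m X \<and> (\<forall>x\<in>M. M' \<inter> cyl x l \<noteq> {}) \<and>
    (\<forall>r b. (r, b) \<in> J \<longrightarrow> M' \<inter> cyl r l \<noteq> {} \<longrightarrow> \<Phi> (M' \<inter> cyl r l) b m X')"
  using J
proof (induction J rule: finite_induct)
  case empty
  have "\<forall>x\<in>M. M \<inter> cyl x l \<noteq> {}" using cyl_self by blast
  then show ?case using M ext_refl[OF X] by (intro exI[of _ M] exI[of _ X]) simp
next
  case (insert j J)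
  obtain r b where j: "j = (r, b)" by (cases j)
  from insert.IH obtain M1 X1 where M1: "M1 \<subseteq> M" "perfect_set M1" and X1: "X1 \<in> ext m X"
    and meet: "\<And>x. x \<in> M \<Longrightarrow> M1 \<inter> cyl x l \<noteq> {}"
    and Phi: "\<And>r b. (r, b) \<in> J \<Longrightarrow> M1 \<inter> cyl r l \<noteq> {} \<Longrightarrow> \<Phi> (M1 \<inter> cyl r l) b m X1"
    by (elim exE conjE) simp
  show ?case
  proof (cases "M1 \<inter> cyl r l = {}")
    case True
    then have "\<forall>r b. (r, b) \<in> insert j J \<longrightarrow> M1 \<inter> cyl r l \<noteq> {} \<longrightarrow> \<Phi> (M1 \<inter> cyl r l) b m X1"
      using Phi by (auto simp: j)
    then show ?thesis using M1 X1 meet by (intro exI[of _ M1] exI[of _ X1]) simp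
  next
    case False
    have "X1 \<in> var_word_seqs L v" using ext_var_word_seqs[OF X X1] .
    from dense[OF perfect_Int_cyl[OF M1(2) False] this]
    obtain N X2 where N: "N \<subseteq> M1 \<inter> cyl r l" "perfect_set N" and X2: "X2 \<in> ext m X1"
      and PhiN: "\<Phi> N b m X2" by metis
    define M2 where "M2 = (M1 - cyl r l) \<union> N"
    have M2: "M2 \<subseteq> M1" "M2 \<inter> cyl r l = N" using N(1) by (auto simp: M2_def)
    have "M2 \<inter> cyl x l \<noteq> {}" if x: "x \<in> M" for x
    proof -
      obtain y where y: "y \<in> M1" "y \<in> cyl x l" using meet[OF x] by blast
      show ?thesis
      proof (cases "y \<in> cyl r l")
        case True
        then have "cyl x l = cyl r l" using y(2) cyl_eq by metis
        then show ?thesis using M2(2) perfect_setD(1)[OF N(2)] by simp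
      next
        case False
        then show ?thesis using y by (auto simp: M2_def)
      qed
    qed
    moreover have "\<Phi> (M2 \<inter> cyl r' l) b' m X2" if rb: "(r', b') \<in> insert j J" "M2 \<inter> cyl r' l \<noteq> {}" for r' b'
    proof (cases "(r', b') = j")
      case True
      then show ?thesis using PhiN M2(2) j by simp
    next
      case False
      then have "\<Phi> (M1 \<inter> cyl r' l) b' m X1" using rb M2(1) by (intro Phi) auto
      then show ?thesis by (rule hered) (use M2(1) X2 in auto)
    qed
    moreover have "perfect_set M2" unfolding M2_def by (rule perfect_replace_cyl[OF M1(2) N(2)])
    moreover have "X2 \<in> ext m X" using ext_trans[OF X1 X2] by simp
    ultimately show ?thesis using M1(1) M2(1) by (intro exI[of _ M2] exI[of _ X2]) auto
  qed
qed

text \<open>Simultaneous fusion. At stage \<open>k\<close> the tasks are the elements of \<open>B (n + k) X\<close>; since this finite set depends only on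
  the first \<open>n + k\<close> entries of \<open>X\<close>, which are frozen from then on, the limit has no task that was
  not treated at some stage. Each task is carried out separately on the finitely many pieces of the
  current perfect set, whence the neighbourhoods in the conclusion.\<close>

lemma fusion:
  fixes \<Phi> :: "(nat \<Rightarrow> bool) set \<Rightarrow> 'c \<Rightarrow> nat \<Rightarrow> (nat \<Rightarrow> 'a list) \<Rightarrow> bool"
  assumes hered: "\<And>M M' b m X X'. \<Phi> M b m X \<Longrightarrow> M' \<subseteq> M \<Longrightarrow> X' \<in> ext m X \<Longrightarrow> \<Phi> M' b m X'"
    and dense: "\<And>M b m X. perfect_set M \<Longrightarrow> X \<in> var_word_seqs L v \<Longrightarrow>
      \<exists>M' X'. M' \<subseteq> M \<and> perfect_set M' \<and> X' \<in> ext m X \<and> \<Phi> M' b m X'"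
    and finB: "\<And>m X. finite (B m X)"
    and congB: "\<And>m X X'. (\<And>i. i < m \<Longrightarrow> X i = X' i) \<Longrightarrow> B m X = B m X'"
    and M0: "perfect_set M0" and X0: "X0 \<in> var_word_seqs L v"
  shows "\<exists>M X. M \<subseteq> M0 \<and> perfect_set M \<and> X \<in> ext n X0 \<and>
    (\<forall>m\<ge>n. \<forall>b\<in>B m X. \<forall>x\<in>M. \<exists>l. \<Phi> (M \<inter> cyl x l) b m X)"
proof -
  let ?inv = "\<lambda>k (M, X, l :: nat). perfect_set M \<and> M \<subseteq> M0 \<and> X \<in> ext n X0"
  let ?rel = "\<lambda>k (M, X, l) (M', X', l'). M' \<subseteq> M \<and> X' \<in> ext (n + k) X \<and> l < l' \<and>
    (\<forall>x\<in>M. \<exists>y z. y \<in> M' \<inter> cyl x l \<and> z \<in> M' \<inter> cyl x l \<and> z \<notin> cyl y l') \<and>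
    (\<forall>b\<in>B (n + k) X. \<forall>x\<in>M'. \<Phi> (M' \<inter> cyl x l') b (n + k) X')"
  have "\<exists>s. \<forall>k. ?inv k (s k) \<and> ?rel k (s k) (s (Suc k))"
  proof (rule dependent_nat_choice)
    have "?inv 0 (M0, X0, 0)" using M0 ext_refl[OF X0] by simp
    then show "\<exists>s. ?inv 0 s" by (rule exI)
  next
    fix s k assume "?inv k s"
    moreover obtain M X l where s: "s = (M, X, l)" by (cases s) auto
    ultimately have M: "perfect_set M" "M \<subseteq> M0" and X: "X \<in> ext n X0" by auto
    have Xv: "X \<in> var_word_seqs L v" using ext_var_word_seqs[OF X0 X] .
    from perfect_splitting_level[OF M(1), of l] obtain l' where l': "l < l'"
      and split: "\<And>x. x \<in> M \<Longrightarrow> \<exists>y z. y \<in> M \<inter> cyl x l \<and> z \<in> M \<inter> cyl x l \<and> z \<notin> cyl y l'" by metis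
    from finite_cyl_cover[of l'] obtain R where R: "finite R" "\<And>x. \<exists>r\<in>R. cyl x l' = cyl r l'" by metis
    have "finite (R \<times> B (n + k) X)" using R(1) finB by simp
    have "\<exists>M' X'. M' \<subseteq> M \<and> perfect_set M' \<and> X' \<in> ext (n + k) X \<and> (\<forall>x\<in>M. M' \<inter> cyl x l' \<noteq> {}) \<and>
        (\<forall>r b. (r, b) \<in> R \<times> B (n + k) X \<longrightarrow> M' \<inter> cyl r l' \<noteq> {} \<longrightarrow> \<Phi> (M' \<inter> cyl r l') b (n + k) X')"
      by (rule shrink_pieces[where \<Phi> = \<Phi>]) (erule (2) hered, erule (1) dense, fact+)
    then obtain M' X' where M': "M' \<subseteq> M" "perfect_set M'" and X': "X' \<in> ext (n + k) X"
      and meet: "\<And>x. x \<in> M \<Longrightarrow> M' \<inter> cyl x l' \<noteq> {}"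
      and Phi: "\<And>r b. r \<in> R \<Longrightarrow> b \<in> B (n + k) X \<Longrightarrow> M' \<inter> cyl r l' \<noteq> {} \<Longrightarrow> \<Phi> (M' \<inter> cyl r l') b (n + k) X'"
      by (elim exE conjE) simp
    have "\<exists>y z. y \<in> M' \<inter> cyl x l \<and> z \<in> M' \<inter> cyl x l \<and> z \<notin> cyl y l'" if x: "x \<in> M" for x
    proof -
      obtain y z where yz: "y \<in> M" "y \<in> cyl x l" "z \<in> M" "z \<in> cyl x l" "z \<notin> cyl y l'"
        using split[OF x] by blast
      obtain y' z' where y': "y' \<in> M'" "y' \<in> cyl y l'" and z': "z' \<in> M'" "z' \<in> cyl z l'"
        using meet[OF yz(1)] meet[OF yz(3)] by blast
      have "y' \<in> cyl x l" "z' \<in> cyl x l" "z' \<notin> cyl y' l'"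
        using y'(2) z'(2) yz l' by (auto simp: cyl_def)
      then show ?thesis using y'(1) z'(1) by blast
    qed
    moreover have "\<Phi> (M' \<inter> cyl x l') b (n + k) X'" if "b \<in> B (n + k) X" "x \<in> M'" for b x
    proof -
      obtain r where r: "r \<in> R" "cyl x l' = cyl r l'" using R(2) by blast
      have "M' \<inter> cyl r l' \<noteq> {}" using that(2) cyl_self[of x l'] r(2) by blast
      then show ?thesis using Phi[OF r(1) that(1)] r(2) by simp
    qed
    moreover have "X' \<in> ext n X0" by (rule ext_trans[OF X X']) simp
    ultimately have "?inv (Suc k) (M', X', l') \<and> ?rel k (M, X, l) (M', X', l')"
      using M M' X' l' by simp
    then show "\<exists>s'. ?inv (Suc k) s' \<and> ?rel k s s'"
      unfolding s by (rule exI[of _ "(M', X', l')"])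
  qed
  then obtain s where s': "\<forall>k. ?inv k (s k) \<and> ?rel k (s k) (s (Suc k))" by (elim exE)
  have s: "?inv k (s k)" "?rel k (s k) (s (Suc k))" for k
    using conjunct1[OF s'[THEN spec, of k]] conjunct2[OF s'[THEN spec, of k]] .
  define M where "M = (\<lambda>k. fst (s k))"
  define Xs where "Xs = (\<lambda>k. fst (snd (s k)))"
  define l where "l = (\<lambda>k. snd (snd (s k)))"
  have sk: "s k = (M k, Xs k, l k)" for k by (simp add: M_def Xs_def l_def)
  have inv: "perfect_set (M k)" "M k \<subseteq> M0" "Xs k \<in> ext n X0" for k
    using s(1)[of k] unfolding sk by simp_all
  have rel: "M (Suc k) \<subseteq> M k" "Xs (Suc k) \<in> ext (n + k) (Xs k)" "l k < l (Suc k)"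
    "\<And>x. x \<in> M k \<Longrightarrow> \<exists>y z. y \<in> M (Suc k) \<inter> cyl x (l k) \<and> z \<in> M (Suc k) \<inter> cyl x (l k) \<and> z \<notin> cyl y (l (Suc k))"
    "\<And>b x. b \<in> B (n + k) (Xs k) \<Longrightarrow> x \<in> M (Suc k) \<Longrightarrow> \<Phi> (M (Suc k) \<inter> cyl x (l (Suc k))) b (n + k) (Xs (Suc k))" for k
    using s(2)[of k] unfolding sk by simp_all
  define X where "X = (\<lambda>i. Xs (Suc i) i)"
  have lim: "X \<in> ext (n + k) (Xs k)" for k unfolding X_def by (rule ext_limit[where Xs = Xs and n = n, OF rel(2)])
  have "perfect_set (\<Inter>k. M k)" by (rule perfect_fusion[where m = l, OF inv(1) rel(1) rel(3) rel(4)])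
  moreover have "(\<Inter>k. M k) \<subseteq> M0" using inv(2)[of 0] by blast
  moreover have "X \<in> ext n X0" by (rule ext_trans[OF inv(3)[of 0] lim[of 0]]) simp
  moreover have "\<exists>j. \<Phi> ((\<Inter>k. M k) \<inter> cyl x j) b m X"
    if m: "n \<le> m" and b: "b \<in> B m X" and x: "x \<in> (\<Inter>k. M k)" for m b x
  proof -
    define k where "k = m - n"
    have mk: "m = n + k" using m by (simp add: k_def)
    have "B m X = B m (Xs k)" by (rule congB) (use ext_initial[OF lim[of k]] mk in simp)
    then have "\<Phi> (M (Suc k) \<inter> cyl x (l (Suc k))) b m (Xs (Suc k))"
      using rel(5)[of b k x] b x mk by blast
    moreover have "X \<in> ext m (Xs (Suc k))"
      using lim[of "Suc k"] ext_antimono[of m "n + Suc k" "Xs (Suc k)"] mk by auto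
    moreover have "(\<Inter>k. M k) \<inter> cyl x (l (Suc k)) \<subseteq> M (Suc k) \<inter> cyl x (l (Suc k))" by blast
    ultimately show ?thesis using hered by blast
  qed
  ultimately show ?thesis by (intro exI[of _ "\<Inter>k. M k"] exI[of _ X]) simp
qed

end

section \<open>From inclusions of basic sets to reductions\<close>

text \<open>Two different letters reveal where the variable is: it occurs exactly where the two
  substituted words differ.\<close>

lemma substitutions_determine_block:
  assumes st: "s \<noteq> t" "s \<noteq> v" "t \<noteq> v"
    and "subst_var v x s = subst_var v y c" "subst_var v x t = subst_var v y d"
  shows "x = y \<or> x = subst_var v y c"
proof (cases "v \<in> set x")
  case False
  then show ?thesis using assms(4) subst_var_no_var[OF False, of s] by simp
next
  case True
  have len: "length x = length y" using assms(4) length_subst_var by metis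
  have s: "(if x ! q = v then s else x ! q) = (if y ! q = v then c else y ! q)" if "q < length x" for q
    using that len arg_cong[OF assms(4), of "\<lambda>z. z ! q"] by (simp add: subst_var_def)
  have t: "(if x ! q = v then t else x ! q) = (if y ! q = v then d else y ! q)" if "q < length x" for q
    using that len arg_cong[OF assms(5), of "\<lambda>z. z ! q"] by (simp add: subst_var_def)
  obtain p where p: "p < length x" "x ! p = v" using True by (auto simp: in_set_conv_nth)
  then have cd: "c = s" "d = t" using s[OF p(1)] t[OF p(1)] st by (auto split: if_splits)
  have "x ! q = y ! q" if q: "q < length x" for q
    using s[OF q] t[OF q] st unfolding cd by (auto split: if_splits)
  then show ?thesis using len nth_equalityI by blast
qed

lemma substitutions_determine_blocks:
  assumes st: "s \<noteq> t" "s \<noteq> v" "t \<noteq> v" and "distinct ns"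
    and "subst_var v x s = concat (map (\<lambda>n. subst_var v (X n) (f n)) ns)"
    and "subst_var v x t = concat (map (\<lambda>n. subst_var v (X n) (f' n)) ns)"
  shows "\<exists>g. (\<forall>n\<in>set ns. g n = v \<or> g n = f n) \<and> x = concat (map (\<lambda>n. subst_var v (X n) (g n)) ns)"
  using assms(4-)
proof (induction ns arbitrary: x)
  case Nil
  then show ?case by (simp add: subst_var_def)
next
  case (Cons n ns)
  define x1 where "x1 = take (length (X n)) x"
  define x2 where "x2 = drop (length (X n)) x"
  have x: "x = x1 @ x2" by (simp add: x1_def x2_def)
  have "length x = length (concat (map (\<lambda>n. subst_var v (X n) (f n)) (n # ns)))"
    using Cons.prems(2) length_subst_var by metis
  then have len: "length x1 = length (X n)" by (simp add: x1_def)
  have s: "subst_var v x1 s = subst_var v (X n) (f n)"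
    "subst_var v x2 s = concat (map (\<lambda>n. subst_var v (X n) (f n)) ns)"
    using Cons.prems(2) len by (simp_all add: x)
  have t: "subst_var v x1 t = subst_var v (X n) (f' n)"
    "subst_var v x2 t = concat (map (\<lambda>n. subst_var v (X n) (f' n)) ns)"
    using Cons.prems(3) len by (simp_all add: x)
  obtain g where g: "\<forall>n\<in>set ns. g n = v \<or> g n = f n" "x2 = concat (map (\<lambda>n. subst_var v (X n) (g n)) ns)"
    using Cons.IH[OF _ s(2) t(2)] Cons.prems(1) by auto
  obtain c where c: "c = v \<or> c = f n" "x1 = subst_var v (X n) c"
    using substitutions_determine_block[OF st s(1) t(1)] by (metis subst_var_self)
  have e: "map (\<lambda>m. subst_var v (X m) ((g(n := c)) m)) ns = map (\<lambda>m. subst_var v (X m) (g m)) ns"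
    using Cons.prems(1) by auto
  have "x = concat (map (\<lambda>m. subst_var v (X m) ((g(n := c)) m)) (n # ns))"
    unfolding list.map concat.simps e fun_upd_same using x c(2) g(2) by simp
  moreover have "\<forall>m\<in>set (n # ns). (g(n := c)) m = v \<or> (g(n := c)) m = f m" using c(1) g(1) by simp
  ultimately show ?case by blast
qed

context alphabet
begin

text \<open>Both substitutions have the length of \<open>x\<close>, hence the same support, and can be compared block by block.\<close>

lemma vwords_of_two_substitutions:
  assumes X: "X \<in> var_word_seqs L v" and st: "s \<noteq> t" "s \<noteq> v" "t \<noteq> v"
    and x: "subst_var v x s \<in> lwords X i j" "subst_var v x t \<in> lwords X i' j'"
  shows "x \<in> vwords X i j"
proof -
  obtain F f where F: "F \<subseteq> {i..<j}" "\<forall>n\<in>F. f n \<in> L n"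
    "subst_var v x s = concat (map (\<lambda>n. subst_var v (X n) (f n)) (sorted_list_of_set F))"
    using x(1) unfolding combos_iff by blast
  obtain F' f' where F': "F' \<subseteq> {i'..<j'}" "\<forall>n\<in>F'. f' n \<in> L n"
    "subst_var v x t = concat (map (\<lambda>n. subst_var v (X n) (f' n)) (sorted_list_of_set F'))"
    using x(2) unfolding combos_iff by blast
  have fin: "finite F" "finite F'" using F(1) F'(1) finite_subset by blast+
  have "F' = F"
  proof (rule rapid_sums_inj[of "\<lambda>n. length (X n)" F' "max j j'"])
    show "(\<Sum>i<n. length (X i)) < length (X n)" for n
      using X by (auto simp: var_word_seqs_def rapidly_increasing_def)
    have "(\<Sum>n\<in>F'. length (X n)) = length x" "(\<Sum>n\<in>F. length (X n)) = length x"
      using arg_cong[OF F(3), of length] arg_cong[OF F'(3), of length] fin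
      by (simp_all only: length_concat_blocks length_subst_var)
    then show "(\<Sum>n\<in>F'. length (X n)) = (\<Sum>n\<in>F. length (X n))" by simp
    show "F' \<subseteq> {..<max j j'}" "F \<subseteq> {..<max j j'}" using F(1) F'(1) by (fastforce simp: less_max_iff_disj)+
  qed
  then obtain g where g: "\<forall>n\<in>set (sorted_list_of_set F). g n = v \<or> g n = f n"
    "x = concat (map (\<lambda>n. subst_var v (X n) (g n)) (sorted_list_of_set F))"
    using substitutions_determine_blocks[OF st _ F(3)] F'(3) by auto
  have "\<forall>n\<in>F. g n \<in> insert v (L n)" using g(1) F(2) fin by auto
  then show ?thesis unfolding combos_iff using F(1) g(2) by blast
qed

text \<open>With a single letter, the positions of the variable cannot be recovered from the word, but for the
  same reason they do not matter: put the variable into every block.\<close>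

lemma vwords_over_one_letter:
  assumes one: "\<And>n. L n \<subseteq> {s}"
  shows "w \<in> lwords X i j \<Longrightarrow> X \<in> var_word_seqs L v \<Longrightarrow>
    \<exists>y\<in>vwords X i j. subst_var v y s = w \<and> (w \<noteq> [] \<longrightarrow> v \<in> set y)"
proof (induction j arbitrary: w)
  case (Suc j)
  consider "w \<in> lwords X i j"
    | w' c where "w = w' @ subst_var v (X j) c" "w' \<in> lwords X i j" "c \<in> L j" "i \<le> j"
    using Suc.prems(1) by (auto split: if_splits)
  then show ?case
  proof cases
    case 1
    then obtain y where "y \<in> vwords X i j" "subst_var v y s = w \<and> (w \<noteq> [] \<longrightarrow> v \<in> set y)"
      using Suc by blast
    then show ?thesis by (intro bexI[of _ y]) simp_all
  next
    case 2
    obtain y where y: "y \<in> vwords X i j" "subst_var v y s = w'" using Suc.IH[OF 2(2) Suc.prems(2)] by blast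
    have "c = s" using 2(3) one by blast
    moreover have "v \<in> set (X j)" using Suc.prems(2) by (auto simp: var_word_seqs_def var_words_def)
    moreover have "y @ X j \<in> vwords X i (Suc j)"
      using combos_append[OF y(1) vwords_self 2(4)] by simp
    ultimately show ?thesis using y(2) 2(1) by (intro bexI[of _ "y @ X j"]) simp_all
  qed
qed (simp add: subst_var_def)

text \<open>Only the constant words of \<open>X'\<close> are known to lie in the span of \<open>X\<close>. If the alphabet has at least two letters, this
  forces the late variable words of \<open>X'\<close> into the span of \<open>X\<close>; if it has only one, they are replaced by variable
  words over \<open>X\<close> with the same substitutions.\<close>

lemma basic_set_contains_tails_of_reduction:
  assumes X: "X \<in> var_word_seqs L v" and X': "X' \<in> var_word_seqs L v"
    and sub: "basic_set L v b X' \<subseteq> basic_set L v [] X" and ne: "basic_set L v b X' \<noteq> {}"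
  shows "\<exists>X''\<in>ext 0 X. tails b 0 X'' \<subseteq> basic_set L v b X'"
proof -
  obtain A h where A: "A \<in> word_seqs L" "initial (length b) A = b"
    and h: "\<And>i. A i \<in> lwords X' (h i) (h (Suc i))"
    using ne basic_set_iff[OF X'] by blast
  have nth: "b ! i = A i" if "i < length b" for i
    using initial_nth[OF A(2) that] .
  have b: "b ! i \<in> lwords X' (h i) (h (Suc i)) \<and> b ! i \<noteq> []" if "i < length b" for i
    using h[of i] nth[OF that] word_seqs_nonempty[OF A(1)] by simp
  have blocks: "\<exists>g. \<forall>i. subst_var v (X' (N + i)) s \<in> lwords X (g i) (g (Suc i))"
    if N: "h (length b) \<le> N" and s: "s \<in> L N" for N s
  proof -
    have c: "s \<in> L (N + i)" for i using s L_mono[of N "N + i"] by auto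
    from extend_stem[OF X' b N, of "\<lambda>_. s", OF _ c] sub
    have "(\<lambda>i. if i < length b then b ! i else subst_var v (X' (N + (i - length b))) s) \<in> basic_set L v [] X"
      by blast
    from iffD1[OF basic_set_iff[OF X] this]
    obtain g where g: "\<forall>i. (if i < length b then b ! i else subst_var v (X' (N + (i - length b))) s)
        \<in> lwords X (g i) (g (Suc i))"
      by (elim conjE exE)
    have "subst_var v (X' (N + i)) s \<in> lwords X (g (length b + i)) (g (Suc (length b + i)))" for i
      using g[THEN spec, of "length b + i"] by simp
    then show ?thesis by (intro exI[of _ "\<lambda>i. g (length b + i)"]) simp
  qed
  have X'v: "v \<in> set (X' n)" for n using X' by (auto simp: var_word_seqs_def var_words_def)
  have "\<exists>N g y. h (length b) \<le> N \<and> (\<forall>i. y i \<in> vwords X (g i) (g (Suc i)) \<and> v \<in> set (y i) \<and>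
      (\<forall>c\<in>L i. subst_var v (y i) c = subst_var v (X' (N + i)) c))"
  proof (cases "\<exists>m. \<exists>s\<in>L m. \<exists>t\<in>L m. s \<noteq> t")
    case True
    then obtain m s t where m: "s \<in> L m" "t \<in> L m" "s \<noteq> t" by blast
    \<comment> \<open>From N on both letters are available and the supports lie beyond those of b.\<close>
    define N where "N = max m (h (length b))"
    have stN: "s \<in> L N" "t \<in> L N" using m L_mono[of m N] by (auto simp: N_def)
    have N: "h (length b) \<le> N" by (simp add: N_def)
    obtain g where g: "\<And>i. subst_var v (X' (N + i)) s \<in> lwords X (g i) (g (Suc i))"
      using blocks[OF N stN(1)] by blast
    obtain g' where g': "\<And>i. subst_var v (X' (N + i)) t \<in> lwords X (g' i) (g' (Suc i))"
      using blocks[OF N stN(2)] by blast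
    have "s \<noteq> v" "t \<noteq> v" using stN v_notin_L[of N] by blast+
    then have "X' (N + i) \<in> vwords X (g i) (g (Suc i))" for i
      using vwords_of_two_substitutions[OF X m(3) _ _ g g'] by blast
    then show ?thesis using N X'v by (intro exI[of _ N] exI[of _ g] exI[of _ "\<lambda>i. X' (N + i)"]) simp
  next
    case False
    obtain N c where N: "h (length b) \<le> N" and c: "\<And>i. c i \<in> L (N + i)" using letter_sequence by blast
    define s where "s = c 0"
    have sN: "s \<in> L N" using c[of 0] by (simp add: s_def)
    have one: "L n \<subseteq> {s}" for n
    proof
      fix t assume "t \<in> L n"
      then have "t \<in> L (max n N)" "s \<in> L (max n N)"
        using L_mono[of n "max n N"] L_mono[of N "max n N"] sN by auto
      then show "t \<in> {s}" using False by blast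
    qed
    obtain g where g: "\<And>i. subst_var v (X' (N + i)) s \<in> lwords X (g i) (g (Suc i))"
      using blocks[OF N sN] by blast
    have "\<exists>y. y \<in> vwords X (g i) (g (Suc i)) \<and> v \<in> set y \<and> subst_var v y s = subst_var v (X' (N + i)) s" for i
    proof -
      have "subst_var v (X' (N + i)) s \<noteq> []" using X'v[of "N + i"] by auto
      then show ?thesis using vwords_over_one_letter[OF one g X, of i] by blast
    qed
    then obtain y where "\<And>i. y i \<in> vwords X (g i) (g (Suc i)) \<and> v \<in> set (y i) \<and>
        subst_var v (y i) s = subst_var v (X' (N + i)) s" by metis
    then show ?thesis using N one by (intro exI[of _ N] exI[of _ g] exI[of _ y]) blast
  qed
  then obtain N g y where N: "h (length b) \<le> N" and y: "\<And>i. y i \<in> vwords X (g i) (g (Suc i))" "\<And>i. v \<in> set (y i)"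
    "\<And>i c. c \<in> L i \<Longrightarrow> subst_var v (y i) c = subst_var v (X' (N + i)) c" by blast
  define g0 where "g0 = (\<lambda>i. if i = 0 then 0 else g i)"
  have "reduces g0 y X"
    unfolding reduces_def
  proof (intro allI conjI)
    fix i
    have "vwords X (g i) (g (Suc i)) \<subseteq> vwords X (g0 i) (g0 (Suc i))"
      by (rule combos_mono) (auto simp: g0_def)
    then show "y i \<in> vwords X (g0 i) (g0 (Suc i))" using y(1) by blast
  qed (rule y(2))
  then have "y \<in> ext 0 X" unfolding ext_iff by (intro exI[of _ g0]) (simp add: g0_def)
  moreover have "tails b 0 y \<subseteq> tails b N X'"
  proof
    fix B assume B: "B \<in> tails b 0 y"
    then obtain p where p: "p 0 = 0" "\<And>i. B (length b + i) \<in> lwords y (p i) (p (Suc i))"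
      using tailsD(3) by blast
    have "lwords y i j \<subseteq> lwords X' (i + N) (j + N)" for i j
    proof (rule combos_transfer)
      fix n c assume "c \<in> L n"
      then show "c \<in> L (n + N) \<and> subst_var v (y n) c = subst_var v (X' (n + N)) c"
        using y(3) L_mono[of n "n + N"] by (auto simp: add.commute)
    qed
    then show "B \<in> tails b N X'"
      using tailsD(1,2)[OF B] p by (intro tailsI[of _ _ _ "\<lambda>i. p i + N"]) auto
  qed
  moreover have "tails b N X' \<subseteq> basic_set L v b X'"
    by (rule tails_subset_basic_set[where h = h, OF X' _ N]) (use b in blast)
  ultimately show ?thesis by blast
qed

text \<open>The first \<open>n\<close> words of \<open>X\<close> followed by a tail of \<open>X'\<close>. The tail moves to earlier positions, where fewer
  letters are available, so its span can only shrink.\<close>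

lemma ext_splice:
  assumes X: "X \<in> var_word_seqs L v" and X': "X' \<in> ext 0 X" and nN: "n \<le> N"
  defines "X'' \<equiv> (\<lambda>i. if i < n then X i else X' (i - n + N))"
  shows "X'' \<in> ext n X" "tails b n X'' \<subseteq> tails b N X'"
proof -
  obtain h where h: "reduces h X' X" using X' by (auto simp: ext_iff)
  define g where "g = (\<lambda>i. if i \<le> n then i else h (i - n + N))"
  have "v \<in> set (X'' i) \<and> X'' i \<in> vwords X (g i) (g (Suc i))" for i
  proof (cases "i < n")
    case True
    moreover have "v \<in> set (X i)" using X by (auto simp: var_word_seqs_def var_words_def)
    ultimately show ?thesis using vwords_self[of X i] by (simp add: X''_def g_def del: combos.simps)
  next
    case False
    have "X' (i - n + N) \<in> vwords X (h (i - n + N)) (h (Suc (i - n + N)))" "v \<in> set (X' (i - n + N))"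
      using h by (auto simp: reduces_def)
    moreover have "vwords X (h (i - n + N)) (h (Suc (i - n + N))) \<subseteq> vwords X (g i) (g (Suc i))"
    proof (rule combos_mono)
      show "g i \<le> h (i - n + N)" using False nN reduces_ge[OF h, of N] by (auto simp: g_def)
      show "h (Suc (i - n + N)) \<le> g (Suc i)" using False by (simp add: g_def Suc_diff_le)
    qed simp
    ultimately show ?thesis using False by (auto simp: X''_def)
  qed
  then show "X'' \<in> ext n X" unfolding ext_iff reduces_def
    by (intro exI[of _ g]) (simp add: g_def X''_def)
  show "tails b n X'' \<subseteq> tails b N X'"
  proof
    fix A assume A: "A \<in> tails b n X''"
    then obtain p where p: "p 0 = n" "\<And>i. A (length b + i) \<in> lwords X'' (p i) (p (Suc i))"
      using tailsD(3) by blast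
    have "p i \<le> p (Suc i)" for i
      using combos_nonempty_less[OF p(2) word_seqs_nonempty[OF tailsD(1)[OF A]]] by (simp add: less_imp_le)
    then have pn: "n \<le> p i" for i using lift_Suc_mono_le[of p 0 i] p(1) by simp
    have "lwords X'' i j \<subseteq> lwords X' (i + (N - n)) (j + (N - n))" if "n \<le> i" for i j
    proof (rule combos_transfer)
      fix m c assume "c \<in> L m" "i \<le> m"
      then show "c \<in> L (m + (N - n)) \<and> subst_var v (X'' m) c = subst_var v (X' (m + (N - n))) c"
        using subsetD[OF L_mono[OF le_add1[of m "N - n"]]] that nN by (simp add: X''_def)
    qed
    then have "A (length b + i) \<in> lwords X' (p i + (N - n)) (p (Suc i) + (N - n))" for i
      using p(2)[of i] pn[of i] by blast
    then show "A \<in> tails b N X'"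
      using tailsD(1,2)[OF A] p(1) nN by (intro tailsI[of _ _ _ "\<lambda>i. p i + (N - n)"]) auto
  qed
qed


section \<open>Decided and undecidable beginnings\<close>

definition decided where
  "decided \<Lambda> S b n X \<longleftrightarrow> S \<times> tails b n X \<subseteq> \<Lambda> \<or> S \<times> tails b n X \<subseteq> (UNIV \<times> word_seqs L) - \<Lambda>"

text \<open>Quantifying over all reductions and all \<open>n\<close> makes this property hereditary and independent of the depth
  of \<open>b\<close>. By \<open>ext_splice\<close> nothing is lost: a witness can always be made to fix an initial segment
  of \<open>X\<close>.\<close>

definition undecidable where
  "undecidable \<Lambda> S b X \<longleftrightarrow>
    (\<forall>M X' n. perfect_set M \<longrightarrow> M \<subseteq> S \<longrightarrow> X' \<in> ext 0 X \<longrightarrow> \<not> decided \<Lambda> M b n X')"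

lemma decided_mono:
  "decided \<Lambda> S b n X \<Longrightarrow> S' \<subseteq> S \<Longrightarrow> tails b' n' X' \<subseteq> tails b n X \<Longrightarrow> decided \<Lambda> S' b' n' X'"
  unfolding decided_def by (meson Sigma_mono order_trans)

lemma undecidable_mono:
  assumes "undecidable \<Lambda> S b X" "S' \<subseteq> S" "X' \<in> ext m X"
  shows "undecidable \<Lambda> S' b X'"
  unfolding undecidable_def
proof (intro allI impI)
  fix M X'' n assume "perfect_set M" "M \<subseteq> S'" "X'' \<in> ext 0 X'"
  moreover have "X' \<in> ext 0 X" using assms(3) ext_antimono[of 0 m X] by auto
  ultimately show "\<not> decided \<Lambda> M b n X''"
    using assms(1,2) ext_trans[of X' 0 X X'' 0] unfolding undecidable_def by (meson order_trans order_refl)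
qed

text \<open>A deciding perfect set has a perfect piece in any neighbourhood of any of its points.\<close>

lemma undecidable_local:
  assumes "\<And>x. x \<in> S \<Longrightarrow> \<exists>l. undecidable \<Lambda> (S \<inter> cyl x l) b X"
  shows "undecidable \<Lambda> S b X"
  unfolding undecidable_def
proof (intro allI impI notI)
  fix M X' n assume M: "perfect_set M" "M \<subseteq> S" and X': "X' \<in> ext 0 X" and d: "decided \<Lambda> M b n X'"
  obtain x where x: "x \<in> M" using perfect_setD(1)[OF M(1)] by blast
  then obtain l where l: "undecidable \<Lambda> (S \<inter> cyl x l) b X" using assms M(2) by blast
  have "M \<inter> cyl x l \<noteq> {}" using x cyl_self[of x l] by blast
  then have "perfect_set (M \<inter> cyl x l)" by (rule perfect_Int_cyl[OF M(1)])
  moreover have "decided \<Lambda> (M \<inter> cyl x l) b n X'" by (rule decided_mono[OF d]) auto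
  moreover have "M \<inter> cyl x l \<subseteq> S \<inter> cyl x l" using M(2) by blast
  ultimately show False using l X' unfolding undecidable_def by blast
qed

lemma decide_or_undecidable:
  assumes M: "perfect_set M" and X: "X \<in> var_word_seqs L v"
  shows "\<exists>M' X'. M' \<subseteq> M \<and> perfect_set M' \<and> X' \<in> ext n X \<and>
    (decided \<Lambda> M' b n X' \<or> undecidable \<Lambda> M' b X')"
proof (cases "undecidable \<Lambda> M b X")
  case True
  then show ?thesis using M ext_refl[OF X] by blast
next
  case False
  then obtain M' X' n' where M': "perfect_set M'" "M' \<subseteq> M" and X': "X' \<in> ext 0 X"
    and d: "decided \<Lambda> M' b n' X'" unfolding undecidable_def by blast
  note sp = ext_splice[OF X X', of n "max n n'", simplified]
  have "decided \<Lambda> M' b n (\<lambda>i. if i < n then X i else X' (i - n + max n n'))"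
    by (rule decided_mono[OF d order_refl]) (use sp(2) tails_antimono[of n' "max n n'" b X'] in auto)
  then show ?thesis using M' sp(1) by blast
qed

text \<open>The one-word extensions of \<open>b\<close> are coloured by \<open>0\<close> (inside \<open>\<Lambda>\<close>), \<open>1\<close> (outside \<open>\<Lambda>\<close>) and \<open>2\<close> (undecidable).
  Homogeneity in colour \<open>0\<close> or \<open>1\<close> decides \<open>b\<close>, because every sequence that begins with \<open>b\<close> begins with some
  \<open>b @ [w]\<close>.\<close>

lemma decide_or_successors_undecidable:
  assumes M: "perfect_set M" and X: "X \<in> var_word_seqs L v"
  shows "\<exists>M' X'. M' \<subseteq> M \<and> perfect_set M' \<and> X' \<in> ext n X \<and>
    (decided \<Lambda> M' b n X' \<or> (\<forall>w\<in>lspan X' n. undecidable \<Lambda> M' (b @ [w]) X'))"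
proof -
  let ?\<Phi> = "\<lambda>M b m X. decided \<Lambda> M b m X \<or> undecidable \<Lambda> M b X"
  have hered: "?\<Phi> M' b m X'" if "?\<Phi> M b m X" "M' \<subseteq> M" "X' \<in> ext m X" for M M' b m X X'
    using that decided_mono[OF _ that(2) tails_ext[OF that(3)]] undecidable_mono[OF _ that(2,3)] by blast
  have "\<exists>M1 X1. M1 \<subseteq> M \<and> perfect_set M1 \<and> X1 \<in> ext n X \<and>
      (\<forall>m\<ge>n. \<forall>b'\<in>(\<lambda>w. b @ [w]) ` lwords X1 n m. \<forall>x\<in>M1. \<exists>l. ?\<Phi> (M1 \<inter> cyl x l) b' m X1)"
  proof (rule fusion[where \<Phi> = ?\<Phi> and B = "\<lambda>m X. (\<lambda>w. b @ [w]) ` lwords X n m"])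
    show "finite ((\<lambda>w. b @ [w]) ` lwords X n m)" for m X by (intro finite_imageI finite_combos fin)
    show "(\<lambda>w. b @ [w]) ` lwords X n m = (\<lambda>w. b @ [w]) ` lwords X' n m"
      if "\<And>i. i < m \<Longrightarrow> X i = X' i" for m X X' 
      using combos_cong[where v = v and K = L and i = n and j = m and X = X and X' = X'] that by metis
  qed (erule (2) hered, erule (1) decide_or_undecidable, rule M, rule X)
  then obtain M1 X1 where M1: "M1 \<subseteq> M" "perfect_set M1" and X1: "X1 \<in> ext n X"
    and loc: "\<And>m w x. n \<le> m \<Longrightarrow> w \<in> lwords X1 n m \<Longrightarrow> x \<in> M1 \<Longrightarrow> \<exists>l. ?\<Phi> (M1 \<inter> cyl x l) (b @ [w]) m X1"
    by (elim exE conjE) simp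
  have X1v: "X1 \<in> var_word_seqs L v" using ext_var_word_seqs[OF X X1] .
  define e where "e = (\<lambda>w. LEAST m. w \<in> lwords X1 n m)"
  define \<Psi> where "\<Psi> = (\<lambda>(c :: nat) S w. if c = 0 then S \<times> tails (b @ [w]) (e w) X1 \<subseteq> \<Lambda>
    else if c = 1 then S \<times> tails (b @ [w]) (e w) X1 \<subseteq> (UNIV \<times> word_seqs L) - \<Lambda>
    else undecidable \<Lambda> S (b @ [w]) X1)"
  have "\<exists>c\<in>{0, 1, 2}. \<exists>M2 X2. M2 \<subseteq> M1 \<and> perfect_set M2 \<and> X2 \<in> ext n X1 \<and>
    (\<forall>w\<in>lspan X2 n. \<forall>x\<in>M2. \<exists>l. \<Psi> c (M2 \<inter> cyl x l) w)"
  proof (rule parametrized_pigeonhole[OF X1v M1(2)])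
    show "\<Psi> c N' w" if "\<Psi> c N w" "N' \<subseteq> N" for c N N' w
      using that undecidable_mono[OF _ that(2) ext_refl[OF X1v, of 0]]
        Sigma_mono[OF that(2) order_refl, of "\<lambda>_. tails (b @ [w]) (e w) X1"]
      by (auto simp: \<Psi>_def split: if_splits)
  next
    fix w x assume w: "w \<in> lspan X1 n" and x: "x \<in> M1"
    have ew: "w \<in> lwords X1 n (e w)" unfolding e_def using w by (auto simp: lspan_def intro: LeastI)
    moreover have "n \<le> e w" using combos_nonempty_less[OF ew] w by (auto simp: lspan_def)
    ultimately obtain l where "?\<Phi> (M1 \<inter> cyl x l) (b @ [w]) (e w) X1" using loc x by blast
    then have "\<Psi> 0 (M1 \<inter> cyl x l) w \<or> \<Psi> 1 (M1 \<inter> cyl x l) w \<or> \<Psi> 2 (M1 \<inter> cyl x l) w"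
      by (auto simp: \<Psi>_def decided_def)
    then show "\<exists>c\<in>{0, 1, 2}. \<exists>m. \<Psi> c (M1 \<inter> cyl x m) w" by blast
  qed simp
  then obtain c M2 X2 where c: "c \<in> {0, 1, 2}" and M2: "M2 \<subseteq> M1" "perfect_set M2" and X2: "X2 \<in> ext n X1"
    and \<Psi>: "\<And>w x. w \<in> lspan X2 n \<Longrightarrow> x \<in> M2 \<Longrightarrow> \<exists>l. \<Psi> c (M2 \<inter> cyl x l) w"
    by (elim bexE exE conjE) simp
  have first: "A (length b) \<in> lspan X2 n \<and> A \<in> tails (b @ [A (length b)]) (e (A (length b))) X1"
    if A: "A \<in> tails b n X2" for A
  proof -
    have "A (length b) \<in> lspan X2 n" using tails_step(1,2)[OF A refl] by (auto simp: lspan_def)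
    moreover have "A \<in> tails b n X1" using A tails_ext[OF X2] by blast
    ultimately show ?thesis using tails_step(3)[OF _ refl] by (simp add: e_def)
  qed
  have "decided \<Lambda> M2 b n X2 \<or> (\<forall>w\<in>lspan X2 n. undecidable \<Lambda> M2 (b @ [w]) X2)"
  proof -
    consider "c = 0" | "c = 1" | "c = 2" using c by blast
    then show ?thesis
    proof cases
      case 1
      have "(x, A) \<in> \<Lambda>" if x: "x \<in> M2" and A: "A \<in> tails b n X2" for x A
      proof -
        obtain l where "\<Psi> c (M2 \<inter> cyl x l) (A (length b))" using \<Psi>[OF _ x] first[OF A] by blast
        then show ?thesis using 1 x first[OF A] cyl_self[of x l] by (auto simp: \<Psi>_def)
      qed
      then show ?thesis by (auto simp: decided_def)
    next
      case 2
      have "(x, A) \<in> (UNIV \<times> word_seqs L) - \<Lambda>" if x: "x \<in> M2" and A: "A \<in> tails b n X2" for x A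
      proof -
        obtain l where "\<Psi> c (M2 \<inter> cyl x l) (A (length b))" using \<Psi>[OF _ x] first[OF A] by blast
        then have "(M2 \<inter> cyl x l) \<times> tails (b @ [A (length b)]) (e (A (length b))) X1
            \<subseteq> (UNIV \<times> word_seqs L) - \<Lambda>" using 2 by (simp add: \<Psi>_def)
        moreover have "(x, A) \<in> (M2 \<inter> cyl x l) \<times> tails (b @ [A (length b)]) (e (A (length b))) X1"
          using x first[OF A] by simp
        ultimately show ?thesis by (rule subsetD)
      qed
      then have "M2 \<times> tails b n X2 \<subseteq> (UNIV \<times> word_seqs L) - \<Lambda>" by blast
      then show ?thesis by (simp add: decided_def)
    next
      case 3
      have "undecidable \<Lambda> M2 (b @ [w]) X2" if w: "w \<in> lspan X2 n" for w
      proof -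
        have "undecidable \<Lambda> M2 (b @ [w]) X1"
          by (rule undecidable_local) (use \<Psi>[OF w] 3 in \<open>simp add: \<Psi>_def\<close>)
        then show ?thesis by (rule undecidable_mono[OF _ order_refl X2])
      qed
      then show ?thesis by blast
    qed
  qed
  moreover have "X2 \<in> ext n X" using ext_trans[OF X1 X2] by simp
  ultimately show ?thesis using M1(1) M2 by (intro exI[of _ M2] exI[of _ X2]) auto
qed

text \<open>The finite block sequences of \<open>X\<close> that extend \<open>a\<close>, with supports after \<open>a\<close> in \<open>{d..<n}\<close>.\<close>

inductive stem :: "'a list list \<Rightarrow> nat \<Rightarrow> (nat \<Rightarrow> 'a list) \<Rightarrow> 'a list list \<Rightarrow> nat \<Rightarrow> bool"
  for a d X where
  base: "stem a d X a d"
| step: "stem a d X b n \<Longrightarrow> w \<in> lwords X n m \<Longrightarrow> w \<noteq> [] \<Longrightarrow> stem a d X (b @ [w]) m"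

lemma stem_ge: "stem a d X b n \<Longrightarrow> d \<le> n"
  by (induction rule: stem.induct) (auto dest: combos_nonempty_less)

lemma stem_words:
  "stem a d X b n \<Longrightarrow> \<exists>ws. b = a @ ws \<and> set ws \<subseteq> lwords X d n \<and> length ws \<le> n"
proof (induction rule: stem.induct)
  case base
  then show ?case by (intro exI[of _ "[]"]) simp
next
  case (step b n w m)
  obtain ws where ws: "b = a @ ws" "set ws \<subseteq> lwords X d n" "length ws \<le> n" using step.IH by blast
  have nm: "n < m" using combos_nonempty_less[OF step.hyps(2,3)] .
  have "lwords X d n \<subseteq> lwords X d m" by (rule combos_mono_right) (use nm in simp)
  moreover have "lwords X n m \<subseteq> lwords X d m"
    by (rule combos_mono) (use stem_ge[OF step.hyps(1)] in auto)
  ultimately have "set (ws @ [w]) \<subseteq> lwords X d m" using ws(2) step.hyps(2) by auto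
  then show ?case using ws nm by (intro exI[of _ "ws @ [w]"]) simp
qed

lemma finite_stems: "finite {b. stem a d X b n}"
proof -
  have "{b. stem a d X b n} \<subseteq> (\<lambda>ws. a @ ws) ` {ws. set ws \<subseteq> lwords X d n \<and> length ws \<le> n}"
    using stem_words by blast
  moreover have "finite {ws. set ws \<subseteq> lwords X d n \<and> length ws \<le> n}"
    by (intro finite_lists_length_le finite_combos fin)
  ultimately show ?thesis using finite_surj by blast
qed

lemma stem_cong: "stem a d X b n \<Longrightarrow> (\<And>i. i < n \<Longrightarrow> X i = X' i) \<Longrightarrow> stem a d X' b n"
proof (induction rule: stem.induct)
  case base
  show ?case by (rule stem.base)
next
  case (step b n w m)
  have "n < m" using combos_nonempty_less[OF step.hyps(2,3)] .
  then have "stem a d X' b n" by (intro step.IH step.prems) simp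
  moreover have "w \<in> lwords X' n m" 
    using step.hyps(2) step.prems combos_cong[where v = v and K = L and i = n and j = m and X = X and X' = X'] by metis
  ultimately show ?case using step.hyps(3) by (rule stem.step)
qed

lemma stem_of_tails:
  assumes A: "A \<in> tails a d X"
  shows "\<exists>n. stem a d X (initial (length a + i) A) n"
proof -
  obtain h where h: "h 0 = d" "\<And>i. A (length a + i) \<in> lwords X (h i) (h (Suc i))"
    using tailsD(3)[OF A] by blast
  have "stem a d X (initial (length a + i) A) (h i)"
  proof (induction i)
    case 0
    then show ?case using tailsD(2)[OF A] h(1) stem.base by simp
  next
    case (Suc i)
    show ?case
      using stem.step[OF Suc h(2) word_seqs_nonempty[OF tailsD(1)[OF A]]] by (simp add: initial_Suc)
  qed
  then show ?thesis by blast
qed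

text \<open>Fusion over all extensions \<open>b\<close> of \<open>a\<close>. Once each of them is, locally, decided or has only undecidable
  successors, undecidability spreads from \<open>a\<close> by induction, since an undecidable \<open>b\<close> is not
  decided on any perfect piece of \<open>M\<close>.\<close>

lemma undecidable_stems:
  assumes M: "perfect_set M" and X: "X \<in> var_word_seqs L v" and und: "undecidable \<Lambda> M a X"
  shows "\<exists>M' X'. M' \<subseteq> M \<and> perfect_set M' \<and> X' \<in> ext d X \<and>
    (\<forall>b n. stem a d X' b n \<longrightarrow> undecidable \<Lambda> M' b X')"
proof -
  let ?\<Phi> = "\<lambda>M b m X. decided \<Lambda> M b m X \<or> (\<forall>w\<in>lspan X m. undecidable \<Lambda> M (b @ [w]) X)"
  have hered: "?\<Phi> M' b m X'" if P: "?\<Phi> M b m X" and sub: "M' \<subseteq> M" "X' \<in> ext m X" for M M' b m X X'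
  proof -
    obtain h where h: "reduces h X' X" using sub(2) by (auto simp: ext_iff)
    have "lspan X' m \<subseteq> lspan X m"
    proof
      fix w assume "w \<in> lspan X' m"
      then obtain k where k: "w \<in> lwords X' m k" "w \<noteq> []" by (auto simp: lspan_def)
      have "lwords X (h m) (h k) \<subseteq> lwords X m (h k)"
        by (rule combos_mono) (use reduces_ge[OF h] in auto)
      then show "w \<in> lspan X m" using reduces_lwords[OF h k(1)] k(2) by (auto simp: lspan_def)
    qed
    then show ?thesis
      using P decided_mono[OF _ sub(1) tails_ext[OF sub(2)]] undecidable_mono[OF _ sub] by blast
  qed
  have "\<exists>M' X'. M' \<subseteq> M \<and> perfect_set M' \<and> X' \<in> ext d X \<and>
      (\<forall>m\<ge>d. \<forall>b\<in>{b. stem a d X' b m}. \<forall>x\<in>M'. \<exists>l. ?\<Phi> (M' \<inter> cyl x l) b m X')"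
  proof (rule fusion[where \<Phi> = ?\<Phi> and B = "\<lambda>m X. {b. stem a d X b m}"])
    show "{b. stem a d X b m} = {b. stem a d X' b m}"
      if "\<And>i. i < m \<Longrightarrow> X i = X' i" for m X X'
      using stem_cong[of a d X _ m X'] stem_cong[of a d X' _ m X] that by (metis (no_types))
  qed (erule (2) hered, erule (1) decide_or_successors_undecidable, rule finite_stems, rule M, rule X)
  then obtain M' X' where M': "M' \<subseteq> M" "perfect_set M'" and X': "X' \<in> ext d X"
    and loc: "\<And>m b x. d \<le> m \<Longrightarrow> stem a d X' b m \<Longrightarrow> x \<in> M' \<Longrightarrow> \<exists>l. ?\<Phi> (M' \<inter> cyl x l) b m X'"
    by (elim exE conjE) simp
  have X'v: "X' \<in> var_word_seqs L v" using ext_var_word_seqs[OF X X'] .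
  have "undecidable \<Lambda> M' b X'" if "stem a d X' b n" for b n
    using that
  proof (induction rule: stem.induct)
    case base
    show ?case by (rule undecidable_mono[OF und M'(1) X'])
  next
    case (step b n w m)
    have w: "w \<in> lspan X' n" using step.hyps(2,3) by (auto simp: lspan_def)
    show ?case
    proof (rule undecidable_local)
      fix x assume x: "x \<in> M'"
      obtain l where l: "?\<Phi> (M' \<inter> cyl x l) b n X'" using loc[OF stem_ge[OF step.hyps(1)] step.hyps(1) x] by blast
      have "M' \<inter> cyl x l \<noteq> {}" using x cyl_self[of x l] by blast
      then have "perfect_set (M' \<inter> cyl x l)" by (rule perfect_Int_cyl[OF M'(2)])
      then have "\<not> decided \<Lambda> (M' \<inter> cyl x l) b n X'"
        using step.IH ext_refl[OF X'v, of 0] unfolding undecidable_def by blast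
      then show "\<exists>l. undecidable \<Lambda> (M' \<inter> cyl x l) (b @ [w]) X'" using l w by blast
    qed
  qed
  then show ?thesis using M' X' by blast
qed

section \<open>The equivalences\<close>

lemma basic_set_reduces:
  assumes Y: "Y \<in> var_word_seqs L v" and g: "reduces g X Y"
  shows "basic_set L v a X \<subseteq> basic_set L v a Y"
proof
  fix A assume "A \<in> basic_set L v a X"
  then obtain h where A: "A \<in> word_seqs L" "initial (length a) A = a"
    and h: "\<And>i. A i \<in> lwords X (h i) (h (Suc i))"
    using basic_set_iff[OF reduces_var_word_seqs[OF Y g]] by blast
  have "\<forall>i. A i \<in> lwords Y (g (h i)) (g (h (Suc i)))" using reduces_lwords[OF g h] by blast
  then show "A \<in> basic_set L v a Y"
    unfolding basic_set_iff[OF Y] using A by (intro conjI exI[of _ "\<lambda>i. g (h i)"])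
qed

text \<open>The sequence \<open>b\<close> supplied by the Baire property may be shorter than \<open>a\<close>; it is first lengthened, inside
  one of the sequences that begin with it, to an extension \<open>c\<close> of \<open>a\<close>.\<close>

lemma Ramsey_of_Baire:
  assumes baire: "perfectly_Baire L v \<Lambda>" and Q: "perfect_set Q" and a: "a \<in> approximations L"
    and Y: "Y \<in> var_word_seqs L v" and ne: "basic_set L v a Y \<noteq> {}"
    and d: "d = nat (depth L v Y a)"
  shows "\<exists>M X. M \<subseteq> Q \<and> perfect_set M \<and> X \<in> ext d Y \<and> decided \<Lambda> M a d X"
proof (rule ccontr)
  assume no: "\<not> ?thesis"
  have "undecidable \<Lambda> Q a Y"
    unfolding undecidable_def
  proof (intro allI impI notI)
    fix M X n assume M: "perfect_set M" "M \<subseteq> Q" and X: "X \<in> ext 0 Y" and dec: "decided \<Lambda> M a n X"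
    note sp = ext_splice[OF Y X, of d "max d n", simplified]
    have "decided \<Lambda> M a d (\<lambda>i. if i < d then Y i else X (i - d + max d n))"
      by (rule decided_mono[OF dec order_refl]) (use sp(2) tails_antimono[of n "max d n" a X] in auto)
    then show False using no M sp(1) by blast
  qed
  from undecidable_stems[OF Q Y this, of d]
  obtain M X where M: "M \<subseteq> Q" "perfect_set M" and X: "X \<in> ext d Y"
    and und': "\<forall>b n. stem a d X b n \<longrightarrow> undecidable \<Lambda> M b X" by (elim exE conjE)
  have und: "undecidable \<Lambda> M b X" if "stem a d X b n" for b n using und' that by blast
  have Xv: "X \<in> var_word_seqs L v" using ext_var_word_seqs[OF Y X] .
  note aX = basic_set_ext_depth[OF Y ne d X]
  from aX have "basic_set L v a X \<noteq> {}" by simp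
  then have "\<exists>M'. \<exists>b\<in>approximations L. \<exists>X'\<in>var_word_seqs L v. perfect_set M' \<and> M' \<subseteq> M \<and>
      basic_set L v b X' \<noteq> {} \<and> basic_set L v b X' \<subseteq> basic_set L v a X \<and>
      (M' \<times> basic_set L v b X' \<subseteq> \<Lambda> \<or> M' \<times> basic_set L v b X' \<subseteq> (UNIV \<times> word_seqs L) - \<Lambda>)"
    using baire a Xv M(2) unfolding perfectly_Baire_def by blast
  then obtain M' b X' where M': "perfect_set M'" "M' \<subseteq> M" and X'v: "X' \<in> var_word_seqs L v"
    and bX': "basic_set L v b X' \<noteq> {}" "basic_set L v b X' \<subseteq> basic_set L v a X"
    and dec: "M' \<times> basic_set L v b X' \<subseteq> \<Lambda> \<or> M' \<times> basic_set L v b X' \<subseteq> (UNIV \<times> word_seqs L) - \<Lambda>"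
    by (elim exE bexE conjE) simp
  obtain A where A: "A \<in> basic_set L v b X'" using bX'(1) by blast
  \<comment> \<open>Any length that is at least the lengths of a and of b would do.\<close>
  define c where "c = initial (length a + length b) A"
  have "A \<in> tails a d X" using A bX'(2) aX(1) by blast
  then obtain n where n: "stem a d X c n" using stem_of_tails unfolding c_def by blast
  have Ab: "A \<in> word_seqs L" "initial (length b) A = b"
    using iffD1[OF basic_set_iff[OF X'v] A] by simp_all
  have pre: "initial (length b) B = b" if B: "initial (length c) B = c" for B
  proof -
    have "take (length b) (initial (length c) E) = initial (length b) E" for E :: "nat \<Rightarrow> 'a list"
      by (simp add: initial_def take_map c_def)
    moreover have "initial (length c) B = initial (length c) A" using B by (simp add: c_def)
    ultimately show ?thesis using Ab(2) by metis
  qed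
  have "basic_set L v c X' \<subseteq> basic_set L v b X'"
  proof
    fix B assume "B \<in> basic_set L v c X'"
    then show "B \<in> basic_set L v b X'" unfolding basic_set_iff[OF X'v] using pre[of B] by (elim conjE) simp
  qed
  moreover have "A \<in> basic_set L v c X'"
    using A unfolding basic_set_iff[OF X'v] by (elim conjE) (simp add: c_def)
  moreover have "basic_set L v a X \<subseteq> basic_set L v [] X"
  proof
    fix B assume "B \<in> basic_set L v a X"
    then show "B \<in> basic_set L v [] X" unfolding basic_set_iff[OF Xv] by (elim conjE) (simp add: initial_def)
  qed
  ultimately have "basic_set L v c X' \<subseteq> basic_set L v [] X" "basic_set L v c X' \<noteq> {}"
      "basic_set L v c X' \<subseteq> basic_set L v b X'"
    using bX'(2) by blast+
  moreover from basic_set_contains_tails_of_reduction[OF Xv X'v this(1,2)]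
  obtain X'' where "X'' \<in> ext 0 X" "tails c 0 X'' \<subseteq> basic_set L v c X'" by (elim bexE)
  ultimately have X'': "X'' \<in> ext 0 X" "tails c 0 X'' \<subseteq> basic_set L v b X'" by simp_all
  have "decided \<Lambda> M' c 0 X''"
    unfolding decided_def using dec Sigma_mono[OF order_refl X''(2), of M'] by (meson order_trans)
  then show False using und[OF n] M' X''(1) unfolding undecidable_def by blast
qed

lemma perfectly_Ramsey_imp_Baire:
  assumes "perfectly_Ramsey L v \<Lambda>"
  shows "perfectly_Baire L v \<Lambda>"
  unfolding perfectly_Baire_def
proof (intro allI ballI impI)
  fix Q a Y assume a: "a \<in> approximations L" and Y: "Y \<in> var_word_seqs L v"
    and "perfect_set Q \<and> basic_set L v a Y \<noteq> {}"
  then obtain M X where X: "X \<in> var_basic_set L v (nat (depth L v Y a)) Y"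
    and M: "perfect_set M" "M \<subseteq> Q" "basic_set L v a X \<noteq> {}"
      "M \<times> basic_set L v a X \<subseteq> \<Lambda> \<or> M \<times> basic_set L v a X \<subseteq> (UNIV \<times> word_seqs L) - \<Lambda>"
    using assms unfolding perfectly_Ramsey_def by meson
  have Xv: "X \<in> var_word_seqs L v" and "var_seq_le L v X Y" using X by (simp_all add: var_basic_set_def)
  then obtain g where "reduces g X Y" using var_seq_le_iff[OF Y] by blast
  from basic_set_reduces[OF Y this, of a]
  show "\<exists>M. \<exists>b\<in>approximations L. \<exists>X\<in>var_word_seqs L v. perfect_set M \<and> M \<subseteq> Q \<and>
      basic_set L v b X \<noteq> {} \<and> basic_set L v b X \<subseteq> basic_set L v a Y \<and>
      (M \<times> basic_set L v b X \<subseteq> \<Lambda> \<or> M \<times> basic_set L v b X \<subseteq> (UNIV \<times> word_seqs L) - \<Lambda>)"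
    using M a Xv by (intro exI[of _ M] bexI[of _ a] bexI[of _ X]) simp_all
qed

lemma perfectly_Baire_imp_Ramsey:
  assumes "perfectly_Baire L v \<Lambda>"
  shows "perfectly_Ramsey L v \<Lambda>"
  unfolding perfectly_Ramsey_def
proof (intro allI ballI impI)
  fix Q a Y assume a: "a \<in> approximations L" and Y: "Y \<in> var_word_seqs L v"
    and Q: "perfect_set Q \<and> basic_set L v a Y \<noteq> {}"
  define d where "d = nat (depth L v Y a)"
  from Ramsey_of_Baire[OF assms conjunct1[OF Q] a Y conjunct2[OF Q] d_def]
  obtain M X where M: "M \<subseteq> Q" "perfect_set M" and X: "X \<in> ext d Y" and dec: "decided \<Lambda> M a d X"
    by (elim exE conjE)
  note aX = basic_set_ext_depth[OF Y conjunct2[OF Q] d_def X]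
  show "\<exists>M. \<exists>X\<in>var_basic_set L v (nat (depth L v Y a)) Y. perfect_set M \<and> M \<subseteq> Q \<and> basic_set L v a X \<noteq> {} \<and>
      (M \<times> basic_set L v a X \<subseteq> \<Lambda> \<or> M \<times> basic_set L v a X \<subseteq> (UNIV \<times> word_seqs L) - \<Lambda>)"
    unfolding d_def[symmetric]
    using M dec[unfolded decided_def] aX ext_var_basic_set[OF Y X]
    by (intro exI[of _ M] bexI[of _ X]) simp_all
qed

lemma perfectly_Ramsey_null_imp_meager:
  assumes "perfectly_Ramsey_null L v \<Lambda>"
  shows "perfectly_meager L v \<Lambda>"
  unfolding perfectly_meager_def
proof (intro allI ballI impI)
  fix Q a Y assume a: "a \<in> approximations L" and Y: "Y \<in> var_word_seqs L v"
    and "perfect_set Q \<and> basic_set L v a Y \<noteq> {}"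
  then obtain M X where X: "X \<in> var_basic_set L v (nat (depth L v Y a)) Y"
    and M: "perfect_set M" "M \<subseteq> Q" "basic_set L v a X \<noteq> {}"
      "M \<times> basic_set L v a X \<subseteq> (UNIV \<times> word_seqs L) - \<Lambda>"
    using assms unfolding perfectly_Ramsey_null_def by meson
  have Xv: "X \<in> var_word_seqs L v" and "var_seq_le L v X Y" using X by (simp_all add: var_basic_set_def)
  then obtain g where "reduces g X Y" using var_seq_le_iff[OF Y] by blast
  from basic_set_reduces[OF Y this, of a]
  show "\<exists>M. \<exists>b\<in>approximations L. \<exists>X\<in>var_word_seqs L v. perfect_set M \<and> M \<subseteq> Q \<and>
      basic_set L v b X \<noteq> {} \<and> basic_set L v b X \<subseteq> basic_set L v a Y \<and>
      M \<times> basic_set L v b X \<subseteq> (UNIV \<times> word_seqs L) - \<Lambda>"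
    using M a Xv by (intro exI[of _ M] bexI[of _ a] bexI[of _ X]) simp_all
qed

lemma perfectly_meager_imp_Ramsey_null:
  assumes meager: "perfectly_meager L v \<Lambda>"
  shows "perfectly_Ramsey_null L v \<Lambda>"
  unfolding perfectly_Ramsey_null_def
proof (intro allI ballI impI)
  fix Q a Y assume a: "a \<in> approximations L" and Y: "Y \<in> var_word_seqs L v"
    and Q: "perfect_set Q \<and> basic_set L v a Y \<noteq> {}"
  have "perfectly_Baire L v \<Lambda>"
    using meager unfolding perfectly_meager_def perfectly_Baire_def by meson
  then have "perfectly_Ramsey L v \<Lambda>" by (rule perfectly_Baire_imp_Ramsey)
  then obtain M X where X: "X \<in> var_basic_set L v (nat (depth L v Y a)) Y"
    and M: "perfect_set M" "M \<subseteq> Q" "basic_set L v a X \<noteq> {}"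
    and dec: "M \<times> basic_set L v a X \<subseteq> \<Lambda> \<or> M \<times> basic_set L v a X \<subseteq> (UNIV \<times> word_seqs L) - \<Lambda>"
    using a Y Q unfolding perfectly_Ramsey_def by meson
  have "X \<in> var_word_seqs L v" using X by (simp add: var_basic_set_def)
  then obtain M' b X' where M': "perfect_set M'" "M' \<subseteq> M" and b: "basic_set L v b X' \<noteq> {}"
    "basic_set L v b X' \<subseteq> basic_set L v a X" "M' \<times> basic_set L v b X' \<subseteq> (UNIV \<times> word_seqs L) - \<Lambda>"
    using meager a M unfolding perfectly_meager_def by meson
  obtain x A where xA: "x \<in> M'" "A \<in> basic_set L v b X'" using perfect_setD(1)[OF M'(1)] b(1) by blast
  then have "(x, A) \<notin> \<Lambda>" "x \<in> M" "A \<in> basic_set L v a X" using b(2,3) M'(2) by auto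
  then have "M \<times> basic_set L v a X \<subseteq> (UNIV \<times> word_seqs L) - \<Lambda>" using dec by auto
  then show "\<exists>M. \<exists>X\<in>var_basic_set L v (nat (depth L v Y a)) Y. perfect_set M \<and> M \<subseteq> Q \<and>
      basic_set L v a X \<noteq> {} \<and> M \<times> basic_set L v a X \<subseteq> (UNIV \<times> word_seqs L) - \<Lambda>"
    using M X by (intro exI[of _ M] bexI[of _ X]) simp_all
qed

end

theorem corollary1:
  fixes L :: "nat \<Rightarrow> 'a set" and v :: 'a
    and \<Lambda> :: "((nat \<Rightarrow> bool) \<times> (nat \<Rightarrow> 'a list)) set"
  assumes "\<And>n. finite (L n)"
    and "\<And>n. L n \<subseteq> L (Suc n)"
    and "v \<notin> (\<Union>n. L n)"
    and "\<Lambda> \<subseteq> UNIV \<times> word_seqs L"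
  shows "(perfectly_Ramsey L v \<Lambda> \<longleftrightarrow> perfectly_Baire L v \<Lambda>) \<and>
         (perfectly_Ramsey_null L v \<Lambda> \<longleftrightarrow> perfectly_meager L v \<Lambda>)"
proof (cases "(\<Union>n. L n) = {}")
  case True
  have "A \<notin> word_seqs L" for A
  proof
    assume A: "A \<in> word_seqs L"
    then have "A 0 \<in> words L" "A 0 \<noteq> []"
      using rapidly_increasing_nonempty[of A 0] by (simp_all add: word_seqs_def)
    then show False unfolding words_def True by simp
  qed
  then have "approximations L = {}" by (simp add: approximations_def)
  then show ?thesis
    by (simp add: perfectly_Ramsey_def perfectly_Baire_def perfectly_Ramsey_null_def perfectly_meager_def)
next
  case False
  interpret alphabet L v by unfold_locales (use assms False in auto)
  show ?thesis
    using perfectly_Ramsey_imp_Baire perfectly_Baire_imp_Ramsey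
      perfectly_Ramsey_null_imp_meager perfectly_meager_imp_Ramsey_null by blast
qed

end
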